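(* Let $(P,Q):[\tau_0,\infty)\times S^1\to\mathbb{R}^2$ be a smooth solution of \[ P_{\tau\tau}-e^{-2\tau}P_{\theta\theta}-e^{2P}(Q_\tau^2-e^{-2\tau}Q_\theta^2)=0,\qquad Q_{\tau\tau}-e^{-2\tau}Q_{\theta\theta}+2(P_\tau Q_\tau-e^{-2\tau}P_\theta Q_\theta)=0 . \] Assume that $\tau_0\ge 2$, that for some $\gamma>0$ and all $\theta\in S^1$ \[ 1\le P(\tau_0,\theta)\le \tau_0-1,\qquad \gamma\le \frac{1}{\tau_0}P(\tau_0,\theta)\le 1-\gamma, \] and that $F(\tau_0)\le(\gamma-\alpha)^2$ for some $\alpha$ with $0<\alpha<\gamma$. Then there are $v,\phi,q,r\in C^\infty(S^1,\mathbb{R})$ with \[ 0<\alpha\le v\le 1-\alpha<1 \quad\text{on } S^1, \] and, for every non-negative integer $k$, polynomials $\Xi_{i,k}$ ($i=1,\dots,4$) in $\tau$, such that for all $\tau\in[\tau_0,\infty)$, with $p=v\cdot\tau+\phi$, \[ \|P_\tau-v\|_{C^k(S^1,\mathbb{R})}\le \Xi_{1,k}e^{-\alpha\tau},\qquad \|P-p\|_{C^k(S^1,\mathbb{R})}\le \Xi_{2,k}e^{-\alpha\tau}, \] \[ \|e^{2p}Q_\tau-r\|_{C^k(S^1,\mathbb{R})}\le \Xi_{3,k}e^{-\alpha\tau},\qquad \Big\|e^{2p}(Q-q)+\frac{r}{2v}\Big\|_{C^k(S^1,\mathbb{R})}\le \Xi_{4,k}e^{-\alpha\tau}. \]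
   Context: $S^1=\mathbb{R}/2\pi\mathbb{Z}$ with coordinate $\theta$; the functions in the norms are evaluated at time $\tau$, and $\|\cdot\|_{C^k(S^1,\mathbb{R})}$ is the sum of the sup norms over $S^1$ of the $\theta$-derivatives of order $0,\dots,k$. The function $F$ is defined by \[ F(\tau)=\tfrac12\sup_{\theta\in S^1}\Big[(P_\tau-\tfrac1\tau P+e^{-\tau}P_\theta)^2+e^{2P}(Q_\tau+e^{-\tau}Q_\theta)^2\Big] +\tfrac12\sup_{\theta\in S^1}\Big[(P_\tau-\tfrac1\tau P-e^{-\tau}P_\theta)^2+e^{2P}(Q_\tau-e^{-\tau}Q_\theta)^2\Big], \] all quantities evaluated at $(\tau,\theta)$. *)

theory Defs
  imports "HOL-Analysis.Analysis" "HOL-Computational_Algebra.Polynomial"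
begin

text \<open>Functions of (tau, theta) are curried: f tau theta. The time domain is [t0, infinity);
  tau-derivatives are one-sided at t0 (taken within [t0, infinity)).\<close>

definition dtau :: "real \<Rightarrow> (real \<Rightarrow> real \<Rightarrow> real) \<Rightarrow> real \<Rightarrow> real \<Rightarrow> real" where
  "dtau t0 f t x = vector_derivative (\<lambda>s. f s x) (at t within {t0..})"

definition dth :: "(real \<Rightarrow> real \<Rightarrow> real) \<Rightarrow> real \<Rightarrow> real \<Rightarrow> real" where
  "dth f t x = deriv (f t) x"

fun Dlist :: "real \<Rightarrow> bool list \<Rightarrow> (real \<Rightarrow> real \<Rightarrow> real) \<Rightarrow> real \<Rightarrow> real \<Rightarrow> real" where
  "Dlist t0 [] f = f"
| "Dlist t0 (b # bs) f = (if b then dtau t0 else dth) (Dlist t0 bs f)"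

definition smooth_half :: "real \<Rightarrow> (real \<Rightarrow> real \<Rightarrow> real) \<Rightarrow> bool" where
  "smooth_half t0 f \<longleftrightarrow>
     (\<forall>t\<ge>t0. \<forall>x. f t (x + 2 * pi) = f t x) \<and>
     (\<forall>bs. continuous_on ({t0..} \<times> UNIV) (\<lambda>(t, x). Dlist t0 bs f t x) \<and>
           (\<forall>z \<in> {t0..} \<times> UNIV. (\<lambda>(t, x). Dlist t0 bs f t x) differentiable (at z within {t0..} \<times> UNIV)))"

definition smooth_S1 :: "(real \<Rightarrow> real) \<Rightarrow> bool" where
  "smooth_S1 g \<longleftrightarrow> (\<forall>x. g (x + 2 * pi) = g x) \<and> (\<forall>n x. (deriv ^^ n) g differentiable (at x))"

definition Ck_norm :: "nat \<Rightarrow> (real \<Rightarrow> real) \<Rightarrow> real" where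
  "Ck_norm k g = (\<Sum>j\<le>k. (SUP x. \<bar>(deriv ^^ j) g x\<bar>))"

definition Fen :: "real \<Rightarrow> (real \<Rightarrow> real \<Rightarrow> real) \<Rightarrow> (real \<Rightarrow> real \<Rightarrow> real) \<Rightarrow> real \<Rightarrow> real" where
  "Fen t0 P Q t =
     1/2 * (SUP x. (dtau t0 P t x - 1/t * P t x + exp (-t) * dth P t x)\<^sup>2
                  + exp (2 * P t x) * (dtau t0 Q t x + exp (-t) * dth Q t x)\<^sup>2)
   + 1/2 * (SUP x. (dtau t0 P t x - 1/t * P t x - exp (-t) * dth P t x)\<^sup>2
                  + exp (2 * P t x) * (dtau t0 Q t x - exp (-t) * dth Q t x)\<^sup>2)"

end

theory Submission
  imports Defs
begin

text \<open>Put \<open>u\<^sub>\<plusminus> = P\<^sub>\<tau> \<plusminus> e\<^bsup>-\<tau>\<^esup> P\<^sub>\<theta>\<close> and \<open>W\<^sub>\<plusminus> = e\<^bsup>P\<^esup> (Q\<^sub>\<tau> \<plusminus> e\<^bsup>-\<tau>\<^esup> Q\<^sub>\<theta>)\<close>. The equations become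
  a quadratic first-order system that transports \<open>u\<^sub>\<plusminus>, W\<^sub>\<plusminus>\<close> along the two families of characteristics, so
  sup-norm bounds follow from a comparison principle: at a first touching point with an
  \<open>x\<close>-independent barrier the \<open>x\<close>-derivative vanishes, and the system bounds the \<open>\<tau>\<close>-derivative.

  While \<open>1 \<le> P \<le> \<tau> - 1\<close>, the densities \<open>(u\<^sub>\<plusminus> - P/\<tau>)\<^sup>2 + W\<^sub>\<plusminus>\<^sup>2\<close> decay like \<open>\<tau>\<^bsup>-2\<^esup>\<close>; integrating
  \<open>\<partial>\<^sub>\<tau> (P/\<tau>)\<close> gives \<open>\<alpha> \<le> P\<^sub>\<tau> \<le> 1 - \<alpha>\<close>, which makes the range of \<open>P\<close> persist. As
  \<open>\<bar>1/2 - u\<^sub>\<plusminus>\<bar> \<le> 1/2 - \<alpha> + C/\<tau>\<close>, the \<open>W\<^sub>\<plusminus>\<close> decay like \<open>e\<^bsup>-\<alpha>\<tau>\<^esup>\<close> up to a power of \<open>\<tau>\<close>, and the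
  linearised system gives the same for all \<open>\<theta>\<close>-derivatives. Then \<open>P\<^sub>\<tau>\<^sub>\<tau>\<close>, \<open>\<partial>\<^sub>\<tau> (e\<^bsup>2P\<^esup> Q\<^sub>\<tau>)\<close> and \<open>Q\<^sub>\<tau>\<close>
  are integrable at infinity, which yields \<open>v, \<phi>, r, q\<close>; the last estimate comes from the
  equation \<open>R\<^sub>\<tau> = 2 v R + (e\<^bsup>2p\<^esup> Q\<^sub>\<tau> - r)\<close> for \<open>R = e\<^bsup>2p\<^esup> (Q - q) + r / (2 v)\<close>, solved
  backwards from infinity.\<close>

section \<open>Smooth functions on the half-cylinder\<close>

text \<open>The total derivative relative to the closed half-space, with both partials named as
  functions. Sums, products and compositions are differentiated in this form, and one-sidedness at
  \<open>t0\<close> is built in.\<close>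

definition partials :: "real \<Rightarrow> (real \<Rightarrow> real \<Rightarrow> real) \<Rightarrow> (real \<Rightarrow> real \<Rightarrow> real) \<Rightarrow> (real \<Rightarrow> real \<Rightarrow> real) \<Rightarrow> bool" where
  "partials t0 f g h \<longleftrightarrow> (\<forall>t\<ge>t0. \<forall>x. ((\<lambda>z. f (fst z) (snd z)) has_derivative
     (\<lambda>w. g t x * fst w + h t x * snd w)) (at (t, x) within {t0..} \<times> UNIV))"

text \<open>Even \<open>t = t0\<close> is a limit point of the half line, so the one-sided
  derivative there is unique.\<close>

lemma nontrivial_within_half_line: "t0 \<le> t \<Longrightarrow> at t within {t0..} \<noteq> (bot :: real filter)"
proof -
  assume "t0 \<le> t"
  have "t islimpt {t0..t+1}"
    using \<open>t0 \<le> t\<close> by (simp add: islimpt_Icc)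
  then have "t islimpt {t0..}" by (rule islimpt_subset) auto
  then show ?thesis by (simp add: trivial_limit_within)
qed

text \<open>The curve \<open>s \<mapsto> (s, x)\<close> pulls the total derivative back to the half
  line; uniqueness of the one-sided derivative then identifies \<open>dtau\<close>.\<close>

lemma has_derivative_pair_dtau:
  assumes "((\<lambda>z. f (fst z) (snd z)) has_derivative (\<lambda>w. a * fst w + b * snd w))
     (at (t, x) within {t0..} \<times> UNIV)" and t: "t0 \<le> t"
  shows "((\<lambda>s. f s x) has_real_derivative a) (at t within {t0..})" "dtau t0 f t x = a"
proof -
  have "((\<lambda>z. f (fst z) (snd z)) \<circ> (\<lambda>s. (s, x)) has_derivative
     (\<lambda>w. a * fst w + b * snd w) \<circ> (\<lambda>s. (s, 0))) (at t within {t0..})"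
  proof (rule diff_chain_within)
    show "((\<lambda>s. (s, x)) has_derivative (\<lambda>s. (s, 0))) (at t within {t0..})"
      by (auto intro!: derivative_eq_intros)
    show "((\<lambda>z. f (fst z) (snd z)) has_derivative (\<lambda>w. a * fst w + b * snd w))
       (at (t, x) within (\<lambda>s. (s, x)) ` {t0..})"
      by (rule has_derivative_subset[OF assms(1)]) auto
  qed
  then show 1: "((\<lambda>s. f s x) has_real_derivative a) (at t within {t0..})"
    by (simp add: o_def has_field_derivative_def)
  show "dtau t0 f t x = a"
    unfolding dtau_def
    by (rule vector_derivative_within[OF nontrivial_within_half_line[OF t]])
       (use 1 in \<open>simp add: has_real_derivative_iff_has_vector_derivative\<close>)
qed

lemma has_derivative_pair_dth:
  assumes "((\<lambda>z. f (fst z) (snd z)) has_derivative (\<lambda>w. a * fst w + b * snd w))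
     (at (t, x) within {t0..} \<times> UNIV)" and t: "t0 \<le> t"
  shows "(f t has_real_derivative b) (at x)" "dth f t x = b"
proof -
  have "((\<lambda>z. f (fst z) (snd z)) \<circ> (\<lambda>y. (t, y)) has_derivative
     (\<lambda>w. a * fst w + b * snd w) \<circ> (\<lambda>s. (0, s))) (at x)"
  proof (rule diff_chain_within)
    show "((\<lambda>y. (t, y)) has_derivative (\<lambda>s. (0, s))) (at x)"
      by (auto intro!: derivative_eq_intros)
    show "((\<lambda>z. f (fst z) (snd z)) has_derivative (\<lambda>w. a * fst w + b * snd w))
       (at (t, x) within range (\<lambda>y. (t, y)))"
      by (rule has_derivative_subset[OF assms(1)]) (use t in auto)
  qed
  then show 1: "(f t has_real_derivative b) (at x)"
    by (simp add: o_def has_field_derivative_def)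
  then show "dth f t x = b" by (simp add: dth_def DERIV_imp_deriv)
qed

lemma partials_dtau:
  assumes "partials t0 f g h" "t0 \<le> t"
  shows "((\<lambda>s. f s x) has_real_derivative g t x) (at t within {t0..})" "dtau t0 f t x = g t x"
  using has_derivative_pair_dtau[of f "g t x" "h t x" t x t0] assms by (auto simp: partials_def)

lemma partials_dth:
  assumes "partials t0 f g h" "t0 \<le> t"
  shows "(f t has_real_derivative h t x) (at x)" "dth f t x = h t x"
  using has_derivative_pair_dth[of f "g t x" "h t x" t x t0] assms by (auto simp: partials_def)

lemma dtau_cong:
  assumes "\<And>s. t0 \<le> s \<Longrightarrow> f s x = g s y" "t0 \<le> t"
  shows "dtau t0 f t x = dtau t0 g t y"
proof -
  have "((\<lambda>s. f s x) has_vector_derivative d) (at t within {t0..}) \<longleftrightarrow>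
        ((\<lambda>s. g s y) has_vector_derivative d) (at t within {t0..})" for d
    using assms by (intro has_vector_derivative_cong_ev) (auto intro!: always_eventually)
  then show ?thesis by (simp add: dtau_def vector_derivative_def)
qed

lemma dth_cong: "(\<And>x. f t x = g t x) \<Longrightarrow> dth f t x = dth g t x"
  by (metis dth_def ext)

lemma smooth_half_D:
  assumes "smooth_half t0 f"
  shows "continuous_on ({t0..} \<times> UNIV) (\<lambda>(t, x). Dlist t0 bs f t x)"
    "z \<in> {t0..} \<times> UNIV \<Longrightarrow> (\<lambda>(t, x). Dlist t0 bs f t x) differentiable (at z within {t0..} \<times> UNIV)"
  using assms[unfolded smooth_half_def, THEN conjunct2, THEN spec, of bs, THEN conjunct1]
    assms[unfolded smooth_half_def, THEN conjunct2, THEN spec, of bs, THEN conjunct2, THEN bspec, of z]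
  by simp_all

text \<open>Smoothness supplies some linear derivative. Linearity splits it along the two unit
  vectors, and restriction to coordinate lines identifies the two coefficients.\<close>

lemma smooth_half_partials:
  assumes "smooth_half t0 f"
  shows "partials t0 f (dtau t0 f) (dth f)"
proof -
  have "((\<lambda>z. f (fst z) (snd z)) has_derivative (\<lambda>w. dtau t0 f t x * fst w + dth f t x * snd w))
      (at (t, x) within {t0..} \<times> UNIV)" if t: "t \<ge> t0" for t x
  proof -
    have "(\<lambda>(t, x). Dlist t0 [] f t x) differentiable (at (t, x) within {t0..} \<times> UNIV)"
      by (rule smooth_half_D(2)[OF assms]) (use t in auto)
    then obtain L where L: "((\<lambda>z. f (fst z) (snd z)) has_derivative L) (at (t, x) within {t0..} \<times> UNIV)"
      by (auto simp: differentiable_def case_prod_unfold)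
    have lin: "linear L" using L has_derivative_linear by blast
    have "L w = L (1,0) * fst w + L (0,1) * snd w" for w
    proof -
      have "w = fst w *\<^sub>R (1,0) + snd w *\<^sub>R (0,1)" by (cases w) simp
      then have "L w = L (fst w *\<^sub>R (1,0) + snd w *\<^sub>R (0,1))" by simp
      also have "\<dots> = fst w *\<^sub>R L (1,0) + snd w *\<^sub>R L (0,1)"
        by (simp only: linear_add[OF lin] linear_scale[OF lin])
      finally have "L w = fst w *\<^sub>R L (1,0) + snd w *\<^sub>R L (0,1)" .
      then show ?thesis by (simp add: mult.commute)
    qed
    then have "L = (\<lambda>w. L (1,0) * fst w + L (0,1) * snd w)" by (rule ext)
    with L have L': "((\<lambda>z. f (fst z) (snd z)) has_derivative (\<lambda>w. L (1,0) * fst w + L (0,1) * snd w))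
        (at (t, x) within {t0..} \<times> UNIV)" by simp
    show ?thesis
      using has_derivative_pair_dtau(2)[OF L' t] has_derivative_pair_dth(2)[OF L' t] L' by simp
  qed
  then show ?thesis by (auto simp: partials_def)
qed

section \<open>Closure of smoothness under partial derivatives and elementary operations\<close>

named_theorems smooth_intros

text \<open>The head of the list acts last, so the iterated derivatives of \<open>dtau t0 f\<close>
  and \<open>dth f\<close> are iterated derivatives of \<open>f\<close> with one letter appended.
  Both partials therefore inherit smoothness.\<close>

lemma Dlist_append: "Dlist t0 (bs @ cs) f = Dlist t0 bs (Dlist t0 cs f)"
  by (induction bs) auto

lemma smooth_half_periodic: "smooth_half t0 f \<Longrightarrow> t \<ge> t0 \<Longrightarrow> f t (x + 2 * pi) = f t x"
  by (auto simp: smooth_half_def)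

lemma periodic_deriv:
  assumes "\<And>x. g (x + c) = g x"
  shows "deriv g (x + c) = deriv g (x::real)"
proof -
  have "(g has_real_derivative d) (at (x + c)) \<longleftrightarrow> (g has_real_derivative d) (at x)" for d
    using DERIV_shift[of g d x c] assms by simp
  then show ?thesis by (simp add: deriv_def)
qed

lemma smooth_halfI:
  assumes "\<And>t x. t \<ge> t0 \<Longrightarrow> f t (x + 2 * pi) = f t x"
    and "\<And>bs. continuous_on ({t0..} \<times> UNIV) (\<lambda>(t, x). Dlist t0 bs f t x)"
    and "\<And>bs z. z \<in> {t0..} \<times> UNIV \<Longrightarrow> (\<lambda>(t, x). Dlist t0 bs f t x) differentiable (at z within {t0..} \<times> UNIV)"
  shows "smooth_half t0 f"
  unfolding smooth_half_def by (intro conjI allI impI ballI assms)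

lemma smooth_half_dtau [smooth_intros]:
  assumes "smooth_half t0 f"
  shows "smooth_half t0 (dtau t0 f)"
proof (rule smooth_halfI)
  have eq: "Dlist t0 bs (dtau t0 f) = Dlist t0 (bs @ [True]) f" for bs
    by (simp add: Dlist_append)
  show "dtau t0 f t (x + 2 * pi) = dtau t0 f t x" if "t \<ge> t0" for t x
    using that smooth_half_periodic[OF assms] by (intro dtau_cong)
  show "continuous_on ({t0..} \<times> UNIV) (\<lambda>(t, x). Dlist t0 bs (dtau t0 f) t x)" for bs
    unfolding eq by (rule smooth_half_D[OF assms])
  show "(\<lambda>(t, x). Dlist t0 bs (dtau t0 f) t x) differentiable (at z within {t0..} \<times> UNIV)"
    if "z \<in> {t0..} \<times> UNIV" for bs z
    unfolding eq by (rule smooth_half_D(2)[OF assms that])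
qed

lemma smooth_half_dth [smooth_intros]:
  assumes "smooth_half t0 f"
  shows "smooth_half t0 (dth f)"
proof (rule smooth_halfI)
  have eq: "Dlist t0 bs (dth f) = Dlist t0 (bs @ [False]) f" for bs
    by (simp add: Dlist_append)
  show "dth f t (x + 2 * pi) = dth f t x" if "t \<ge> t0" for t x
    using that smooth_half_periodic[OF assms] by (simp add: dth_def periodic_deriv)
  show "continuous_on ({t0..} \<times> UNIV) (\<lambda>(t, x). Dlist t0 bs (dth f) t x)" for bs
    unfolding eq by (rule smooth_half_D[OF assms])
  show "(\<lambda>(t, x). Dlist t0 bs (dth f) t x) differentiable (at z within {t0..} \<times> UNIV)"
    if "z \<in> {t0..} \<times> UNIV" for bs z
    unfolding eq by (rule smooth_half_D(2)[OF assms that])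
qed

text \<open>Closure properties of smoothness are obtained by coinduction: it suffices that the class
  generated by the operations is closed under both partial derivatives.\<close>

inductive smooth_gen :: "real \<Rightarrow> (real \<Rightarrow> real \<Rightarrow> real) \<Rightarrow> bool" for t0 where
  base: "smooth_half t0 f \<Longrightarrow> smooth_gen t0 f"
| const: "smooth_gen t0 (\<lambda>t x. c)"
| time: "smooth_gen t0 (\<lambda>t x. t)"
| static: "smooth_S1 h \<Longrightarrow> smooth_gen t0 (\<lambda>t. h)"
| add: "smooth_gen t0 f \<Longrightarrow> smooth_gen t0 g \<Longrightarrow> smooth_gen t0 (\<lambda>t x. f t x + g t x)"
| mult: "smooth_gen t0 f \<Longrightarrow> smooth_gen t0 g \<Longrightarrow> smooth_gen t0 (\<lambda>t x. f t x * g t x)"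
| exp: "smooth_gen t0 f \<Longrightarrow> smooth_gen t0 (\<lambda>t x. exp (f t x))"
| inverse: "smooth_gen t0 f \<Longrightarrow> (\<And>t x. t0 \<le> t \<Longrightarrow> f t x \<noteq> 0) \<Longrightarrow> smooth_gen t0 (\<lambda>t x. inverse (f t x))"

lemma smooth_S1_deriv: 
  assumes "smooth_S1 h"
  shows "smooth_S1 (deriv h)"
  unfolding smooth_S1_def
proof (intro conjI allI)
  show "deriv h (x + 2 * pi) = deriv h x" for x
    using assms by (intro periodic_deriv) (simp add: smooth_S1_def)
  show "(deriv ^^ n) (deriv h) differentiable at x" for n x
    using assms[unfolded smooth_S1_def, THEN conjunct2, rule_format, of "Suc n" x]
    by (simp only: funpow_Suc_right o_def)
qed

lemma smooth_S1_DERIV: 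
  assumes "smooth_S1 h" shows "(h has_real_derivative deriv h x) (at x)"
  using assms[unfolded smooth_S1_def, THEN conjunct2, rule_format, of 0 x]
  by (simp add: DERIV_deriv_iff_real_differentiable)

lemma smooth_gen_periodic: "smooth_gen t0 f \<Longrightarrow> t0 \<le> t \<Longrightarrow> f t (x + 2 * pi) = f t x"
  by (induction rule: smooth_gen.induct) (auto simp: smooth_half_periodic smooth_S1_def)

text \<open>Linearity, the Leibniz rule and the chain rule express each partial by generators again;
  this is the closure that iterates to all orders.\<close>

lemma smooth_gen_partials: "smooth_gen t0 f \<Longrightarrow> \<exists>g h. smooth_gen t0 g \<and> smooth_gen t0 h \<and> partials t0 f g h"
proof (induction rule: smooth_gen.induct)
  case (base f)
  then show ?case using smooth_half_partials smooth_half_dth smooth_half_dtau smooth_gen.base by blast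
next
  case (const c)
  have "partials t0 (\<lambda>t x. c) (\<lambda>t x. 0) (\<lambda>t x. 0)" by (auto simp: partials_def)
  then show ?case using smooth_gen.const by blast
next
  case time
  have "partials t0 (\<lambda>t x. t) (\<lambda>t x. 1) (\<lambda>t x. 0)"
    by (auto simp: partials_def intro!: derivative_eq_intros)
  then show ?case using smooth_gen.const by blast
next
  case (static h)
  have "((\<lambda>z. h (snd z)) has_derivative (\<lambda>w. deriv h x * snd w)) (at (t, x) within {t0..} \<times> UNIV)" for t x
    by (rule has_derivative_compose[of snd snd _ _ h "(*) (deriv h x)", OF has_derivative_snd[OF has_derivative_ident]])
       (use smooth_S1_DERIV[OF static] in \<open>simp add: has_field_derivative_def\<close>)
  then have "partials t0 (\<lambda>t. h) (\<lambda>t x. 0) (\<lambda>t. deriv h)"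
    by (auto simp: partials_def)
  then show ?case using smooth_gen.const smooth_gen.static smooth_S1_deriv[OF static] by blast
next
  case (add f g)
  then obtain f1 f2 g1 g2 where *: "smooth_gen t0 f1" "smooth_gen t0 f2" "smooth_gen t0 g1" "smooth_gen t0 g2"
    "partials t0 f f1 f2" "partials t0 g g1 g2" by blast
  have "partials t0 (\<lambda>t x. f t x + g t x) (\<lambda>t x. f1 t x + g1 t x) (\<lambda>t x. f2 t x + g2 t x)"
    using *(5,6) unfolding partials_def
    by (auto intro!: derivative_eq_intros simp: algebra_simps)
  moreover have "smooth_gen t0 (\<lambda>t x. f1 t x + g1 t x)" "smooth_gen t0 (\<lambda>t x. f2 t x + g2 t x)"
    by (intro smooth_gen.add *)+
  ultimately show ?case by blast
next
  case (mult f g)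
  then obtain f1 f2 g1 g2 where *: "smooth_gen t0 f1" "smooth_gen t0 f2" "smooth_gen t0 g1" "smooth_gen t0 g2"
    "partials t0 f f1 f2" "partials t0 g g1 g2" by blast
  have "partials t0 (\<lambda>t x. f t x * g t x) (\<lambda>t x. f1 t x * g t x + f t x * g1 t x) (\<lambda>t x. f2 t x * g t x + f t x * g2 t x)"
    using *(5,6) unfolding partials_def
    by (auto intro!: derivative_eq_intros simp: algebra_simps)
  moreover have "smooth_gen t0 (\<lambda>t x. f1 t x * g t x + f t x * g1 t x)" "smooth_gen t0 (\<lambda>t x. f2 t x * g t x + f t x * g2 t x)"
    by (intro smooth_gen.add smooth_gen.mult * mult)+
  ultimately show ?case by blast
next
  case (exp f)
  then obtain f1 f2 where *: "smooth_gen t0 f1" "smooth_gen t0 f2" "partials t0 f f1 f2" by blast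
  have "partials t0 (\<lambda>t x. exp (f t x)) (\<lambda>t x. f1 t x * exp (f t x)) (\<lambda>t x. f2 t x * exp (f t x))"
    using *(3) unfolding partials_def
    by (auto intro!: derivative_eq_intros simp: algebra_simps)
  moreover have "smooth_gen t0 (\<lambda>t x. f1 t x * exp (f t x))" "smooth_gen t0 (\<lambda>t x. f2 t x * exp (f t x))"
    by (intro smooth_gen.exp smooth_gen.mult * exp)+
  ultimately show ?case by blast
next
  case (inverse f)
  then obtain f1 f2 where *: "smooth_gen t0 f1" "smooth_gen t0 f2" "partials t0 f f1 f2" by blast
  \<comment> \<open>The derivative of inversion, minus the inverse square, spelled as products so
    that it stays in the generated class.\<close>
  define k where "k = (\<lambda>t x. (-1) * (inverse (f t x) * inverse (f t x)))"
  have k: "smooth_gen t0 k" unfolding k_def by (intro smooth_gen.mult smooth_gen.const smooth_gen.inverse inverse)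
  have "partials t0 (\<lambda>t x. inverse (f t x)) (\<lambda>t x. f1 t x * k t x) (\<lambda>t x. f2 t x * k t x)"
    using *(3) inverse(2) unfolding partials_def k_def
    by (auto intro!: derivative_eq_intros simp: algebra_simps)
  moreover have "smooth_gen t0 (\<lambda>t x. f1 t x * k t x)" "smooth_gen t0 (\<lambda>t x. f2 t x * k t x)"
    by (intro smooth_gen.mult * k)+
  ultimately show ?case by blast
qed

text \<open>The partials are determined only for \<open>t \<ge> t0\<close>, so each iterated
  derivative is matched with a generated function there rather than by equality of functions. The
  one-sided time derivative does not see the difference.\<close>

lemma smooth_gen_Dlist: "smooth_gen t0 f \<Longrightarrow> \<exists>g. smooth_gen t0 g \<and> (\<forall>t\<ge>t0. \<forall>x. Dlist t0 bs f t x = g t x)"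
proof (induction bs)
  case Nil
  then show ?case by auto
next
  case (Cons b bs)
  then obtain g where g: "smooth_gen t0 g" "\<forall>t\<ge>t0. \<forall>x. Dlist t0 bs f t x = g t x" by blast
  obtain g1 g2 where p: "smooth_gen t0 g1" "smooth_gen t0 g2" "partials t0 g g1 g2"
    using smooth_gen_partials[OF g(1)] by blast
  have "dtau t0 (Dlist t0 bs f) t x = g1 t x" if "t \<ge> t0" for t x
    using dtau_cong[of t0 "Dlist t0 bs f" x g x t] partials_dtau(2)[OF p(3) that] g(2) that by simp
  moreover have "dth (Dlist t0 bs f) t x = g2 t x" if "t \<ge> t0" for t x
    using dth_cong[of "Dlist t0 bs f" t g x] partials_dth(2)[OF p(3) that] g(2) that by simp
  ultimately show ?case using p by (cases b) auto
qed

text \<open>Every iterated derivative agrees on the half-space with a generated function, which has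
  a total derivative; continuity is then automatic.\<close>

lemma smooth_half_smooth_gen: assumes "smooth_gen t0 f" shows "smooth_half t0 f"
proof -
  have D: "(\<lambda>(t, x). Dlist t0 bs f t x) differentiable (at z within {t0..} \<times> UNIV)"
    if "z \<in> {t0..} \<times> UNIV" for bs z
  proof -
    obtain g where g: "smooth_gen t0 g" "\<forall>t\<ge>t0. \<forall>x. Dlist t0 bs f t x = g t x"
      using smooth_gen_Dlist[OF assms] by blast
    obtain g1 g2 where p: "partials t0 g g1 g2" using smooth_gen_partials[OF g(1)] by blast
    have "(\<lambda>z. g (fst z) (snd z)) differentiable (at z within {t0..} \<times> UNIV)"
      using p that unfolding partials_def differentiable_def by (cases z) blast
    then show ?thesis
      by (rule differentiable_transform_within[OF _ zero_less_one that])
         (use g(2) in \<open>auto simp: split_beta\<close>)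
  qed
  show ?thesis
  proof (rule smooth_halfI)
    show "continuous_on ({t0..} \<times> UNIV) (\<lambda>(t, x). Dlist t0 bs f t x)" for bs
      by (rule differentiable_imp_continuous_on) (use D in \<open>auto simp: differentiable_on_def\<close>)
  qed (use smooth_gen_periodic[OF assms] D in auto)
qed

lemma smooth_half_const [smooth_intros]: "smooth_half t0 (\<lambda>t x. c)"
  by (rule smooth_half_smooth_gen[OF smooth_gen.const])

lemma smooth_half_time [smooth_intros]: "smooth_half t0 (\<lambda>t x. t)"
  by (rule smooth_half_smooth_gen[OF smooth_gen.time])

lemma smooth_half_static: "smooth_S1 h \<Longrightarrow> smooth_half t0 (\<lambda>t. h)"
  by (rule smooth_half_smooth_gen[OF smooth_gen.static])

lemma smooth_half_add [smooth_intros]: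
  "smooth_half t0 f \<Longrightarrow> smooth_half t0 g \<Longrightarrow> smooth_half t0 (\<lambda>t x. f t x + g t x)"
  by (rule smooth_half_smooth_gen[OF smooth_gen.add[OF smooth_gen.base smooth_gen.base]])

lemma smooth_half_mult [smooth_intros]:
  "smooth_half t0 f \<Longrightarrow> smooth_half t0 g \<Longrightarrow> smooth_half t0 (\<lambda>t x. f t x * g t x)"
  by (rule smooth_half_smooth_gen[OF smooth_gen.mult[OF smooth_gen.base smooth_gen.base]])

lemma smooth_half_exp [smooth_intros]: "smooth_half t0 f \<Longrightarrow> smooth_half t0 (\<lambda>t x. exp (f t x))"
  by (rule smooth_half_smooth_gen[OF smooth_gen.exp[OF smooth_gen.base]])

lemma smooth_half_inverse:
  "smooth_half t0 f \<Longrightarrow> (\<And>t x. t0 \<le> t \<Longrightarrow> f t x \<noteq> 0) \<Longrightarrow> smooth_half t0 (\<lambda>t x. inverse (f t x))"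
  by (rule smooth_half_smooth_gen[OF smooth_gen.inverse[OF smooth_gen.base]])

lemma smooth_half_uminus [smooth_intros]: "smooth_half t0 f \<Longrightarrow> smooth_half t0 (\<lambda>t x. - f t x)"
  using smooth_half_mult[OF smooth_half_const, of t0 f "-1"] by simp

lemma smooth_half_diff [smooth_intros]:
  "smooth_half t0 f \<Longrightarrow> smooth_half t0 g \<Longrightarrow> smooth_half t0 (\<lambda>t x. f t x - g t x)"
  using smooth_half_add[OF _ smooth_half_uminus, of t0 f g] by simp

lemma smooth_half_power [smooth_intros]: "smooth_half t0 f \<Longrightarrow> smooth_half t0 (\<lambda>t x. f t x ^ n)"
  by (induction n) (simp_all add: smooth_half_const smooth_half_mult)

lemma smooth_half_DERIV_tau:
  "smooth_half t0 f \<Longrightarrow> t0 \<le> t \<Longrightarrow> ((\<lambda>s. f s x) has_real_derivative dtau t0 f t x) (at t within {t0..})"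
  by (rule partials_dtau(1)[OF smooth_half_partials])

lemma smooth_half_DERIV_th:
  "smooth_half t0 f \<Longrightarrow> t0 \<le> t \<Longrightarrow> (f t has_real_derivative dth f t x) (at x)"
  by (rule partials_dth(1)[OF smooth_half_partials])

lemma dtau_eqI: "((\<lambda>s. f s x) has_real_derivative d) (at t within {t0..}) \<Longrightarrow> t0 \<le> t \<Longrightarrow> dtau t0 f t x = d"
  unfolding dtau_def
  by (rule vector_derivative_within[OF nontrivial_within_half_line])
     (simp_all add: has_real_derivative_iff_has_vector_derivative)

lemma dth_eqI: "(f t has_real_derivative d) (at x) \<Longrightarrow> dth f t x = d"
  by (simp add: dth_def DERIV_imp_deriv)

lemma smooth_half_continuous:
  "smooth_half t0 f \<Longrightarrow> continuous_on ({t0..} \<times> UNIV) (\<lambda>(t, x). f t x)"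
  using smooth_half_D(1)[of t0 f "[]"] by simp

text \<open>Symmetry of mixed partials up to the boundary \<open>t0\<close>: \<open>f\<close> is its
  value at \<open>t0\<close> plus the time integral of \<open>dtau t0 f\<close>, the integral is
  differentiated in x under the integral sign, and the resulting identity is differentiated in
  time.\<close>

lemma smooth_half_dth_dtau:
  assumes "smooth_half t0 f" "t0 \<le> t"
  shows "dtau t0 (dth f) t x = dth (dtau t0 f) t x"
proof -
  \<comment> \<open>The integrals live on a compact time interval. Ending it past \<open>t\<close>
    keeps \<open>t\<close> off the right endpoint, so derivatives within \<open>{t0..T}\<close> and
    within \<open>{t0..}\<close> coincide at \<open>t\<close>.\<close>
  define T where "T = t + 1"
  have c1: "continuous_on (UNIV \<times> {t0..T}) (\<lambda>(y, s). g s y)" if "smooth_half t0 g" for g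
  proof -
    have "continuous_on (UNIV \<times> {t0..T}) ((\<lambda>(t, x). g t x) \<circ> prod.swap)"
      by (intro continuous_on_compose continuous_on_subset[OF smooth_half_continuous[OF that]])
         (auto simp: continuous_on_swap)
    then show ?thesis by (simp add: o_def split_beta)
  qed
  have ct: "continuous_on {t0..T} (\<lambda>s. g s y)" if "smooth_half t0 g" for g y
  proof -
    have "continuous_on {t0..T} ((\<lambda>(t, x). g t x) \<circ> (\<lambda>s. (s, y)))"
      by (intro continuous_on_compose continuous_on_subset[OF smooth_half_continuous[OF that]] continuous_intros) auto
    then show ?thesis by (simp add: o_def)
  qed
  note sm = assms(1) smooth_half_dtau[OF assms(1)] smooth_half_dth[OF smooth_half_dtau[OF assms(1)]]
  have ftc: "f s y = f t0 y + integral {t0..s} (\<lambda>s. dtau t0 f s y)" if "s \<ge> t0" for s y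
  proof -
    have "((\<lambda>s. dtau t0 f s y) has_integral (f s y - f t0 y)) {t0..s}"
    proof (rule fundamental_theorem_of_calculus[OF that])
      fix r assume "r \<in> {t0..s}"
      then show "((\<lambda>s. f s y) has_vector_derivative dtau t0 f r y) (at r within {t0..s})"
        using smooth_half_DERIV_tau[OF sm(1), of r y]
        by (auto simp: has_real_derivative_iff_has_vector_derivative intro: has_vector_derivative_within_subset)
    qed
    then show ?thesis by (simp add: integral_unique)
  qed
  have eq: "dth f s x = dth f t0 x + integral {t0..s} (\<lambda>s. dth (dtau t0 f) s x)" if s: "s \<ge> t0" "s \<le> T" for s
  proof -
    have "((\<lambda>y. integral (cbox t0 s) (\<lambda>s. dtau t0 f s y)) has_real_derivative
        integral (cbox t0 s) (\<lambda>s. dth (dtau t0 f) s x)) (at x within UNIV)"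
    proof (rule leibniz_rule_field_derivative)
      show "((\<lambda>y. dtau t0 f r y) has_real_derivative dth (dtau t0 f) r y) (at y within UNIV)"
        if "r \<in> cbox t0 s" for y r
        using smooth_half_DERIV_th[OF sm(2)] that by auto
      show "(\<lambda>s. dtau t0 f s y) integrable_on cbox t0 s" for y
        unfolding cbox_interval
        by (intro integrable_continuous_real continuous_on_subset[OF ct[OF sm(2)]]) (use s in auto)
      show "continuous_on (UNIV \<times> cbox t0 s) (\<lambda>(y, s). dth (dtau t0 f) s y)"
        by (rule continuous_on_subset[OF c1[OF sm(3)]]) (use s in auto)
    qed auto
    then have "((\<lambda>y. f t0 y + integral {t0..s} (\<lambda>s. dtau t0 f s y)) has_real_derivative
        dth f t0 x + integral {t0..s} (\<lambda>s. dth (dtau t0 f) s x)) (at x)"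
      using smooth_half_DERIV_th[OF sm(1), of t0 x] by (auto intro!: derivative_eq_intros)
    then have "(f s has_real_derivative
        dth f t0 x + integral {t0..s} (\<lambda>s. dth (dtau t0 f) s x)) (at x)"
      by (simp add: ftc[OF s(1), symmetric])
    then show ?thesis by (rule dth_eqI)
  qed
  have "((\<lambda>s. integral {t0..s} (\<lambda>s. dth (dtau t0 f) s x)) has_real_derivative dth (dtau t0 f) t x) (at t within {t0..T})"
    by (rule integral_has_real_derivative[OF ct[OF sm(3)]]) (use assms(2) in \<open>auto simp: T_def\<close>)
  then have "((\<lambda>s. dth f t0 x + integral {t0..s} (\<lambda>s. dth (dtau t0 f) s x)) has_real_derivative dth (dtau t0 f) t x) (at t within {t0..T})"
    by (auto intro!: derivative_eq_intros)
  then have A: "((\<lambda>s. dth f s x) has_real_derivative dth (dtau t0 f) t x) (at t within {t0..T})"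
  proof (rule has_field_derivative_transform_within[OF _ zero_less_one])
    show "t \<in> {t0..T}" using assms(2) by (simp add: T_def)
    show "dth f t0 x + integral {t0..s} (\<lambda>s. dth (dtau t0 f) s x) = dth f s x" if "s \<in> {t0..T}" for s
      by (rule eq[symmetric]) (use that in auto)
  qed
  have "at t within {t0..T} = at t within {t0..}"
  proof -
    have "at t within {t0..} \<inter> {..<T} = at t within {t0..}"
      by (rule at_within_nhd[of _ "{..<T}"]) (auto simp: T_def)
    moreover have "at t within {t0..T} \<inter> {..<T} = at t within {t0..T}"
      by (rule at_within_nhd[of _ "{..<T}"]) (auto simp: T_def)
    moreover have "{t0..T} \<inter> {..<T} = {t0..} \<inter> {..<T}" by auto
    ultimately show ?thesis by simp
  qed
  with A have "((\<lambda>s. dth f s x) has_real_derivative dth (dtau t0 f) t x) (at t within {t0..})" by simp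
  then show ?thesis by (rule dtau_eqI[OF _ assms(2)])
qed

section \<open>A comparison principle\<close>

lemma periodic_representative:
  fixes g :: "real \<Rightarrow> 'a"
  assumes "\<And>x. g (x + 2 * pi) = g x"
  shows "g x = g (x - of_int \<lfloor>x / (2 * pi)\<rfloor> * (2 * pi))"
proof -
  interpret periodic_fun_simple g "2 * pi" by unfold_locales (rule assms)
  show ?thesis by (rule minus_of_int[symmetric])
qed

lemma representative_range: "x - of_int \<lfloor>x / (2 * pi)\<rfloor> * (2 * pi) \<in> {0..2 * pi}"
proof -
  have "of_int \<lfloor>x / (2 * pi)\<rfloor> \<le> x / (2 * pi)" "x / (2 * pi) < of_int \<lfloor>x / (2 * pi)\<rfloor> + 1"
    by linarith+
  then have "of_int \<lfloor>x / (2 * pi)\<rfloor> * (2 * pi) \<le> x" "x < (of_int \<lfloor>x / (2 * pi)\<rfloor> + 1) * (2 * pi)"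
    by (simp_all only: pos_le_divide_eq pos_divide_less_eq pi_gt_zero zero_less_mult_iff zero_less_numeral simp_thms)
  then show ?thesis by (simp add: algebra_simps)
qed

text \<open>Subtracting full periods from x gives the same \<open>y\<close> at every time, so whole
  time histories can be studied on one compact period.\<close>

lemma smooth_half_representative:
  assumes "smooth_half t0 f"
  obtains y where "y \<in> {0..2 * pi}" "\<And>t. t0 \<le> t \<Longrightarrow> f t y = f t x"
  using representative_range[of x] periodic_representative[of "f t" x for t]
    smooth_half_periodic[OF assms] by metis

lemma smooth_half_bounded:
  assumes "smooth_half t0 f" "t0 \<le> t"
  obtains B where "B > 0" "\<And>x. \<bar>f t x\<bar> \<le> B"
proof -
  have "continuous_on {0..2 * pi} (f t)"
    by (intro continuous_at_imp_continuous_on ballI DERIV_isCont[OF smooth_half_DERIV_th[OF assms]])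
  then have "bounded (f t ` {0..2 * pi})"
    by (intro compact_imp_bounded compact_continuous_image) auto
  then obtain B where B: "B > 0" "\<And>y. y \<in> {0..2 * pi} \<Longrightarrow> \<bar>f t y\<bar> \<le> B"
    by (auto simp: bounded_pos)
  have "\<bar>f t x\<bar> \<le> B" for x
    using smooth_half_representative[OF assms(1), of x] B(2) assms(2) by metis
  with B(1) show ?thesis using that by blast
qed

text \<open>If a strict inequality fails, compactness of one period gives a first time of failure.
  Left limits give weak inequalities there, so the touching point is a spatial maximum with
  vanishing x-derivative, and \<open>step\<close> makes \<open>f - h\<close> strictly decreasing in
  time: it would have been positive just before.\<close>

lemma comparison_principle:
  fixes f :: "'i \<Rightarrow> real \<Rightarrow> real \<Rightarrow> real" and h h' :: "'i \<Rightarrow> real \<Rightarrow> real"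
  assumes fin: "finite I" and sm: "\<And>i. i \<in> I \<Longrightarrow> smooth_half t0 (f i)"
    and h: "\<And>i t. i \<in> I \<Longrightarrow> t0 \<le> t \<Longrightarrow> (h i has_real_derivative h' i t) (at t)"
    and init: "\<And>i x. i \<in> I \<Longrightarrow> f i t0 x < h i t0"
    and step: "\<And>i t x. \<lbrakk>i \<in> I; t0 < t; t \<le> T; \<And>j y. j \<in> I \<Longrightarrow> f j t y \<le> h j t;
       f i t x = h i t; dth (f i) t x = 0\<rbrakk> \<Longrightarrow> dtau t0 (f i) t x < h' i t"
    and i: "i \<in> I" and t: "t0 \<le> t" "t \<le> T"
  shows "f i t x < h i t"
proof (rule ccontr)
  assume neg: "\<not> f i t x < h i t"
  \<comment> \<open>The failures of the j-th inequality up to \<open>T\<close>, within one period.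
    These sets are compact, and so is the set \<open>B\<close> of times at which some inequality
    fails.\<close>
  define K where "K j = {z \<in> {t0..T} \<times> {0..2 * pi}. 0 \<le> f j (fst z) (snd z) - h j (fst z)}" for j
  define B where "B = (\<Union>j\<in>I. fst ` K j)"
  have "compact (K j)" if j: "j \<in> I" for j
  proof -
    have "continuous_on {t0..T} (h j)"
      by (intro continuous_at_imp_continuous_on ballI DERIV_isCont[OF h[OF j]]) auto
    then have "continuous_on ({t0..T} \<times> {0..2 * pi}) (\<lambda>z. h j (fst z))"
      by (intro continuous_on_compose2[of "{t0..T}" "h j" _ fst] continuous_intros) auto
    moreover have "continuous_on ({t0..T} \<times> {0..2 * pi}) (\<lambda>z. f j (fst z) (snd z))"
      by (rule continuous_on_subset[OF smooth_half_continuous[OF sm[OF j], unfolded split_beta]]) auto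
    ultimately have "continuous_on ({t0..T} \<times> {0..2 * pi}) (\<lambda>z. f j (fst z) (snd z) - h j (fst z))"
      by (intro continuous_intros)
    from continuous_closed_preimage[OF this, of "{0..}"]
    have "closed (K j)" by (simp add: K_def closed_Times vimage_def Int_def)
    moreover have "bounded (K j)"
      by (rule bounded_subset[of "{t0..T} \<times> {0..2 * pi}"]) (auto simp: K_def intro: bounded_Times)
    ultimately show ?thesis by (simp add: compact_eq_bounded_closed)
  qed
  then have "compact B" unfolding B_def
    by (intro compact_UN fin compact_continuous_image continuous_intros) auto
  have inB: "s \<in> B" if *: "j \<in> I" "t0 \<le> s" "s \<le> T" "\<not> f j s y < h j s" for j s y
  proof -
    obtain y' where y': "y' \<in> {0..2 * pi}" "f j s y' = f j s y"
      using smooth_half_representative[OF sm[OF *(1)], of y] *(2) by metis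
    then have "(s, y') \<in> K j" using * by (auto simp: K_def)
    then show ?thesis using *(1) by (force simp: B_def)
  qed
  then have "B \<noteq> {}" using neg i t by blast
  with \<open>compact B\<close> obtain s where s: "s \<in> B" "\<And>r. r \<in> B \<Longrightarrow> s \<le> r"
    using compact_attains_inf by metis
  then obtain k y where k: "k \<in> I" "t0 \<le> s" "s \<le> T" "f k s y \<ge> h k s"
    by (auto simp: B_def K_def)
  have "s \<noteq> t0" using k init[OF k(1), of y] by auto
  with k have "t0 < s" by simp
  have before: "f j r z < h j r" if "j \<in> I" "t0 \<le> r" "r < s" for j r z
    using inB[of j r z] s(2)[of r] that k(3) by (meson leD less_le_trans less_imp_le)
  \<comment> \<open>Strict inequalities before \<open>s\<close> pass to weak ones at
    \<open>s\<close> by left limits.\<close>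
  have le: "f j s z \<le> h j s" if j: "j \<in> I" for j z
  proof -
    have 1: "((\<lambda>r. f j r z) \<longlongrightarrow> f j s z) (at s within {t0..<s})"
      using smooth_half_DERIV_tau[OF sm[OF j] k(2), of z]
      by (auto simp: continuous_within intro: tendsto_within_subset dest!: DERIV_continuous)
    have 2: "(h j \<longlongrightarrow> h j s) (at s within {t0..<s})"
      using DERIV_isCont[OF h[OF j k(2)]] by (auto simp: isCont_def intro: tendsto_within_subset)
    have 3: "at s within {t0..<s} \<noteq> bot"
      using \<open>t0 < s\<close> by (simp add: trivial_limit_within islimpt_Ico)
    have 4: "\<forall>\<^sub>F r in at s within {t0..<s}. f j r z \<le> h j r"
      using before[OF j] by (auto simp: eventually_at_filter intro!: always_eventually less_imp_le)
    show ?thesis by (rule tendsto_le[OF 3 2 1 4])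
  qed
  have touch: "f k s y = h k s" using le[OF k(1), of y] k(4) by simp
  have "dth (f k) s y = 0"
    by (rule DERIV_local_max[OF smooth_half_DERIV_th[OF sm[OF k(1)] k(2)], of 1])
       (use le[OF k(1)] touch in auto)
  then have "dtau t0 (f k) s y < h' k s"
    by (intro step k \<open>t0 < s\<close> touch le)
  moreover have "((\<lambda>r. f k r y - h k r) has_real_derivative dtau t0 (f k) s y - h' k s) (at s within {t0..})"
    by (intro derivative_intros smooth_half_DERIV_tau sm k has_field_derivative_at_within[OF h])
  ultimately obtain d where d: "d > 0"
    "\<And>e. e > 0 \<Longrightarrow> s - e \<in> {t0..} \<Longrightarrow> e < d \<Longrightarrow> f k s y - h k s < f k (s - e) y - h k (s - e)"
    using has_real_derivative_neg_dec_left[of "\<lambda>r. f k r y - h k r" "dtau t0 (f k) s y - h' k s" s "{t0..}"]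
    by auto
  \<comment> \<open>Small enough for the local decrease, and at most \<open>s - t0\<close>, so that
    \<open>s - e\<close> is still in the time domain.\<close>
  define e where "e = min (d / 2) (s - t0)"
  have "e > 0" "s - e \<in> {t0..}" "e < d" using d(1) \<open>t0 < s\<close> by (auto simp: e_def min_def)
  with d(2)[OF this] before[OF k(1), of "s - e" y] touch show False by auto
qed

section \<open>Functions with polynomially corrected exponential decay\<close>

lemma dth_add: "smooth_half t0 f \<Longrightarrow> smooth_half t0 g \<Longrightarrow> t0 \<le> t \<Longrightarrow>
    dth (\<lambda>t x. f t x + g t x) t x = dth f t x + dth g t x"
  by (rule dth_eqI) (auto intro!: derivative_eq_intros smooth_half_DERIV_th)

lemma dth_mult: "smooth_half t0 f \<Longrightarrow> smooth_half t0 g \<Longrightarrow> t0 \<le> t \<Longrightarrow>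
    dth (\<lambda>t x. f t x * g t x) t x = dth f t x * g t x + f t x * dth g t x"
  by (rule dth_eqI) (auto intro!: derivative_eq_intros smooth_half_DERIV_th)

lemma dth_exp: "smooth_half t0 f \<Longrightarrow> t0 \<le> t \<Longrightarrow>
    dth (\<lambda>t x. exp (f t x)) t x = dth f t x * exp (f t x)"
  by (rule dth_eqI) (auto intro!: derivative_eq_intros smooth_half_DERIV_th)

lemma dth_time: "dth (\<lambda>t x. g t) t x = 0"
  by (rule dth_eqI) auto

lemma smooth_half_dth_funpow: "smooth_half t0 f \<Longrightarrow> smooth_half t0 ((dth ^^ n) f)"
  by (induction n) (auto intro: smooth_half_dth)

lemma dth_funpow_eq: "(dth ^^ n) f t = (deriv ^^ n) (f t)"
proof (induction n)
  case (Suc n)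
  have "dth ((dth ^^ n) f) t = deriv ((dth ^^ n) f t)" by (rule ext) (simp add: dth_def)
  with Suc show ?case by simp
qed auto

lemma dtau_dth_funpow:
  assumes "smooth_half t0 f" "t0 \<le> t"
  shows "dtau t0 ((dth ^^ n) f) t x = (dth ^^ n) (dtau t0 f) t x"
  using assms(2)
proof (induction n arbitrary: t x)
  case (Suc n)
  have "dtau t0 ((dth ^^ Suc n) f) t x = dth (dtau t0 ((dth ^^ n) f)) t x"
    using smooth_half_dth_dtau[OF smooth_half_dth_funpow[OF assms(1)] Suc.prems] by simp
  also have "\<dots> = dth ((dth ^^ n) (dtau t0 f)) t x"
    using Suc by (intro dth_cong) auto
  finally show ?case by simp
qed auto

section \<open>Limits on a half line and tails of exponential integrals\<close>

lemma mono_half_line: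
  assumes z: "\<And>t. t0 \<le> t \<Longrightarrow> (z has_real_derivative z' t) (at t within {t0..})"
    and nonneg: "\<And>t. t0 \<le> t \<Longrightarrow> t \<le> T \<Longrightarrow> 0 \<le> z' t" and st: "t0 \<le> s" "s \<le> t" "t \<le> T"
  shows "z s \<le> z (t::real)"
proof (cases "s = t")
  case False
  show ?thesis
  proof (rule DERIV_nonneg_imp_increasing_open[OF st(2)])
    show "\<exists>y. (z has_real_derivative y) (at x) \<and> 0 \<le> y" if "s < x" "x < t" for x
    proof -
      have "at x within {t0..} = at x"
        by (rule at_within_interior) (use that st in auto)
      then show ?thesis using z[of x] nonneg[of x] that st by auto
    qed
    show "continuous_on {s..t} z"
      unfolding continuous_on_eq_continuous_within
    proof
      fix x assume "x \<in> {s..t}"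
      then show "continuous (at x within {s..t}) z"
        using DERIV_continuous[OF z[of x]] st by (auto intro: continuous_within_subset)
    qed
  qed
qed simp

text \<open>\<open>z - H\<close> is nondecreasing and \<open>z + H\<close> nonincreasing. As
  \<open>H \<ge> 0\<close>, every value of the former lies below every value of the latter, so the
  infimum of \<open>z + H\<close> separates them.\<close>

lemma half_line_limit:
  assumes z: "\<And>t. t0 \<le> t \<Longrightarrow> (z has_real_derivative z' t) (at t within {t0..})"
    and H: "\<And>t. t0 \<le> t \<Longrightarrow> (H has_real_derivative H' t) (at t within {t0..})"
    and z': "\<And>t. t0 \<le> t \<Longrightarrow> \<bar>z' t\<bar> \<le> - H' t" and nonneg: "\<And>t. t0 \<le> t \<Longrightarrow> 0 \<le> H t"
  shows "\<exists>l. \<forall>t\<ge>t0. \<bar>z t - l\<bar> \<le> H (t::real)"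
proof -
  have z'': "H' t \<le> - z' t" "H' t \<le> z' t" if "t0 \<le> t" for t
    using z'[OF that] by auto
  have 1: "z s - H s \<le> z t - H t" if "t0 \<le> s" "s \<le> t" for s t
    by (rule mono_half_line[of t0 "\<lambda>t. z t - H t" "\<lambda>t. z' t - H' t" t])
       (use z''(2) that in \<open>auto intro!: derivative_intros z H\<close>)
  have 2: "- z s - H s \<le> - z t - H t" if "t0 \<le> s" "s \<le> t" for s t
    by (rule mono_half_line[of t0 "\<lambda>t. - z t - H t" "\<lambda>t. - z' t - H' t" t])
       (use z''(1) that in \<open>auto intro!: derivative_intros z H\<close>)
  define l where "l = Inf ((\<lambda>t. z t + H t) ` {t0..})"
  have 3: "z t - H t \<le> z s + H s" if "t0 \<le> s" "t0 \<le> t" for s t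
    using 1[of t s] 2[of s t] nonneg[of s] nonneg[of t] that by linarith
  have "bdd_below ((\<lambda>t. z t + H t) ` {t0..})"
    using 3[OF _ order_refl] by (auto simp: bdd_below_def)
  then have "l \<le> z t + H t" if "t0 \<le> t" for t
    unfolding l_def using that by (intro cInf_lower) auto
  moreover have "z t - H t \<le> l" if "t0 \<le> t" for t
    unfolding l_def using that 3 by (intro cInf_greatest) auto
  ultimately have "\<bar>z t - l\<bar> \<le> H t" if "t0 \<le> t" for t
    using that by (force simp: abs_le_iff)
  then show ?thesis by blast
qed

text \<open>\<open>tail a m t * exp (- a * t)\<close> is the integral of \<open>s ^ m * exp (- a * s)\<close> over \<open>s \<ge> t\<close>.\<close>

primrec tail :: "real \<Rightarrow> nat \<Rightarrow> real \<Rightarrow> real" where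
  "tail a 0 t = 1 / a"
| "tail a (Suc m) t = (t ^ Suc m + real (Suc m) * tail a m t) / a"

lemma tail_nonneg: "0 < a \<Longrightarrow> 0 \<le> t \<Longrightarrow> 0 \<le> tail a m t"
  by (induction m) auto

lemma tail_DERIV: "a \<noteq> 0 \<Longrightarrow> (tail a m has_real_derivative a * tail a m t - t ^ m) (at t)"
proof (induction m)
  case 0
  have "tail a 0 = (\<lambda>t. 1 / a)" by auto
  then show ?case using 0 by simp
next
  case (Suc m)
  have "tail a (Suc m) = (\<lambda>t. (t ^ Suc m + real (Suc m) * tail a m t) / a)" by auto
  moreover have "((\<lambda>t. (t ^ Suc m + real (Suc m) * tail a m t) / a) has_real_derivative
      (real (Suc m) * t ^ m + real (Suc m) * (a * tail a m t - t ^ m)) / a) (at t)"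
    using DERIV_pow[of "Suc m" t] by (intro DERIV_cdivide DERIV_add DERIV_cmult Suc.IH Suc.prems) simp
  moreover have "(real (Suc m) * t ^ m + real (Suc m) * (a * tail a m t - t ^ m)) / a = a * tail a (Suc m) t - t ^ Suc m"
    using Suc.prems by (simp add: field_simps)
  ultimately show ?case by metis
qed

lemma tail_exp_DERIV:
  "a \<noteq> 0 \<Longrightarrow> ((\<lambda>t. tail a m t * exp (- a * t)) has_real_derivative - (t ^ m * exp (- a * t))) (at t within S)"
  by (rule has_field_derivative_at_within) (auto intro!: derivative_eq_intros tail_DERIV simp: algebra_simps)

text \<open>In the recursion for \<open>tail\<close> the lower powers of t are absorbed by the top
  one, since \<open>t \<ge> 1\<close>.\<close>

lemma tail_bound:
  assumes "0 < a"
  obtains K where "0 \<le> K" "\<And>t. 1 \<le> t \<Longrightarrow> tail a m t \<le> K * t ^ m"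
proof -
  have "\<exists>K\<ge>0. \<forall>t\<ge>1. tail a m t \<le> K * t ^ m"
  proof (induction m)
    case 0
    show ?case using assms by (intro exI[of _ "1/a"]) auto
  next
    case (Suc m)
    then obtain K where K: "0 \<le> K" "\<forall>t\<ge>1. tail a m t \<le> K * t ^ m" by blast
    have "tail a (Suc m) t \<le> ((1 + real (Suc m) * K) / a) * t ^ Suc m" if t: "1 \<le> t" for t
    proof -
      have "tail a m t \<le> K * t ^ m" using K t by auto
      also have "\<dots> \<le> K * t ^ Suc m" using t K(1) by (intro mult_left_mono power_increasing) auto
      finally have "t ^ Suc m + real (Suc m) * tail a m t \<le> t ^ Suc m + real (Suc m) * (K * t ^ Suc m)"
        by (intro add_left_mono mult_left_mono) auto
      then have "(t ^ Suc m + real (Suc m) * tail a m t) / a \<le> (t ^ Suc m + real (Suc m) * (K * t ^ Suc m)) / a"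
        using assms by (intro divide_right_mono) auto
      then show ?thesis by (simp add: algebra_simps)
    qed
    then show ?case using K(1) assms by (intro exI[of _ "(1 + real (Suc m) * K) / a"]) auto
  qed
  then show ?thesis using that by blast
qed

text \<open>The inequality \<open>y \<le> exp y\<close> at \<open>y = a * t / m\<close>, raised to
  the m-th power.\<close>

lemma power_exp_bounded:
  assumes "0 < a" "0 \<le> t"
  shows "t ^ m * exp (- a * t) \<le> (real m / a) ^ m"
proof (cases "m = 0")
  case True
  then show ?thesis using assms by simp
next
  case False
  have "a * t / real m \<le> exp (a * t / real m)"
    using exp_ge_add_one_self[of "a * t / real m"] by linarith
  then have "(a * t / real m) ^ m \<le> exp (a * t / real m) ^ m"
    using assms by (intro power_mono) auto
  also have "\<dots> = exp (a * t)" using False by (simp add: exp_of_nat_mult[symmetric])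
  finally have "t ^ m * (a / real m) ^ m \<le> exp (a * t)"
    by (simp add: power_mult_distrib[symmetric] mult.commute)
  then have "t ^ m * (a / real m) ^ m * (real m / a) ^ m \<le> exp (a * t) * (real m / a) ^ m"
    using assms by (intro mult_right_mono) auto
  moreover have "(a / real m) ^ m * (real m / a) ^ m = 1"
    using assms False by (simp add: power_mult_distrib[symmetric])
  ultimately have "t ^ m \<le> exp (a * t) * (real m / a) ^ m" by (simp add: mult.assoc)
  then have "t ^ m * exp (- a * t) \<le> exp (a * t) * (real m / a) ^ m * exp (- a * t)"
    by (intro mult_right_mono) auto
  also have "\<dots> = (real m / a) ^ m" by (simp add: exp_minus)
  finally show ?thesis .
qed

text \<open>One spare power: \<open>t ^ Suc m * exp (- a * t)\<close> is bounded, which leaves a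
  factor 1/t.\<close>

lemma power_exp_tendsto_0:
  fixes a :: real
  assumes "0 < a"
  shows "((\<lambda>t. t ^ m * exp (- a * t)) \<longlongrightarrow> 0) at_top"
proof (rule tendsto_sandwich[where f = "\<lambda>_. 0" and h = "\<lambda>t. (real (Suc m) / a) ^ Suc m / t"])
  show "\<forall>\<^sub>F t in at_top. 0 \<le> t ^ m * exp (- a * t)"
    using eventually_ge_at_top[of "0::real"] by eventually_elim auto
  show "\<forall>\<^sub>F t in at_top. t ^ m * exp (- a * t) \<le> (real (Suc m) / a) ^ Suc m / t"
    using eventually_gt_at_top[of "0::real"]
  proof eventually_elim
    case (elim t)
    then show ?case
      using power_exp_bounded[OF assms, of t "Suc m"] by (simp only: pos_le_divide_eq) (simp add: ac_simps)
  qed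
  show "((\<lambda>t. (real (Suc m) / a) ^ Suc m / t) \<longlongrightarrow> 0) at_top"
    by (rule real_tendsto_divide_at_top[OF tendsto_const filterlim_ident])
qed auto

section \<open>Classes of functions with exponential decay up to polynomial factors\<close>

locale half_line =
  fixes t0 :: real
  assumes t0: "1 \<le> t0"
begin

text \<open>Uniform in x, with the degree of the polynomial factor left existential: powers of t
  cost nothing and only the exponential rate is tracked. The function t itself has rate 0.\<close>

definition bnd :: "real \<Rightarrow> (real \<Rightarrow> real \<Rightarrow> real) \<Rightarrow> bool" where
  "bnd a f \<longleftrightarrow> (\<exists>C m. \<forall>t\<ge>t0. \<forall>x. \<bar>f t x\<bar> \<le> C * t ^ m * exp (- a * t))"

text \<open>Recursion through \<open>dth f\<close> suits inductions by the Leibniz rule, in which a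
  function and its derivative are both treated one order lower.\<close>

primrec decay :: "nat \<Rightarrow> real \<Rightarrow> (real \<Rightarrow> real \<Rightarrow> real) \<Rightarrow> bool" where
  "decay 0 a f = bnd a f"
| "decay (Suc k) a f = (bnd a f \<and> decay k a (dth f))"

lemma bndI: "(\<And>t x. t0 \<le> t \<Longrightarrow> \<bar>f t x\<bar> \<le> C * t ^ m * exp (- a * t)) \<Longrightarrow> bnd a f"
  by (auto simp: bnd_def)

text \<open>As \<open>t \<ge> 1\<close>, the constant can be made positive and the exponent
  enlarged; this form lets several bounds share an exponent.\<close>

lemma bndE:
  assumes "bnd a f"
  obtains C m where "0 < C" "\<And>n t x. m \<le> n \<Longrightarrow> t0 \<le> t \<Longrightarrow> \<bar>f t x\<bar> \<le> C * t ^ n * exp (- a * t)"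
proof -
  obtain C m where C: "\<And>t x. t0 \<le> t \<Longrightarrow> \<bar>f t x\<bar> \<le> C * t ^ m * exp (- a * t)"
    using assms by (auto simp: bnd_def)
  have "\<bar>f t x\<bar> \<le> max 1 C * t ^ n * exp (- a * t)" if "m \<le> n" "t0 \<le> t" for n t x
  proof -
    have "C * t ^ m * exp (- a * t) \<le> max 1 C * t ^ n * exp (- a * t)"
      using that t0 by (intro mult_right_mono mult_mono power_increasing) auto
    then show ?thesis using C[OF that(2), of x] by linarith
  qed
  then show ?thesis using that[of "max 1 C" m] by auto
qed

lemma bnd_cong: "(\<And>t x. t0 \<le> t \<Longrightarrow> f t x = g t x) \<Longrightarrow> bnd a f = bnd a g"
  by (simp add: bnd_def)

lemma bnd_add: assumes "bnd a f" "bnd a g" shows "bnd a (\<lambda>t x. f t x + g t x)"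
proof -
  obtain C m D n where C: "0 < C" "\<And>k t x. m \<le> k \<Longrightarrow> t0 \<le> t \<Longrightarrow> \<bar>f t x\<bar> \<le> C * t ^ k * exp (- a * t)"
    and D: "0 < D" "\<And>k t x. n \<le> k \<Longrightarrow> t0 \<le> t \<Longrightarrow> \<bar>g t x\<bar> \<le> D * t ^ k * exp (- a * t)"
    using assms by (metis bndE)
  have "\<bar>f t x + g t x\<bar> \<le> (C + D) * t ^ max m n * exp (- a * t)" if "t0 \<le> t" for t x
    using abs_triangle_ineq[of "f t x" "g t x"] C(2)[of "max m n" t x] D(2)[of "max m n" t x] that
    by (simp add: algebra_simps)
  then show ?thesis by (rule bndI)
qed

lemma bnd_mult: assumes "bnd a f" "bnd b g" shows "bnd (a + b) (\<lambda>t x. f t x * g t x)"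
proof -
  obtain C m where C: "0 < C" "\<And>k t x. m \<le> k \<Longrightarrow> t0 \<le> t \<Longrightarrow> \<bar>f t x\<bar> \<le> C * t ^ k * exp (- a * t)"
    using assms(1) by (metis bndE)
  obtain D n where D: "0 < D" "\<And>k t x. n \<le> k \<Longrightarrow> t0 \<le> t \<Longrightarrow> \<bar>g t x\<bar> \<le> D * t ^ k * exp (- b * t)"
    using assms(2) by (metis bndE)
  have "\<bar>f t x * g t x\<bar> \<le> (C * D) * t ^ (m + n) * exp (- (a + b) * t)" if "t0 \<le> t" for t x
  proof -
    have "\<bar>f t x * g t x\<bar> \<le> (C * t ^ m * exp (- a * t)) * (D * t ^ n * exp (- b * t))"
      unfolding abs_mult using C D that t0 by (intro mult_mono) auto
    also have "\<dots> = (C * D) * t ^ (m + n) * (exp (- a * t) * exp (- b * t))"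
      by (simp add: power_add)
    also have "exp (- a * t) * exp (- b * t) = exp (- (a + b) * t)"
      by (simp add: exp_add[symmetric] algebra_simps)
    finally show ?thesis .
  qed
  then show ?thesis by (rule bndI)
qed

lemma bnd_mono: assumes "bnd a f" "b \<le> a" shows "bnd b f"
proof -
  obtain C m where C: "0 < C" "\<And>k t x. m \<le> k \<Longrightarrow> t0 \<le> t \<Longrightarrow> \<bar>f t x\<bar> \<le> C * t ^ k * exp (- a * t)"
    using assms(1) by (metis bndE)
  have "\<bar>f t x\<bar> \<le> C * t ^ m * exp (- b * t)" if "t0 \<le> t" for t x
  proof -
    have "C * t ^ m * exp (- a * t) \<le> C * t ^ m * exp (- b * t)"
      using C(1) that t0 assms(2) by (intro mult_left_mono) (auto simp: mult_right_mono)
    then show ?thesis using C(2)[OF order_refl that, of x] by linarith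
  qed
  then show ?thesis by (rule bndI)
qed

lemma bnd_zero: "bnd a (\<lambda>t x. 0)"
  by (rule bndI[of _ 0]) auto

lemma bnd_const: "bnd 0 (\<lambda>t x. c)"
  by (rule bndI[of _ "\<bar>c\<bar>" 0]) auto

lemma bnd_time: "bnd 0 (\<lambda>t x. t)"
  by (rule bndI[of _ 1 1]) (use t0 in auto)

lemma bnd_exp_time: "bnd a (\<lambda>t x. exp (- a * t))"
  by (rule bndI[of _ 1 0]) auto

lemma decay_cong: "(\<And>t x. t0 \<le> t \<Longrightarrow> f t x = g t x) \<Longrightarrow> decay k a f = decay k a g"
proof (induction k arbitrary: f g)
  case (Suc k)
  have "dth f t x = dth g t x" if "t0 \<le> t" for t x using Suc.prems that by (intro dth_cong)
  with Suc.IH[of "dth f" "dth g"] bnd_cong[of f g] Suc.prems show ?case by simp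
next
  case 0
  then show ?case using bnd_cong[of f g a] by simp
qed

lemma decay_bnd: "decay k a f \<Longrightarrow> bnd a f"
  by (cases k) auto

lemma decay_Suc_le: "decay (Suc k) a f \<Longrightarrow> decay k a f"
  by (induction k arbitrary: f) auto

lemma decay_mono: "decay k a f \<Longrightarrow> b \<le> a \<Longrightarrow> decay k b f"
  by (induction k arbitrary: f) (auto intro: bnd_mono)

lemma decay_iff: "decay k a f \<longleftrightarrow> (\<forall>n\<le>k. bnd a ((dth ^^ n) f))"
proof (induction k arbitrary: f)
  case (Suc k)
  have "(\<forall>n\<le>Suc k. bnd a ((dth ^^ n) f)) \<longleftrightarrow> bnd a f \<and> (\<forall>n\<le>k. bnd a ((dth ^^ Suc n) f))"
    unfolding All_less_Suc2[of "Suc k", unfolded less_Suc_eq_le] by simp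
  then show ?case using Suc[of "dth f"] by (simp add: funpow_swap1)
qed auto

lemma decay_time: "bnd a (\<lambda>t x. g t) \<Longrightarrow> decay k a (\<lambda>t x. g t)"
proof (induction k arbitrary: g)
  case (Suc k)
  have "dth (\<lambda>t x. g t) = (\<lambda>t x. 0)" by (intro ext dth_time)
  then show ?case using Suc.prems Suc.IH[OF bnd_zero] by simp
qed auto

lemma decay_add:
  "smooth_half t0 f \<Longrightarrow> smooth_half t0 g \<Longrightarrow> decay k a f \<Longrightarrow> decay k a g \<Longrightarrow> decay k a (\<lambda>t x. f t x + g t x)"
proof (induction k arbitrary: f g)
  case (Suc k)
  have "decay k a (\<lambda>t x. dth f t x + dth g t x)"
    using Suc by (intro Suc.IH smooth_half_dth) auto
  then show ?case
    using Suc.prems decay_cong[of "dth (\<lambda>t x. f t x + g t x)" "\<lambda>t x. dth f t x + dth g t x"]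
    by (auto intro: bnd_add simp: dth_add)
qed (auto intro: bnd_add)

text \<open>Rates add at order zero, and by the Leibniz rule each term of the derivative pairs the
  same two rates again.\<close>

lemma decay_mult:
  "smooth_half t0 f \<Longrightarrow> smooth_half t0 g \<Longrightarrow> decay k a f \<Longrightarrow> decay k b g \<Longrightarrow> decay k (a + b) (\<lambda>t x. f t x * g t x)"
proof (induction k arbitrary: f g)
  case (Suc k)
  have "decay k (a + b) (\<lambda>t x. dth f t x * g t x + f t x * dth g t x)"
    using Suc.prems decay_Suc_le[OF Suc.prems(3)] decay_Suc_le[OF Suc.prems(4)]
    by (intro decay_add Suc.IH smooth_intros) auto
  then show ?case
    using Suc.prems decay_cong[of "dth (\<lambda>t x. f t x * g t x)" "\<lambda>t x. dth f t x * g t x + f t x * dth g t x"]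
    by (auto intro: bnd_mult simp: dth_mult)
qed (auto intro: bnd_mult)

text \<open>Every derivative of the exponential carries the exponential itself as a factor, and the
  other factors come from \<open>f\<close> at rate 0; so the rate found at order zero persists at
  all orders.\<close>

lemma decay_exp:
  "smooth_half t0 f \<Longrightarrow> decay k 0 f \<Longrightarrow> bnd a (\<lambda>t x. exp (f t x)) \<Longrightarrow> decay k a (\<lambda>t x. exp (f t x))"
proof (induction k)
  case (Suc k)
  have "decay k (0 + a) (\<lambda>t x. dth f t x * exp (f t x))"
    using Suc.prems decay_Suc_le[OF Suc.prems(2)]
    by (intro decay_mult Suc.IH smooth_intros) auto
  then show ?case
    using Suc.prems decay_cong[of "dth (\<lambda>t x. exp (f t x))" "\<lambda>t x. dth f t x * exp (f t x)"]
    by (auto simp: dth_exp)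
qed auto

lemma decay_const: "decay k 0 (\<lambda>t x. c)" by (rule decay_time[OF bnd_const])

lemma decay_uminus:
  assumes "smooth_half t0 f" "decay k a f" shows "decay k a (\<lambda>t x. - f t x)"
  using decay_mult[OF smooth_half_const assms(1) decay_const assms(2), of "-1"] by simp

lemma decay_diff:
  "smooth_half t0 f \<Longrightarrow> smooth_half t0 g \<Longrightarrow> decay k a f \<Longrightarrow> decay k a g \<Longrightarrow> decay k a (\<lambda>t x. f t x - g t x)"
  using decay_add[OF _ smooth_half_uminus _ decay_uminus, of f g] by simp

lemma decay_scale:
  assumes "smooth_half t0 f" "decay k a f" shows "decay k a (\<lambda>t x. c * f t x)"
  using decay_mult[OF smooth_half_const assms(1) decay_const assms(2), of c] by simp

lemma decay_static:
  assumes "smooth_half t0 (\<lambda>t. h)" shows "decay k 0 (\<lambda>t. h)"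
proof -
  have "bnd 0 ((dth ^^ n) (\<lambda>t. h))" for n
  proof -
    obtain B where "B > 0" "\<And>x. \<bar>(dth ^^ n) (\<lambda>t. h) t0 x\<bar> \<le> B"
      using smooth_half_bounded[OF smooth_half_dth_funpow[OF assms] order_refl] by metis
    then show ?thesis by (intro bndI[of _ B 0]) (simp add: dth_funpow_eq)
  qed
  then show ?thesis by (simp add: decay_iff)
qed

text \<open>Integration from \<open>t0\<close> costs one power of t, which the class does not
  see.\<close>

lemma bnd_integrate:
  assumes sm: "smooth_half t0 f" and "bnd 0 (dtau t0 f)"
  shows "bnd 0 f"
proof -
  obtain C m where C: "0 < C" "\<And>k t x. m \<le> k \<Longrightarrow> t0 \<le> t \<Longrightarrow> \<bar>dtau t0 f t x\<bar> \<le> C * t ^ k * exp (- 0 * t)"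
    using assms(2) by (metis bndE)
  obtain B where B: "B > 0" "\<And>x. \<bar>f t0 x\<bar> \<le> B"
    using smooth_half_bounded[OF sm order_refl] by metis
  have "\<bar>f t x\<bar> \<le> (B + C) * t ^ Suc m * exp (- 0 * t)" if t: "t0 \<le> t" for t x
  proof -
    \<comment> \<open>On \<open>[t0, t]\<close> the growing bound is frozen at its endpoint value;
      \<open>f\<close> then compares with linear functions of slope
      \<open>C * t ^ m\<close>.\<close>
    have b: "\<bar>dtau t0 f s x\<bar> \<le> C * t ^ m" if "t0 \<le> s" "s \<le> t" for s
    proof -
      have "\<bar>dtau t0 f s x\<bar> \<le> C * s ^ m" using C(2)[of m s x] that by simp
      also have "\<dots> \<le> C * t ^ m" using that t0 C(1) by (intro mult_left_mono power_mono) auto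
      finally show ?thesis .
    qed
    have b': "dtau t0 f s x + C * t ^ m \<ge> 0" "C * t ^ m - dtau t0 f s x \<ge> 0" if "t0 \<le> s" "s \<le> t" for s
      using b[OF that] by auto
    have "f t0 x + C * t ^ m * t0 \<le> f t x + C * t ^ m * t"
      by (rule mono_half_line[of t0 "\<lambda>s. f s x + C * t ^ m * s" "\<lambda>s. dtau t0 f s x + C * t ^ m" t])
         (use t b' in \<open>auto intro!: derivative_eq_intros smooth_half_DERIV_tau[OF sm]\<close>)
    moreover have "C * t ^ m * t0 - f t0 x \<le> C * t ^ m * t - f t x"
      by (rule mono_half_line[of t0 "\<lambda>s. C * t ^ m * s - f s x" "\<lambda>s. C * t ^ m - dtau t0 f s x" t])
         (use t b' in \<open>auto intro!: derivative_eq_intros smooth_half_DERIV_tau[OF sm]\<close>)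
    moreover have "0 \<le> C * t ^ m * t0" using C(1) t t0 by simp
    ultimately have "\<bar>f t x\<bar> \<le> B + C * t ^ m * t"
      using B(2)[of x] by linarith
    also have "\<dots> \<le> B * t ^ Suc m + C * t ^ Suc m"
      using B(1) t t0 one_le_power[of t "Suc m"] mult_left_mono[of 1 "t ^ Suc m" B] by (simp add: mult.commute)
    finally show ?thesis by (simp add: algebra_simps)
  qed
  then show ?thesis by (rule bndI)
qed

lemma decay_integrate:
  assumes sm: "smooth_half t0 f" and "decay k 0 (dtau t0 f)"
  shows "decay k 0 f"
proof -
  have "bnd 0 ((dth ^^ n) f)" if "n \<le> k" for n
  proof (rule bnd_integrate[OF smooth_half_dth_funpow[OF sm]])
    show "bnd 0 (dtau t0 ((dth ^^ n) f))"
      using assms(2) that bnd_cong[of "dtau t0 ((dth ^^ n) f)" "(dth ^^ n) (dtau t0 f)"]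
      by (simp add: decay_iff dtau_dth_funpow[OF sm])
  qed
  then show ?thesis by (simp add: decay_iff)
qed

text \<open>\<open>half_line_limit\<close> applies with H the integrated tail of the bound on the
  derivative; \<open>tail_bound\<close> returns the result to polynomial form at the same
  rate.\<close>

lemma bnd_limit:
  assumes sm: "smooth_half t0 f" and "bnd a (dtau t0 f)" "0 < a"
  obtains h where "bnd a (\<lambda>t x. f t x - h x)"
proof -
  obtain C m where C: "0 < C" "\<And>k t x. m \<le> k \<Longrightarrow> t0 \<le> t \<Longrightarrow> \<bar>dtau t0 f t x\<bar> \<le> C * t ^ k * exp (- a * t)"
    using assms(2) by (metis bndE)
  obtain K where K: "0 \<le> K" "\<And>t. 1 \<le> t \<Longrightarrow> tail a m t \<le> K * t ^ m"
    using tail_bound[OF assms(3)] by metis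
  have "\<exists>l. \<forall>t\<ge>t0. \<bar>f t x - l\<bar> \<le> C * (tail a m t * exp (- a * t))" for x
  proof (rule half_line_limit)
      show "((\<lambda>t. f t x) has_real_derivative dtau t0 f t x) (at t within {t0..})" if "t0 \<le> t" for t
        by (rule smooth_half_DERIV_tau[OF sm that])
      show "((\<lambda>t. C * (tail a m t * exp (- a * t))) has_real_derivative C * - (t ^ m * exp (- a * t))) (at t within {t0..})"
        for t by (intro DERIV_cmult tail_exp_DERIV) (use assms(3) in auto)
      show "\<bar>dtau t0 f t x\<bar> \<le> - (C * - (t ^ m * exp (- a * t)))" if "t0 \<le> t" for t
        using C(2)[OF order_refl that, of x] by (simp add: mult.assoc)
      show "0 \<le> C * (tail a m t * exp (- a * t))" if "t0 \<le> t" for t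
        using C(1) that t0 tail_nonneg[OF assms(3), of t m] by simp
  qed
  then obtain h where h: "\<And>x t. t0 \<le> t \<Longrightarrow> \<bar>f t x - h x\<bar> \<le> C * (tail a m t * exp (- a * t))" by metis
  have "\<bar>f t x - h x\<bar> \<le> (C * K) * t ^ m * exp (- a * t)" if t: "t0 \<le> t" for t x
  proof -
    have "C * (tail a m t * exp (- a * t)) \<le> C * (K * t ^ m * exp (- a * t))"
      using C(1) K(2)[of t] t t0 by (intro mult_left_mono mult_right_mono) auto
    then show ?thesis using h[OF t, of x] by (simp add: mult.assoc)
  qed
  then have "bnd a (\<lambda>t x. f t x - h x)" by (rule bndI)
  then show ?thesis by (rule that)
qed

text \<open>Sampling at \<open>t0 + real n\<close> turns the limit in continuous time into a
  sequence, the setting of the theorem on differentiating limits.\<close>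

lemma bnd_uniform_limit:
  assumes "bnd a f" "0 < a" "0 < e"
  shows "\<forall>\<^sub>F n in sequentially. \<forall>x. \<bar>f (t0 + real n) x\<bar> < e"
proof -
  obtain C m where C: "0 < C" "\<And>k t x. m \<le> k \<Longrightarrow> t0 \<le> t \<Longrightarrow> \<bar>f t x\<bar> \<le> C * t ^ k * exp (- a * t)"
    using assms(1) by (metis bndE)
  have "((\<lambda>t. C * (t ^ m * exp (- a * t))) \<longlongrightarrow> C * 0) at_top"
    by (intro tendsto_intros power_exp_tendsto_0 assms)
  then have "\<forall>\<^sub>F t in at_top. C * (t ^ m * exp (- a * t)) < e"
    using assms(3) by (auto dest: order_tendstoD)
  moreover have "filterlim (\<lambda>n. t0 + real n) at_top sequentially"
    by (rule filterlim_tendsto_add_at_top[OF tendsto_const filterlim_real_sequentially])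
  ultimately have "\<forall>\<^sub>F n in sequentially. C * ((t0 + real n) ^ m * exp (- a * (t0 + real n))) < e"
    by (rule eventually_compose_filterlim)
  then show ?thesis
  proof eventually_elim
    case (elim n)
    show ?case
    proof
      fix x
      show "\<bar>f (t0 + real n) x\<bar> < e"
        using C(2)[OF order_refl, of "t0 + real n" x] elim by (simp add: mult.assoc)
    qed
  qed
qed

lemma bnd_pointwise_limit: "bnd a (\<lambda>t x. f t x - h x) \<Longrightarrow> 0 < a \<Longrightarrow> (\<lambda>n. f (t0 + real n) x) \<longlonglongrightarrow> h x"
  unfolding LIMSEQ_def dist_real_def
  using bnd_uniform_limit[of a "\<lambda>t x. f t x - h x"] by (simp add: eventually_sequentially) meson

text \<open>Since \<open>dth\<close> commutes with \<open>dtau\<close>, each angular derivative of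
  \<open>f\<close> converges uniformly to some \<open>L n\<close>. Uniform convergence of the
  derivatives makes \<open>L (Suc n)\<close> the derivative of \<open>L n\<close>, so
  \<open>L 0\<close> is smooth and the errors of all orders decay at rate \<open>a\<close>.\<close>

lemma decay_limit:
  assumes sm: "smooth_half t0 f" and dec: "\<And>k. decay k a (dtau t0 f)" and a: "0 < a"
  obtains h where "smooth_S1 h" "\<And>k. decay k a (\<lambda>t x. f t x - h x)"
proof -
  have "\<exists>h. bnd a (\<lambda>t x. (dth ^^ n) f t x - h x)" for n
  proof -
    have "bnd a (dtau t0 ((dth ^^ n) f))"
      using dec[of n] bnd_cong[of "dtau t0 ((dth ^^ n) f)" "(dth ^^ n) (dtau t0 f)"]
      by (simp add: decay_iff dtau_dth_funpow[OF sm])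
    then show ?thesis using bnd_limit[OF smooth_half_dth_funpow[OF sm]] a by metis
  qed
  then obtain L where L: "\<And>n. bnd a (\<lambda>t x. (dth ^^ n) f t x - L n x)" by metis
  have lim: "(\<lambda>j. (dth ^^ n) f (t0 + real j) x) \<longlonglongrightarrow> L n x" for n x
    by (rule bnd_pointwise_limit[OF L a])
  have L': "(L n has_real_derivative L (Suc n) x) (at x)" for n x
  proof -
    \<comment> \<open>Differentiating the limit yields some g with the right derivative; g is
      \<open>L n\<close> by uniqueness of limits.\<close>
    have "\<exists>g. \<forall>x\<in>UNIV. (\<lambda>j. (dth ^^ n) f (t0 + real j) x) \<longlonglongrightarrow> g x \<and> (g has_derivative (*) (L (Suc n) x)) (at x within UNIV)"
    proof (rule has_derivative_sequence)
      show "((dth ^^ n) f (t0 + real j) has_derivative (*) ((dth ^^ Suc n) f (t0 + real j) x)) (at x within UNIV)" for j x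
        using smooth_half_DERIV_th[OF smooth_half_dth_funpow[OF sm, of n], of "t0 + real j" x]
        by (simp add: has_field_derivative_def)
      show "\<forall>\<^sub>F j in sequentially. \<forall>x\<in>UNIV. \<forall>h.
          norm ((dth ^^ Suc n) f (t0 + real j) x * h - L (Suc n) x * h) \<le> e * norm h" if "e > 0" for e
        using bnd_uniform_limit[OF L a that, of "Suc n"]
      proof eventually_elim
        case (elim j)
        have "\<bar>((dth ^^ Suc n) f (t0 + real j) x - L (Suc n) x) * h\<bar> \<le> e * \<bar>h\<bar>" for x h
          unfolding abs_mult by (rule mult_right_mono[OF less_imp_le[OF elim[rule_format]]]) simp
        then show ?case by (simp add: left_diff_distrib)
      qed
    qed (use lim in auto)
    then obtain g where g: "\<And>x. (\<lambda>j. (dth ^^ n) f (t0 + real j) x) \<longlonglongrightarrow> g x" 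
      "\<And>x. (g has_derivative (*) (L (Suc n) x)) (at x)" by auto
    then have "g = L n" using lim LIMSEQ_unique by blast
    then show ?thesis using g(2) by (simp add: has_field_derivative_def)
  qed
  have Lder: "(deriv ^^ n) (L 0) = L n" for n
  proof (induction n)
    case (Suc n)
    have "deriv (L n) = L (Suc n)" using L' by (auto intro: DERIV_imp_deriv)
    with Suc show ?case by simp
  qed simp
  have "L 0 (x + 2 * pi) = L 0 x" for x
    using lim[of 0 "x + 2 * pi"] lim[of 0 x] smooth_half_periodic[OF sm] LIMSEQ_unique by force
  then have smL: "smooth_S1 (L 0)"
    using L' by (auto simp: smooth_S1_def Lder real_differentiable_def)
  moreover have "decay k a (\<lambda>t x. f t x - L 0 x)" for k
  proof -
    have eq: "(dth ^^ n) (\<lambda>t x. f t x - L 0 x) t x = (dth ^^ n) f t x - L n x" if "t0 \<le> t" for n t x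
      using that
    proof (induction n arbitrary: t x)
      case (Suc n)
      have "(dth ^^ Suc n) (\<lambda>t x. f t x - L 0 x) t x = dth (\<lambda>t x. (dth ^^ n) f t x - L n x) t x"
        using Suc by (auto intro!: dth_cong)
      also have "\<dots> = (dth ^^ Suc n) f t x - L (Suc n) x"
        by (rule dth_eqI)
          (use smooth_half_DERIV_th[OF smooth_half_dth_funpow[OF sm, of n] Suc.prems, of x] L'[of n x]
           in \<open>auto intro!: derivative_eq_intros\<close>)
      finally show ?case .
    qed simp
    have "bnd a ((dth ^^ n) (\<lambda>t x. f t x - L 0 x))" for n
      using L[of n] bnd_cong[of "(dth ^^ n) (\<lambda>t x. f t x - L 0 x)" "\<lambda>t x. (dth ^^ n) f t x - L n x" a] eq by simp
    then show ?thesis by (simp add: decay_iff)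
  qed
  ultimately show ?thesis using that by blast
qed

end

section \<open>The first-order form of the equations\<close>

text \<open>The one-sided principle for the family doubled by signs: each function and its negative
  under the same barrier.\<close>

lemma comparison_principle_abs:
  fixes f :: "'i \<Rightarrow> real \<Rightarrow> real \<Rightarrow> real" and h h' :: "'i \<Rightarrow> real \<Rightarrow> real"
  assumes fin: "finite I" and sm: "\<And>i. i \<in> I \<Longrightarrow> smooth_half t0 (f i)"
    and h: "\<And>i t. i \<in> I \<Longrightarrow> t0 \<le> t \<Longrightarrow> (h i has_real_derivative h' i t) (at t)"
    and init: "\<And>i x. i \<in> I \<Longrightarrow> \<bar>f i t0 x\<bar> < h i t0"
    and step: "\<And>i t x \<sigma>. \<lbrakk>i \<in> I; t0 < t; \<bar>\<sigma>\<bar> = 1; \<And>j y. j \<in> I \<Longrightarrow> \<bar>f j t y\<bar> \<le> h j t;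
       \<sigma> * f i t x = h i t; dth (f i) t x = 0\<rbrakk> \<Longrightarrow> \<sigma> * dtau t0 (f i) t x < h' i t"
    and i: "i \<in> I" and t: "t0 \<le> t"
  shows "\<bar>f i t x\<bar> < h i t"
proof -
  define g where "g = (\<lambda>(j, \<sigma>) t x. \<sigma> * f j t x)"
  have smg: "smooth_half t0 (g k)" if "k \<in> I \<times> {-1, 1}" for k
    using that by (auto simp: g_def intro!: smooth_intros sm)
  have dt: "dtau t0 (g (j, \<sigma>)) s y = \<sigma> * dtau t0 (f j) s y" if "j \<in> I" "t0 \<le> s" for j \<sigma> s y
    by (rule dtau_eqI) (use that in \<open>auto simp: g_def intro!: DERIV_cmult smooth_half_DERIV_tau sm\<close>)
  have dx: "dth (g (j, \<sigma>)) s y = \<sigma> * dth (f j) s y" if "j \<in> I" "t0 \<le> s" for j \<sigma> s y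
    by (rule dth_eqI) (use that in \<open>auto simp: g_def intro!: DERIV_cmult smooth_half_DERIV_th sm\<close>)
  have "g k t y < h (fst k) t" if k: "k \<in> I \<times> {-1, 1}" for k y
  proof (rule comparison_principle[where I = "I \<times> {-1, 1}" and f = g and h = "h \<circ> fst" and h' = "h' \<circ> fst" and T = t,
        unfolded o_apply])
    show "g k t0 x < h (fst k) t0" if "k \<in> I \<times> {-1, 1}" for k x
      using that init[of "fst k" x] by (auto simp: g_def abs_less_iff)
    fix k s x
    assume k: "k \<in> I \<times> {-1, 1 :: real}" and s: "t0 < s" and le: "\<And>j y. j \<in> I \<times> {-1, 1} \<Longrightarrow> g j s y \<le> h (fst j) s"
      and touch: "g k s x = h (fst k) s" and zero: "dth (g k) s x = 0"
    obtain j \<sigma> where jk: "k = (j, \<sigma>)" "j \<in> I" "\<bar>\<sigma>\<bar> = 1" using k by auto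
    have "\<bar>f i s y\<bar> \<le> h i s" if "i \<in> I" for i y
      using le[of "(i, 1)" y] le[of "(i, -1)" y] that by (auto simp: g_def abs_le_iff)
    then have "\<sigma> * dtau t0 (f j) s x < h' j s"
      using touch zero jk s by (intro step) (auto simp: dx, auto simp: g_def)
    then show "dtau t0 (g k) s x < h' (fst k) s"
      using jk s by (simp add: dt)
  qed (use fin smg h k t in auto)
  from this[of "(i, 1)" x] this[of "(i, -1)" x] i show ?thesis by (auto simp: g_def abs_less_iff)
qed

text \<open>The standard barrier. Its logarithmic derivative is \<open>N / t - a\<close>, so a large
  \<open>N\<close> leaves room for errors of relative size C/t without changing the rate.\<close>

lemma poly_exp_DERIV:
  "0 < t \<Longrightarrow> ((\<lambda>t. M * t ^ N * exp (- a * t)) has_real_derivative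
     (real N / t - a) * (M * t ^ N * exp (- a * t))) (at t)"
proof -
  assume "0 < t"
  \<comment> \<open>For \<open>N = 0\<close> the truncated exponent is harmless because both sides
    carry the factor \<open>N\<close>.\<close>
  then have "real N * t ^ (N - Suc 0) = real N / t * t ^ N" by (cases N) auto
  then show ?thesis by (auto intro!: derivative_eq_intros simp: algebra_simps)
qed

text \<open>Booleans index the two families of characteristics, so \<open>\<not> s\<close> is the
  opposite family and one statement covers both signs.\<close>

definition sg :: "bool \<Rightarrow> real" where "sg s = (if s then 1 else -1)"

lemma sg_simps [simp]: "sg (\<not> s) = - sg s" "sg s * sg s = 1" "sg s * (sg s * z) = z" "\<bar>sg s\<bar> = 1"
  by (auto simp: sg_def)

section \<open>The transported first-order quantities and their energy\<close>

locale gowdy = half_line t0 for t0 :: real +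
  fixes P Q :: "real \<Rightarrow> real \<Rightarrow> real"
  assumes smP: "smooth_half t0 P" and smQ: "smooth_half t0 Q"
    and eqP: "\<And>t x. t \<ge> t0 \<Longrightarrow>
       dtau t0 (dtau t0 P) t x - exp (-2*t) * dth (dth P) t x
       - exp (2 * P t x) * ((dtau t0 Q t x)\<^sup>2 - exp (-2*t) * (dth Q t x)\<^sup>2) = 0"
    and eqQ: "\<And>t x. t \<ge> t0 \<Longrightarrow>
       dtau t0 (dtau t0 Q) t x - exp (-2*t) * dth (dth Q) t x
       + 2 * (dtau t0 P t x * dtau t0 Q t x - exp (-2*t) * dth P t x * dth Q t x) = 0"
begin

lemma t_pos: "t0 \<le> t \<Longrightarrow> 0 < t" using t0 by linarith

definition u :: "bool \<Rightarrow> real \<Rightarrow> real \<Rightarrow> real" where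
  "u s t x = dtau t0 P t x + sg s * (exp (- t) * dth P t x)"

definition W :: "bool \<Rightarrow> real \<Rightarrow> real \<Rightarrow> real" where
  "W s t x = exp (P t x) * (dtau t0 Q t x + sg s * (exp (- t) * dth Q t x))"

lemma smooth_u: "smooth_half t0 (u s)"
  unfolding u_def[abs_def] by (intro smooth_intros smP)

lemma smooth_W: "smooth_half t0 (W s)"
  unfolding W_def[abs_def] by (intro smooth_intros smP smQ)

lemma exp_square: "exp (-2 * t) = exp (- t) * exp (- t :: real)" "exp (2 * y) = exp y * exp (y :: real)"
  by (simp_all add: exp_add[symmetric])

text \<open>Mixed derivatives cancel, the equation for P removes the second derivatives, and its
  nonlinearity factors as the product of the two W. Differentiating the weight
  \<open>exp (- t)\<close> leaves the half difference of the two u.\<close>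

lemma u_transport:
  assumes t: "t0 \<le> t"
  shows "dtau t0 (u s) t x - sg s * exp (- t) * dth (u s) t x
     = W s t x * W (\<not> s) t x - (u s t x - u (\<not> s) t x) / 2"
proof -
  note sm = smP smooth_half_dtau[OF smP] smooth_half_dth[OF smP]
  have a: "dtau t0 (u s) t x = dtau t0 (dtau t0 P) t x + sg s * (exp (- t) * dth (dtau t0 P) t x - exp (- t) * dth P t x)"
    unfolding u_def[abs_def]
    by (rule dtau_eqI[OF _ t]) (use t smooth_half_dth_dtau[OF smP t] in
      \<open>auto intro!: derivative_eq_intros smooth_half_DERIV_tau sm simp: algebra_simps\<close>)
  have b: "dth (u s) t x = dth (dtau t0 P) t x + sg s * (exp (- t) * dth (dth P) t x)"
    unfolding u_def[abs_def]
    by (rule dth_eqI) (use t in \<open>auto intro!: derivative_eq_intros smooth_half_DERIV_th sm\<close>)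
  have c: "dtau t0 (dtau t0 P) t x = exp (- t) * exp (- t) * dth (dth P) t x
       + exp (P t x) * exp (P t x) * ((dtau t0 Q t x)\<^sup>2 - exp (- t) * exp (- t) * (dth Q t x)\<^sup>2)"
    using eqP[OF t, of x] unfolding exp_square by simp
  show ?thesis
    unfolding a b c u_def W_def by (cases s) (simp_all add: sg_def algebra_simps power2_eq_square)
qed

text \<open>As for u; moreover the derivative of \<open>exp (P t x)\<close> contributes
  \<open>u (\<not> s) t x * W s t x\<close>, which cancels one half of the bilinear term of the Q
  equation and leaves the other half, the cross term.\<close>

lemma W_transport:
  assumes t: "t0 \<le> t"
  shows "dtau t0 (W s) t x - sg s * exp (- t) * dth (W s) t x
     = - (W s t x - W (\<not> s) t x) / 2 - u s t x * W (\<not> s) t x"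
proof -
  note sm = smP smQ smooth_half_dtau[OF smQ] smooth_half_dth[OF smQ]
  have a: "dtau t0 (W s) t x = dtau t0 P t x * W s t x + exp (P t x) * (dtau t0 (dtau t0 Q) t x
      + sg s * (exp (- t) * dth (dtau t0 Q) t x - exp (- t) * dth Q t x))"
    unfolding W_def[abs_def]
    by (rule dtau_eqI[OF _ t]) (use t smooth_half_dth_dtau[OF smQ t] in
      \<open>auto intro!: derivative_eq_intros smooth_half_DERIV_tau sm simp: algebra_simps\<close>)
  have b: "dth (W s) t x = dth P t x * W s t x
      + exp (P t x) * (dth (dtau t0 Q) t x + sg s * (exp (- t) * dth (dth Q) t x))"
    unfolding W_def[abs_def]
    by (rule dth_eqI) (use t in \<open>auto intro!: derivative_eq_intros smooth_half_DERIV_th sm simp: algebra_simps\<close>)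
  have c: "dtau t0 (dtau t0 Q) t x = exp (- t) * exp (- t) * dth (dth Q) t x
       - 2 * (dtau t0 P t x * dtau t0 Q t x - exp (- t) * exp (- t) * dth P t x * dth Q t x)"
    using eqQ[OF t, of x] unfolding exp_square by simp
  show ?thesis
    unfolding a b c u_def W_def by (cases s) (simp_all add: sg_def algebra_simps power2_eq_square)
qed

text \<open>The expressions under the two suprema in F, now as functions of time and angle.\<close>

definition energy :: "bool \<Rightarrow> real \<Rightarrow> real \<Rightarrow> real" where
  "energy s t x = (u s t x - P t x * inverse t)\<^sup>2 + (W s t x)\<^sup>2"

lemma smooth_energy: "smooth_half t0 (energy s)"
  unfolding energy_def[abs_def]
  by (intro smooth_intros smP smooth_u smooth_W smooth_half_inverse) (use t0 in auto)

text \<open>The cubic terms coming from the u and W equations cancel, except for the part of u given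
  by P/t. What remains is damping and two bilinear terms with explicit coefficients.\<close>

lemma energy_transport:
  assumes t: "t0 \<le> t"
  shows "dtau t0 (energy s) t x - sg s * exp (- t) * dth (energy s) t x
     = - energy s t x + (1 - 2 / t) * ((u s t x - P t x / t) * (u (\<not> s) t x - P t x / t))
       + (1 - 2 * P t x / t) * (W s t x * W (\<not> s) t x)"
proof -
  note sm = smP smooth_u smooth_W
  have t': "t \<noteq> 0" using t_pos[OF t] by simp
  define i where "i = inverse t"
  define U where "U s = u s t x - P t x * i" for s
  have a: "dtau t0 (energy s) t x = 2 * U s * (dtau t0 (u s) t x - (dtau t0 P t x * i - P t x * (i * i)))
      + 2 * W s t x * dtau t0 (W s) t x"
    unfolding energy_def[abs_def] U_def i_def
    by (rule dtau_eqI[OF _ t], rule DERIV_cong, (rule derivative_intros smooth_half_DERIV_tau sm t t')+)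
       (simp add: algebra_simps)
  have b: "dth (energy s) t x = 2 * U s * (dth (u s) t x - dth P t x * i) + 2 * W s t x * dth (W s) t x"
    unfolding energy_def[abs_def] U_def i_def
    by (rule dth_eqI, rule DERIV_cong, (rule derivative_intros smooth_half_DERIV_th sm t t')+)
       (simp add: algebra_simps)
  have c: "dtau t0 P t x - sg s * exp (- t) * dth P t x = u (\<not> s) t x"
    by (simp add: u_def)
  have "dtau t0 (energy s) t x - sg s * exp (- t) * dth (energy s) t x
    = 2 * U s * ((dtau t0 (u s) t x - sg s * exp (- t) * dth (u s) t x)
        - (dtau t0 P t x - sg s * exp (- t) * dth P t x) * i + P t x * (i * i))
      + 2 * W s t x * (dtau t0 (W s) t x - sg s * exp (- t) * dth (W s) t x)"
    unfolding a b by (simp add: algebra_simps)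
  also have "\<dots> = 2 * U s * (W s t x * W (\<not> s) t x - (U s - U (\<not> s)) / 2 - i * U (\<not> s))
      + 2 * W s t x * (- (W s t x - W (\<not> s) t x) / 2 - (U s + P t x * i) * W (\<not> s) t x)"
    unfolding u_transport[OF t] W_transport[OF t] c U_def by (simp add: algebra_simps diff_divide_distrib)
  also have "\<dots> = - ((U s)\<^sup>2 + (W s t x)\<^sup>2) + (1 - 2 * i) * (U s * U (\<not> s))
      + (1 - 2 * P t x * i) * (W s t x * W (\<not> s) t x)"
    by (simp add: algebra_simps power2_eq_square diff_divide_distrib)
  finally show ?thesis by (simp add: U_def i_def energy_def divide_inverse)
qed

text \<open>On this range of P both bilinear coefficients are at most \<open>1 - 2 / t\<close> in
  absolute value. At a touching point the densities are thus governed by a linear 2 by 2 system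
  whose solutions have a sum proportional to \<open>1 / t\<^sup>2\<close>. Extra growth at rate
  \<epsilon> makes such a solution a strict barrier; finally \<epsilon> tends to 0.\<close>

lemma energy_decay:
  assumes t2: "2 \<le> t0" and P: "\<And>t x. t0 \<le> t \<Longrightarrow> t \<le> T \<Longrightarrow> 1 \<le> P t x \<and> P t x \<le> t - 1"
    and init: "\<And>s x. energy s t0 x \<le> F s" and t: "t0 \<le> t" "t \<le> T"
  shows "energy True t x + energy False t x \<le> (F True + F False) * (t0 / t)\<^sup>2"
proof -
  have perturbed: "energy True t x + energy False t x \<le> (F True + F False + 2 * \<epsilon>) * (t0 / t)\<^sup>2 * exp (\<epsilon> * (t - t0))"
    if \<epsilon>: "0 < \<epsilon>" for \<epsilon>
  proof -
    define S0 where "S0 = F True + F False + 2 * \<epsilon>"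
    define d where "d = F True - F False"
    define G where "G r = S0 * (t0 * inverse r)\<^sup>2 * exp (\<epsilon> * (r - t0))" for r
    \<comment> \<open>The two barriers have sum \<open>G r\<close> and difference
      \<open>d * exp (- (r - t0))\<close>, the two modes of the comparison system (up to
      \<epsilon>). At \<open>t0\<close> they equal \<open>F s + \<epsilon>\<close>.\<close>
    define h where "h s r = (G r + sg s * d * exp (- (r - t0))) / 2" for s r
    define h' where "h' s r = ((- 2 / r + \<epsilon>) * G r - sg s * d * exp (- (r - t0))) / 2" for s r
    have "0 \<le> F s" for s using init[of s 0] by (simp add: energy_def) (smt (verit) zero_le_power2)
    then have "S0 > 0" using \<epsilon> by (simp add: S0_def add_nonneg_pos)
    then have G_pos: "G r > 0" if "t0 \<le> r" for r
      using t_pos[OF that] t_pos[OF order_refl] by (simp add: G_def)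
    have G': "(G has_real_derivative (- 2 / r + \<epsilon>) * G r) (at r)" if "t0 \<le> r" for r
    proof -
      have "r \<noteq> 0" using t_pos[OF that] by simp
      show ?thesis
        unfolding G_def[abs_def] divide_inverse
        by (rule DERIV_cong, (rule derivative_intros \<open>r \<noteq> 0\<close>)+) (simp add: algebra_simps power2_eq_square)
    qed
    have main: "energy s t x < h s t" for s
    proof (rule comparison_principle[of UNIV t0 energy h h' T])
      show "(h s has_real_derivative h' s r) (at r)" if "t0 \<le> r" for s r
        unfolding h_def[abs_def] h'_def
        by (rule DERIV_cong, rule DERIV_cdivide, (rule derivative_intros G'[OF that])+) (simp add: algebra_simps)
      show "energy s t0 y < h s t0" for s y
        using init[of s y] \<epsilon> t2 by (cases s) (auto simp: h_def G_def S0_def d_def sg_def)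
      fix s r y
      assume r: "t0 < r" "r \<le> T" and le: "\<And>s y. s \<in> UNIV \<Longrightarrow> energy s r y \<le> h s r"
        and touch: "energy s r y = h s r" and zero: "dth (energy s) r y = 0"
      define U where "U s = u s r y - P r y / r" for s
      have en: "energy s r y = (U s)\<^sup>2 + (W s r y)\<^sup>2" for s
        by (simp add: energy_def U_def divide_inverse)
      have r0: "0 < r" "2 \<le> r" using r t2 by auto
      have "1 / r \<le> P r y / r" "P r y / r \<le> (r - 1) / r"
        using P[of r y] r r0 by (auto intro!: divide_right_mono)
      moreover have "(r - 1) / r = 1 - 1 / r" using r0 by (simp add: diff_divide_distrib)
      ultimately have c: "\<bar>1 - 2 * P r y / r\<bar> \<le> 1 - 2 / r"
        by (simp add: abs_le_iff)
      have "dtau t0 (energy s) r y = - energy s r y + (1 - 2 / r) * (U s * U (\<not> s))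
         + (1 - 2 * P r y / r) * (W s r y * W (\<not> s) r y)"
        using energy_transport[of r s y] r zero by (simp add: U_def)
      also have "\<dots> \<le> - energy s r y + (1 - 2 / r) * (((U s)\<^sup>2 + (U (\<not> s))\<^sup>2) / 2)
         + (1 - 2 / r) * (((W s r y)\<^sup>2 + (W (\<not> s) r y)\<^sup>2) / 2)"
      proof -
        have ab: "\<bar>a * b\<bar> \<le> (a\<^sup>2 + b\<^sup>2) / 2" for a b :: real
          using sum_squares_bound[of "\<bar>a\<bar>" "\<bar>b\<bar>"] by (simp add: abs_mult)
        have "(1 - 2 / r) * (U s * U (\<not> s)) \<le> (1 - 2 / r) * (((U s)\<^sup>2 + (U (\<not> s))\<^sup>2) / 2)"
          using abs_le_D1[OF ab[of "U s" "U (\<not> s)"]] r0 by (intro mult_left_mono) auto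
        moreover have "(1 - 2 * P r y / r) * (W s r y * W (\<not> s) r y)
            \<le> (1 - 2 / r) * (((W s r y)\<^sup>2 + (W (\<not> s) r y)\<^sup>2) / 2)"
        proof -
          have "(1 - 2 * P r y / r) * (W s r y * W (\<not> s) r y) \<le> \<bar>1 - 2 * P r y / r\<bar> * \<bar>W s r y * W (\<not> s) r y\<bar>"
            by (simp add: abs_mult[symmetric])
          also have "\<dots> \<le> (1 - 2 / r) * (((W s r y)\<^sup>2 + (W (\<not> s) r y)\<^sup>2) / 2)"
            by (intro mult_mono c ab) (use r0 in auto)
          finally show ?thesis .
        qed
        ultimately show ?thesis by linarith
      qed
      also have "\<dots> = - energy s r y + (1 - 2 / r) * ((energy s r y + energy (\<not> s) r y) / 2)"
        unfolding en by (simp add: algebra_simps add_divide_distrib)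
      also have "\<dots> \<le> - h s r + (1 - 2 / r) * ((h s r + h (\<not> s) r) / 2)"
        using r0 touch le[of "\<not> s" y] by (intro add_mono mult_left_mono divide_right_mono) auto
      also have "\<dots> = - h s r + (1 - 2 / r) * (G r / 2)"
        by (simp add: h_def add_divide_distrib[symmetric])
      also have "\<dots> < h' s r"
      proof -
        have "h' s r - (- h s r + (1 - 2 / r) * (G r / 2)) = \<epsilon> * G r / 2"
          by (simp add: h_def h'_def algebra_simps add_divide_distrib diff_divide_distrib)
        moreover have "\<epsilon> * G r / 2 > 0" using \<epsilon> G_pos[of r] r by simp
        ultimately show ?thesis by linarith
      qed
      finally show "dtau t0 (energy s) r y < h' s r" .
    qed (use t smooth_energy in auto)
    have "h True t + h False t = G t" by (simp add: h_def sg_def add_divide_distrib[symmetric])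
    then show ?thesis using main[of True] main[of False] by (simp add: G_def S0_def divide_inverse)
  qed
  have lim: "((\<lambda>\<epsilon>. (F True + F False + 2 * \<epsilon>) * (t0 / t)\<^sup>2 * exp (\<epsilon> * (t - t0)))
      \<longlongrightarrow> (F True + F False + 2 * 0) * (t0 / t)\<^sup>2 * exp (0 * (t - t0))) (at_right 0)"
    by (intro tendsto_intros)
  have "\<forall>\<^sub>F \<epsilon> in at_right (0::real). energy True t x + energy False t x
      \<le> (F True + F False + 2 * \<epsilon>) * (t0 / t)\<^sup>2 * exp (\<epsilon> * (t - t0))"
    using eventually_at_right_less by (rule eventually_mono) (rule perturbed)
  from tendsto_lowerbound[OF lim this] show ?thesis by simp
qed

end

section \<open>The range of P\<close>

text \<open>One-sided continuity; it carries the closed conditions on P over to the infimum of the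
  times at which they might fail.\<close>

lemma nonneg_left_limit:
  assumes z: "(z has_real_derivative d) (at T within {t0..})" and "t0 < T"
    and nonneg: "\<And>r. t0 \<le> r \<Longrightarrow> r < T \<Longrightarrow> 0 \<le> z r"
  shows "0 \<le> z (T :: real)"
proof -
  have "(z \<longlongrightarrow> z T) (at T within {t0..<T})"
    using DERIV_continuous[OF z] by (auto simp: continuous_within intro: tendsto_within_subset)
  moreover have "at T within {t0..<T} \<noteq> bot"
    using \<open>t0 < T\<close> by (simp add: trivial_limit_within islimpt_Ico)
  moreover have "\<forall>\<^sub>F r in at T within {t0..<T}. 0 \<le> z r"
    using nonneg by (auto simp: eventually_at_filter intro!: always_eventually)
  ultimately show ?thesis using tendsto_lowerbound by blast
qed

locale gowdy_small = gowdy t0 P Q for t0 P Q +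
  fixes \<gamma> \<alpha> :: real
  assumes t2: "2 \<le> t0"
    and bnd1: "\<And>x. 1 \<le> P t0 x \<and> P t0 x \<le> t0 - 1"
    and bnd2: "\<And>x. \<gamma> \<le> P t0 x / t0 \<and> P t0 x / t0 \<le> 1 - \<gamma>"
    and alpha: "0 < \<alpha>" "\<alpha> < \<gamma>"
    and Fbnd: "Fen t0 P Q t0 \<le> (\<gamma> - \<alpha>)\<^sup>2"
begin

text \<open>The bounds are the two suprema themselves; the factors 1/2 in F become the 2 on the
  right.\<close>

lemma energy_init:
  obtains F where "\<And>s x. energy s t0 x \<le> F s" "F True + F False \<le> 2 * (\<gamma> - \<alpha>)\<^sup>2"
proof -
  define F where "F s = (SUP x. energy s t0 x)" for s
  have "energy s t0 x \<le> F s" for s x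
  proof -
    obtain B where "\<And>x. \<bar>energy s t0 x\<bar> \<le> B"
      using smooth_half_bounded[OF smooth_energy order_refl] by metis
    then have "bdd_above (range (energy s t0))"
      by (auto simp: bdd_above_def abs_le_iff)
    then show ?thesis unfolding F_def by (intro cSUP_upper) auto
  qed
  moreover have "energy True t0 x = (dtau t0 P t0 x - 1/t0 * P t0 x + exp (-t0) * dth P t0 x)\<^sup>2
      + exp (2 * P t0 x) * (dtau t0 Q t0 x + exp (-t0) * dth Q t0 x)\<^sup>2" for x
    unfolding energy_def u_def W_def sg_def exp_square
    by (simp add: power_mult_distrib inverse_eq_divide power2_eq_square algebra_simps)
  moreover have "energy False t0 x = (dtau t0 P t0 x - 1/t0 * P t0 x - exp (-t0) * dth P t0 x)\<^sup>2
      + exp (2 * P t0 x) * (dtau t0 Q t0 x - exp (-t0) * dth Q t0 x)\<^sup>2" for x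
    unfolding energy_def u_def W_def sg_def exp_square
    by (simp add: power_mult_distrib inverse_eq_divide power2_eq_square algebra_simps)
  ultimately show ?thesis
    using that[of F] Fbnd by (simp add: Fen_def F_def)
qed

text \<open>The bootstrap hypothesis: the range of P on which the energy is known to decay.\<close>

definition admissible :: "real \<Rightarrow> bool" where
  "admissible T \<longleftrightarrow> (\<forall>t x. t0 \<le> t \<longrightarrow> t \<le> T \<longrightarrow> 1 \<le> P t x \<and> P t x \<le> t - 1)"

text \<open>The two deviations have squares summing to at most \<open>2 * b\<^sup>2\<close>, so each
  is at most \<open>2 * b\<close>. As \<open>dtau t0 P\<close> is the mean of the two u, its
  deviation is at most \<open>b\<close>, a square of a mean being at most the mean of the squares.
  This sharper constant is what closes the bootstrap.\<close>

lemma deviation: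
  assumes "admissible T" and t: "t0 \<le> t" "t \<le> T"
  shows "\<bar>u s t x - P t x / t\<bar> \<le> 2 * ((\<gamma> - \<alpha>) * (t0 / t))"
    and "\<bar>dtau t0 P t x - P t x / t\<bar> \<le> (\<gamma> - \<alpha>) * (t0 / t)"
proof -
  obtain F where F: "\<And>s x. energy s t0 x \<le> F s" "F True + F False \<le> 2 * (\<gamma> - \<alpha>)\<^sup>2"
    using energy_init by metis
  have P: "1 \<le> P t x \<and> P t x \<le> t - 1" if "t0 \<le> t" "t \<le> T" for t x
    using assms(1) that by (auto simp: admissible_def)
  define b where "b = (\<gamma> - \<alpha>) * (t0 / t)"
  have b: "0 \<le> b" using alpha t2 t t_pos[OF t(1)] by (simp add: b_def)
  define U where "U s = u s t x - P t x / t" for s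
  have "(U True)\<^sup>2 + (U False)\<^sup>2 \<le> energy True t x + energy False t x"
    by (simp add: U_def energy_def divide_inverse)
  also have "\<dots> \<le> (F True + F False) * (t0 / t)\<^sup>2"
    by (rule energy_decay[OF t2 P F(1) t])
  also have "\<dots> \<le> 2 * (\<gamma> - \<alpha>)\<^sup>2 * (t0 / t)\<^sup>2"
    using F(2) by (rule mult_right_mono) simp
  also have "\<dots> = 2 * b\<^sup>2" by (simp only: b_def power_mult_distrib mult.assoc)
  finally have U: "(U True)\<^sup>2 + (U False)\<^sup>2 \<le> 2 * b\<^sup>2" .
  have "(U s)\<^sup>2 \<le> (2 * b)\<^sup>2"
  proof -
    have "(U s)\<^sup>2 \<le> (U True)\<^sup>2 + (U False)\<^sup>2" by (cases s) auto
    also have "\<dots> \<le> 4 * b\<^sup>2" using U by (rule order_trans) simp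
    finally show ?thesis by (simp add: power_mult_distrib)
  qed
  then have "\<bar>U s\<bar> \<le> 2 * b" using b abs_le_square_iff[of "U s" "2 * b"] by simp
  then show "\<bar>u s t x - P t x / t\<bar> \<le> 2 * ((\<gamma> - \<alpha>) * (t0 / t))"
    by (simp only: U_def b_def)
  have eq: "dtau t0 P t x - P t x / t = (U True + U False) / 2"
    by (simp add: U_def u_def sg_def)
  have "((U True + U False) / 2)\<^sup>2 \<le> b\<^sup>2"
    using U sum_squares_bound[of "U True" "U False"] by (simp add: power2_eq_square field_simps)
  then have "\<bar>dtau t0 P t x - P t x / t\<bar> \<le> b"
    unfolding eq using b abs_le_square_iff[of "(U True + U False) / 2" b] by simp
  then show "\<bar>dtau t0 P t x - P t x / t\<bar> \<le> (\<gamma> - \<alpha>) * (t0 / t)"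
    by (simp only: b_def)
qed

text \<open>The time derivative of P/t is the deviation divided by t, hence at most
  \<open>c / t\<^sup>2\<close> in absolute value; so \<open>(P - c) / t\<close> is nondecreasing and
  \<open>(P + c) / t\<close> nonincreasing. The margin kept at time t equals the bound on the
  deviation at that time.\<close>

lemma P_ratio:
  assumes ok: "admissible T" and t: "t0 \<le> t" "t \<le> T"
  shows "\<alpha> + (\<gamma> - \<alpha>) * (t0 / t) \<le> P t x / t" "P t x / t \<le> 1 - \<alpha> - (\<gamma> - \<alpha>) * (t0 / t)"
proof -
  define c where "c = (\<gamma> - \<alpha>) * t0"
  have dev: "\<bar>dtau t0 P s x - P s x * inverse s\<bar> \<le> c * inverse s" if "t0 \<le> s" "s \<le> t" for s
    using deviation(2)[OF ok that(1), of x] that t by (simp add: c_def divide_inverse)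
  have "(P t0 x - c) * inverse t0 \<le> (P t x - c) * inverse t"
  proof (rule mono_half_line[of t0 "\<lambda>s. (P s x - c) * inverse s"
        "\<lambda>s. inverse s * (dtau t0 P s x - P s x * inverse s + c * inverse s)" t])
    show "((\<lambda>s. (P s x - c) * inverse s) has_real_derivative
        inverse s * (dtau t0 P s x - P s x * inverse s + c * inverse s)) (at s within {t0..})" if s: "t0 \<le> s" for s
    proof -
      have "s \<noteq> 0" using t_pos[OF s] by simp
      show ?thesis
        by (rule DERIV_cong, (rule derivative_intros smooth_half_DERIV_tau smP \<open>s \<noteq> 0\<close> s)+) (simp add: algebra_simps)
    qed
    show "0 \<le> inverse s * (dtau t0 P s x - P s x * inverse s + c * inverse s)" if "t0 \<le> s" "s \<le> t" for s
      using dev[OF that] t_pos[OF that(1)] by (intro mult_nonneg_nonneg) (auto simp: abs_le_iff)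
  qed (use t in auto)
  moreover have "(P t0 x - c) * inverse t0 = P t0 x / t0 - (\<gamma> - \<alpha>)"
    using t2 by (simp add: c_def field_simps)
  ultimately show "\<alpha> + (\<gamma> - \<alpha>) * (t0 / t) \<le> P t x / t"
    using bnd2[of x] by (simp add: c_def divide_inverse algebra_simps)
  have "- (P t0 x + c) * inverse t0 \<le> - (P t x + c) * inverse t"
  proof (rule mono_half_line[of t0 "\<lambda>s. - (P s x + c) * inverse s"
        "\<lambda>s. inverse s * (c * inverse s - (dtau t0 P s x - P s x * inverse s))" t])
    show "((\<lambda>s. - (P s x + c) * inverse s) has_real_derivative
        inverse s * (c * inverse s - (dtau t0 P s x - P s x * inverse s))) (at s within {t0..})" if s: "t0 \<le> s" for s
    proof -
      have "s \<noteq> 0" using t_pos[OF s] by simp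
      show ?thesis
        by (rule DERIV_cong, (rule derivative_intros smooth_half_DERIV_tau smP \<open>s \<noteq> 0\<close> s)+) (simp add: algebra_simps)
    qed
    show "0 \<le> inverse s * (c * inverse s - (dtau t0 P s x - P s x * inverse s))" if "t0 \<le> s" "s \<le> t" for s
      using dev[OF that] t_pos[OF that(1)] by (intro mult_nonneg_nonneg) (auto simp: abs_le_iff)
  qed (use t in auto)
  moreover have "- (P t0 x + c) * inverse t0 = - (P t0 x / t0) - (\<gamma> - \<alpha>)"
    using t2 by (simp add: c_def field_simps)
  ultimately show "P t x / t \<le> 1 - \<alpha> - (\<gamma> - \<alpha>) * (t0 / t)"
    using bnd2[of x] by (simp add: c_def divide_inverse algebra_simps)
qed

text \<open>The margin in \<open>P_ratio\<close> offsets the bound on the deviation exactly.\<close>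

lemma P_tau_range:
  assumes ok: "admissible T" and t: "t0 \<le> t" "t \<le> T"
  shows "\<alpha> \<le> dtau t0 P t x" "dtau t0 P t x \<le> 1 - \<alpha>"
  using deviation(2)[OF assms, of x] P_ratio[OF assms, of x] by (auto simp: abs_le_iff)

text \<open>A continuation argument. At the infimum \<open>S\<close> of the bad times the condition
  still holds by continuity, so \<open>dtau t0 P\<close> lies in
  \<open>[\<alpha>, 1 - \<alpha>]\<close> there. By uniform continuity it stays in [0, 1] a little
  longer, which makes both P and t - P nondecreasing, so no bad time is close to
  \<open>S\<close>.\<close>

lemma admissible_all: "admissible T"
proof (rule ccontr)
  define B where "B = {t. t0 \<le> t \<and> (\<exists>x. \<not> (1 \<le> P t x \<and> P t x \<le> t - 1))}"
  assume "\<not> admissible T"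
  then have ne: "B \<noteq> {}" by (auto simp: B_def admissible_def)
  define S where "S = Inf B"
  have bdd: "bdd_below B" by (auto simp: B_def)
  have S: "t0 \<le> S" unfolding S_def using ne by (intro cInf_greatest) (auto simp: B_def)
  have before: "1 \<le> P t x \<and> P t x \<le> t - 1" if "t0 \<le> t" "t < S" for t x
    using cInf_lower[OF _ bdd, of t] that by (fastforce simp: S_def B_def)
  have before': "0 \<le> P t x - 1" "0 \<le> t - P t x - 1" if "t0 \<le> t" "t < S" for t x
    using before[OF that, of x] by auto
  have at: "1 \<le> P S x \<and> P S x \<le> S - 1" for x
  proof (cases "S = t0")
    case True
    then show ?thesis using bnd1 by simp
  next
    case False
    with S have "t0 < S" by simp
    have "0 \<le> P S x - 1"
      by (rule nonneg_left_limit[where z = "\<lambda>t. P t x - 1", OF _ \<open>t0 < S\<close>], (rule derivative_intros smooth_half_DERIV_tau smP S)+)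
         (rule before')
    moreover have "0 \<le> S - P S x - 1"
      by (rule nonneg_left_limit[where z = "\<lambda>t. t - P t x - 1", OF _ \<open>t0 < S\<close>], (rule derivative_intros smooth_half_DERIV_tau smP S)+)
         (rule before')
    ultimately show ?thesis by simp
  qed
  have "admissible S" unfolding admissible_def using before at by (metis order_le_less)
  note range = P_tau_range[OF this S order_refl]
  \<comment> \<open>One period suffices by periodicity; compactness gives a time step
    \<open>e\<close> valid for all x at once.\<close>
  define K where "K = {S..S + 1} \<times> {0..2 * pi}"
  have "uniformly_continuous_on K (\<lambda>(t, x). dtau t0 P t x)"
    by (rule compact_uniformly_continuous, rule continuous_on_subset[OF smooth_half_continuous[OF smooth_half_dtau[OF smP]]])
       (use S in \<open>auto simp: K_def intro: compact_Times\<close>)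
  then obtain d where d: "d > 0" "\<And>z z'. z \<in> K \<Longrightarrow> z' \<in> K \<Longrightarrow> dist z' z < d \<Longrightarrow>
      \<bar>dtau t0 P (fst z') (snd z') - dtau t0 P (fst z) (snd z)\<bar> < \<alpha>"
    using alpha(1) unfolding uniformly_continuous_on_def dist_real_def split_beta by metis
  define e where "e = min 1 (d / 2)"
  have e: "0 < e" "e \<le> 1" "e < d" using d(1) by (auto simp: e_def)
  have P': "0 \<le> dtau t0 P t x" "dtau t0 P t x \<le> 1" if t: "S \<le> t" "t \<le> S + e" for t x
  proof -
    obtain y where y: "y \<in> {0..2 * pi}" "\<And>t. t0 \<le> t \<Longrightarrow> dtau t0 P t y = dtau t0 P t x"
      using smooth_half_representative[OF smooth_half_dtau[OF smP], of x] by metis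
    have "dist (t, y) (S, y) < d"
      using t e by (simp add: dist_Pair_Pair dist_real_def)
    then have "\<bar>dtau t0 P t y - dtau t0 P S y\<bar> < \<alpha>"
      using d(2)[of "(S, y)" "(t, y)"] t e y by (simp add: K_def)
    then show "0 \<le> dtau t0 P t x" "dtau t0 P t x \<le> 1"
      using range[of y] y(2)[of t] y(2)[OF S] S t by (auto simp: abs_less_iff)
  qed
  have der: "((\<lambda>s. P s x) has_real_derivative dtau t0 P s x) (at s within {S..})" if "S \<le> s" for s x
    by (rule has_field_derivative_subset[OF smooth_half_DERIV_tau[OF smP]]) (use S that in auto)
  have "S + e \<le> t" if "t \<in> B" for t
  proof (rule ccontr)
    assume "\<not> S + e \<le> t"
    moreover have "S \<le> t" unfolding S_def by (rule cInf_lower[OF that bdd])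
    ultimately have t: "S \<le> t" "t \<le> S + e" by auto
    have "P S x \<le> P t x" for x
      by (rule mono_half_line[of S "\<lambda>s. P s x" "\<lambda>s. dtau t0 P s x" t, OF der]) (use P' t in auto)
    moreover have "S - P S x \<le> t - P t x" for x
      by (rule mono_half_line[of S "\<lambda>s. s - P s x" "\<lambda>s. 1 - dtau t0 P s x" t], (rule derivative_intros der)+)
         (use P' t in auto)
    ultimately have "1 \<le> P t x \<and> P t x \<le> t - 1" for x using at[of x] by (smt (verit))
    with that show False by (simp add: B_def)
  qed
  then have "S + e \<le> S" unfolding S_def using ne by (intro cInf_greatest)
  with e show False by simp
qed

lemma P_linear: "t0 \<le> t \<Longrightarrow> \<alpha> * t \<le> P t x" "t0 \<le> t \<Longrightarrow> P t x \<le> (1 - \<alpha>) * t"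
proof -
  assume t: "t0 \<le> t"
  have "0 \<le> (\<gamma> - \<alpha>) * (t0 / t)" using alpha t2 t_pos[OF t] by simp
  then have "\<alpha> \<le> P t x / t" "P t x / t \<le> 1 - \<alpha>"
    using P_ratio[OF admissible_all t order_refl, of x] by linarith+
  then show "\<alpha> * t \<le> P t x" "P t x \<le> (1 - \<alpha>) * t"
    using t_pos[OF t] by (simp_all add: pos_le_divide_eq pos_divide_le_eq)
qed

lemma P_tau_bounds: "t0 \<le> t \<Longrightarrow> \<alpha> \<le> dtau t0 P t x \<and> dtau t0 P t x \<le> 1 - \<alpha>"
  using P_tau_range[OF admissible_all _ order_refl] by blast

text \<open>The ratio P/t lies within \<open>1 / 2 - \<alpha>\<close> of 1/2, and u deviates from it
  by O(1/t).\<close>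

lemma u_bound:
  obtains C where "0 < C" "\<And>s t x. t0 \<le> t \<Longrightarrow> \<bar>1 / 2 - u s t x\<bar> \<le> 1 / 2 - \<alpha> + C / t"
proof -
  define C where "C = 2 * ((\<gamma> - \<alpha>) * t0)"
  have "\<bar>1 / 2 - u s t x\<bar> \<le> 1 / 2 - \<alpha> + C / t" if t: "t0 \<le> t" for s t x
  proof -
    have "\<bar>u s t x - P t x / t\<bar> \<le> C / t"
      using deviation(1)[OF admissible_all t order_refl, of s x] by (simp add: C_def)
    moreover have "\<alpha> \<le> P t x / t" "P t x / t \<le> 1 - \<alpha>"
      using P_linear[OF t, of x] t_pos[OF t] by (simp_all add: pos_le_divide_eq pos_divide_le_eq)
    ultimately show ?thesis by (simp add: abs_le_iff)
  qed
  moreover have "0 < C" using alpha t2 by (simp add: C_def)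
  ultimately show ?thesis using that by blast
qed

lemma family_bounded:
  assumes "\<And>s. smooth_half t0 (f (s :: bool))"
  obtains B where "0 < B" "\<And>s x. \<bar>f s t0 x\<bar> \<le> B"
proof -
  obtain B1 where B1: "0 < B1" "\<And>x. \<bar>f True t0 x\<bar> \<le> B1"
    using smooth_half_bounded[OF assms order_refl] by metis
  obtain B2 where B2: "0 < B2" "\<And>x. \<bar>f False t0 x\<bar> \<le> B2"
    using smooth_half_bounded[OF assms order_refl] by metis
  have "\<bar>f s t0 x\<bar> \<le> B1 + B2" for s x
    using B1(1) B1(2)[of x] B2(1) B2(2)[of x] by (cases s) auto
  then show ?thesis using that[of "B1 + B2"] B1 B2 by auto
qed

text \<open>In the W equation the damping is 1/2 and the coupling is \<open>1 / 2 - u\<close>, of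
  size at most \<open>1 / 2 - \<alpha> + C / t\<close>. At a touching point the rate
  \<open>C / t - \<alpha>\<close> is left, which is below that of the barrier once
  \<open>N > C\<close>.\<close>

lemma bnd_W: "bnd \<alpha> (W s)"
proof -
  obtain C where C: "0 < C" "\<And>s t x. t0 \<le> t \<Longrightarrow> \<bar>1 / 2 - u s t x\<bar> \<le> 1 / 2 - \<alpha> + C / t"
    using u_bound by metis
  obtain N where N: "C < real N" using reals_Archimedean2 by blast
  obtain B where B: "0 < B" "\<And>s x. \<bar>W s t0 x\<bar> \<le> B"
    using family_bounded[of W] smooth_W by metis
  \<comment> \<open>The exponential cancels that of the barrier at \<open>t0\<close>, and the added
    1 makes the initial inequality strict.\<close>
  define M where "M = (B + 1) * exp (\<alpha> * t0)"
  define h where "h t = M * t ^ N * exp (- \<alpha> * t)" for t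
  define h' where "h' t = (real N / t - \<alpha>) * h t" for t
  have M: "0 < M" using B by (simp add: M_def)
  have "\<bar>W s t x\<bar> < h t" if t: "t0 \<le> t" for s t x
  proof (rule comparison_principle_abs[of UNIV t0 W "\<lambda>_. h" "\<lambda>_. h'"])
    show "(h has_real_derivative h' r) (at r)" if "t0 \<le> r" for r
      unfolding h_def[abs_def] h'_def by (rule poly_exp_DERIV[OF t_pos[OF that]])
    show "\<bar>W s t0 y\<bar> < h t0" for s y
    proof -
      have "\<bar>W s t0 y\<bar> < (B + 1) * 1" using B(2)[of s y] by simp
      also have "\<dots> \<le> (B + 1) * t0 ^ N" using B(1) t0 by (intro mult_left_mono one_le_power) auto
      also have "\<dots> = h t0" by (simp add: h_def M_def exp_minus)
      finally show ?thesis .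
    qed
    fix s r y and \<sigma> :: real
    assume r: "t0 < r" and \<sigma>: "\<bar>\<sigma>\<bar> = 1" and le: "\<And>s y. s \<in> UNIV \<Longrightarrow> \<bar>W s r y\<bar> \<le> h r"
      and touch: "\<sigma> * W s r y = h r" and zero: "dth (W s) r y = 0"
    have r': "t0 \<le> r" using r by simp
    have hpos: "0 < h r" using M t_pos[OF r'] by (simp add: h_def)
    have eq: "dtau t0 (W s) r y = - (W s r y) / 2 + (1 / 2 - u s r y) * W (\<not> s) r y"
      using W_transport[OF r', of s y] zero by (simp add: algebra_simps diff_divide_distrib)
    have "\<sigma> * dtau t0 (W s) r y = - (\<sigma> * W s r y) / 2 + \<sigma> * ((1 / 2 - u s r y) * W (\<not> s) r y)"
      unfolding eq by (simp add: algebra_simps)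
    also have "\<dots> \<le> - h r / 2 + \<bar>\<sigma> * ((1 / 2 - u s r y) * W (\<not> s) r y)\<bar>"
      unfolding touch by simp
    also have "\<dots> = - h r / 2 + \<bar>1 / 2 - u s r y\<bar> * \<bar>W (\<not> s) r y\<bar>"
      using \<sigma> by (simp add: abs_mult)
    also have "\<dots> \<le> - h r / 2 + (1 / 2 - \<alpha> + C / r) * h r"
      using C(2)[OF r', of s y] le[of "\<not> s" y] by (intro add_left_mono mult_mono) auto
    also have "\<dots> = (C / r - \<alpha>) * h r" by (simp add: algebra_simps)
    also have "\<dots> < h' r"
      unfolding h'_def using N hpos t_pos[OF r'] by (intro mult_strict_right_mono) (auto simp: divide_strict_right_mono)
    finally show "\<sigma> * dtau t0 (W s) r y < h' r" .
  qed (use smooth_W t in auto)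
  then show ?thesis by (intro bndI[of _ M N]) (simp add: h_def less_imp_le)
qed

lemma bnd_u: "bnd 0 (u s)"
proof -
  obtain C where C: "0 < C" "\<And>s t x. t0 \<le> t \<Longrightarrow> \<bar>1 / 2 - u s t x\<bar> \<le> 1 / 2 - \<alpha> + C / t"
    using u_bound by metis
  have "\<bar>u s t x\<bar> \<le> (1 + C) * t ^ 0 * exp (- 0 * t)" if t: "t0 \<le> t" for t x
  proof -
    have "C / t \<le> C / 1" using C(1) t t0 by (intro divide_left_mono) auto
    then show ?thesis using C(2)[OF t, of s x] alpha by auto
  qed
  then show ?thesis by (rule bndI)
qed

end

section \<open>Decay of all derivatives\<close>

context gowdy begin

text \<open>Differentiating the quadratic system in \<open>x\<close> produces its linearisation, and differentiating
  the latter only changes the sources; hence one linear estimate covers all derivatives.\<close>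

definition linearised :: "(bool \<Rightarrow> real \<Rightarrow> real \<Rightarrow> real) \<Rightarrow> (bool \<Rightarrow> real \<Rightarrow> real \<Rightarrow> real) \<Rightarrow>
    (bool \<Rightarrow> real \<Rightarrow> real \<Rightarrow> real) \<Rightarrow> (bool \<Rightarrow> real \<Rightarrow> real \<Rightarrow> real) \<Rightarrow> bool" where
  "linearised a b f g \<longleftrightarrow> (\<forall>s. smooth_half t0 (a s) \<and> smooth_half t0 (b s) \<and> smooth_half t0 (f s) \<and> smooth_half t0 (g s)) \<and>
    (\<forall>s t x. t0 \<le> t \<longrightarrow>
      dtau t0 (a s) t x - sg s * exp (- t) * dth (a s) t x
        = b s t x * W (\<not> s) t x + W s t x * b (\<not> s) t x - (a s t x - a (\<not> s) t x) / 2 + f s t x \<and>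
      dtau t0 (b s) t x - sg s * exp (- t) * dth (b s) t x
        = - (b s t x - b (\<not> s) t x) / 2 - u s t x * b (\<not> s) t x - a s t x * W (\<not> s) t x + g s t x)"

lemma linearised_eqs:
  assumes "linearised a b f g" "t0 \<le> t"
  shows "dtau t0 (a s) t x - sg s * exp (- t) * dth (a s) t x
        = b s t x * W (\<not> s) t x + W s t x * b (\<not> s) t x - (a s t x - a (\<not> s) t x) / 2 + f s t x"
    and "dtau t0 (b s) t x - sg s * exp (- t) * dth (b s) t x
        = - (b s t x - b (\<not> s) t x) / 2 - u s t x * b (\<not> s) t x - a s t x * W (\<not> s) t x + g s t x"
  using assms unfolding linearised_def by blast+

text \<open>The coefficient \<open>exp (- t)\<close> does not depend on x, so the transport operator
  commutes with \<open>dth\<close>.\<close>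

lemma transport_dth:
  assumes t: "t0 \<le> t" and sm: "smooth_half t0 f" "smooth_half t0 g"
    and eq: "\<And>x. dtau t0 f t x - sg s * exp (- t) * dth f t x = g t x"
  shows "dtau t0 (dth f) t x - sg s * exp (- t) * dth (dth f) t x = dth g t x"
proof -
  have "dth (\<lambda>t x. dtau t0 f t x - sg s * exp (- t) * dth f t x) t x = dth g t x"
    by (rule dth_cong) (rule eq)
  moreover have "dth (\<lambda>t x. dtau t0 f t x - sg s * exp (- t) * dth f t x) t x
      = dth (dtau t0 f) t x - sg s * exp (- t) * dth (dth f) t x"
    by (rule dth_eqI, rule DERIV_cong,
        (rule derivative_intros smooth_half_DERIV_th smooth_half_dtau smooth_half_dth sm t)+) simp
  ultimately show ?thesis using smooth_half_dth_dtau[OF sm(1) t] by simp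
qed

text \<open>The terms in which \<open>dth\<close> falls on the unknowns reproduce the system; those
  in which it falls on the coefficients u and W join the sources.\<close>

lemma linearised_dth:
  assumes lin: "linearised a b f g"
  shows "linearised (\<lambda>s. dth (a s)) (\<lambda>s. dth (b s))
    (\<lambda>s t x. dth (f s) t x + b s t x * dth (W (\<not> s)) t x + dth (W s) t x * b (\<not> s) t x)
    (\<lambda>s t x. dth (g s) t x - dth (u s) t x * b (\<not> s) t x - a s t x * dth (W (\<not> s)) t x)"
proof -
  have sm: "smooth_half t0 (a s)" "smooth_half t0 (b s)" "smooth_half t0 (f s)" "smooth_half t0 (g s)" for s
    using lin by (auto simp: linearised_def)
  note sms = sm smooth_u smooth_W
  \<comment> \<open>Half differences are written as products with 1/2, the form to which the
    smoothness rules apply.\<close>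
  have "dtau t0 (dth (a s)) t x - sg s * exp (- t) * dth (dth (a s)) t x
      = dth (\<lambda>t x. b s t x * W (\<not> s) t x + W s t x * b (\<not> s) t x - (1/2) * (a s t x - a (\<not> s) t x) + f s t x) t x"
    if t: "t0 \<le> t" for s t x
    by (rule transport_dth[OF t], (rule sms smooth_intros)+) (use lin t in \<open>auto simp: linearised_def\<close>)
  moreover have "dth (\<lambda>t x. b s t x * W (\<not> s) t x + W s t x * b (\<not> s) t x - (1/2) * (a s t x - a (\<not> s) t x) + f s t x) t x
      = dth (b s) t x * W (\<not> s) t x + W s t x * dth (b (\<not> s)) t x - (dth (a s) t x - dth (a (\<not> s)) t x) / 2
       + (dth (f s) t x + b s t x * dth (W (\<not> s)) t x + dth (W s) t x * b (\<not> s) t x)" if t: "t0 \<le> t" for s t x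
    by (rule dth_eqI, rule DERIV_cong, (rule derivative_intros smooth_half_DERIV_th sms t)+) (simp add: algebra_simps diff_divide_distrib)
  moreover have "dtau t0 (dth (b s)) t x - sg s * exp (- t) * dth (dth (b s)) t x
      = dth (\<lambda>t x. (1/2) * (b (\<not> s) t x - b s t x) - u s t x * b (\<not> s) t x - a s t x * W (\<not> s) t x + g s t x) t x"
    if t: "t0 \<le> t" for s t x
    by (rule transport_dth[OF t], (rule sms smooth_intros)+) (use lin t in \<open>auto simp: linearised_def\<close>)
  moreover have "dth (\<lambda>t x. (1/2) * (b (\<not> s) t x - b s t x) - u s t x * b (\<not> s) t x - a s t x * W (\<not> s) t x + g s t x) t x
      = - (dth (b s) t x - dth (b (\<not> s)) t x) / 2 - u s t x * dth (b (\<not> s)) t x - dth (a s) t x * W (\<not> s) t x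
        + (dth (g s) t x - dth (u s) t x * b (\<not> s) t x - a s t x * dth (W (\<not> s)) t x)" if t: "t0 \<le> t" for s t x
    by (rule dth_eqI, rule DERIV_cong, (rule derivative_intros smooth_half_DERIV_th sms t)+) (simp add: algebra_simps diff_divide_distrib)
  moreover have "smooth_half t0 (dth (a s)) \<and> smooth_half t0 (dth (b s)) \<and>
    smooth_half t0 (\<lambda>t x. dth (f s) t x + b s t x * dth (W (\<not> s)) t x + dth (W s) t x * b (\<not> s) t x) \<and>
    smooth_half t0 (\<lambda>t x. dth (g s) t x - dth (u s) t x * b (\<not> s) t x - a s t x * dth (W (\<not> s)) t x)" for s
    by (intro conjI smooth_intros sms)
  ultimately show ?thesis unfolding linearised_def by simp
qed

text \<open>The start of the passage to higher orders: differentiating the quadratic system once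
  yields the linearisation with zero sources.\<close>

lemma linearised_u_W: "linearised (\<lambda>s. dth (u s)) (\<lambda>s. dth (W s)) (\<lambda>s t x. 0) (\<lambda>s t x. 0)"
proof -
  note sms = smooth_u smooth_W
  have "dtau t0 (dth (u s)) t x - sg s * exp (- t) * dth (dth (u s)) t x
      = dth (\<lambda>t x. W s t x * W (\<not> s) t x - (1/2) * (u s t x - u (\<not> s) t x)) t x"
    if t: "t0 \<le> t" for s t x
    by (rule transport_dth[OF t], (rule sms smooth_intros)+) (simp add: u_transport[OF t])
  moreover have "dth (\<lambda>t x. W s t x * W (\<not> s) t x - (1/2) * (u s t x - u (\<not> s) t x)) t x
      = dth (W s) t x * W (\<not> s) t x + W s t x * dth (W (\<not> s)) t x - (dth (u s) t x - dth (u (\<not> s)) t x) / 2 + 0"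
    if t: "t0 \<le> t" for s t x
    by (rule dth_eqI, rule DERIV_cong, (rule derivative_intros smooth_half_DERIV_th sms t)+) (simp add: algebra_simps diff_divide_distrib)
  moreover have "dtau t0 (dth (W s)) t x - sg s * exp (- t) * dth (dth (W s)) t x
      = dth (\<lambda>t x. (1/2) * (W (\<not> s) t x - W s t x) - u s t x * W (\<not> s) t x) t x"
    if t: "t0 \<le> t" for s t x
    by (rule transport_dth[OF t], (rule sms smooth_intros)+) (simp add: W_transport[OF t])
  moreover have "dth (\<lambda>t x. (1/2) * (W (\<not> s) t x - W s t x) - u s t x * W (\<not> s) t x) t x
      = - (dth (W s) t x - dth (W (\<not> s)) t x) / 2 - u s t x * dth (W (\<not> s)) t x - dth (u s) t x * W (\<not> s) t x + 0"
    if t: "t0 \<le> t" for s t x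
    by (rule dth_eqI, rule DERIV_cong, (rule derivative_intros smooth_half_DERIV_th sms t)+) (simp add: algebra_simps diff_divide_distrib)
  moreover have "smooth_half t0 (dth (u s))" "smooth_half t0 (dth (W s))" for s
    by (intro smooth_intros sms)+
  ultimately show ?thesis unfolding linearised_def by (simp add: smooth_half_const)
qed

text \<open>One constant and one exponent for both signs, free to be enlarged so that several
  families can share them.\<close>

lemma bnd_family:
  assumes "\<And>s. bnd a (f (s :: bool))"
  obtains C m where "0 < C" "\<And>D n s t x. C \<le> D \<Longrightarrow> m \<le> n \<Longrightarrow> t0 \<le> t \<Longrightarrow> \<bar>f s t x\<bar> \<le> D * (t ^ n * exp (- a * t))"
proof -
  obtain C1 m1 where 1: "0 < C1" "\<And>n t x. m1 \<le> n \<Longrightarrow> t0 \<le> t \<Longrightarrow> \<bar>f True t x\<bar> \<le> C1 * t ^ n * exp (- a * t)"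
    using assms[of True] by (metis bndE)
  obtain C2 m2 where 2: "0 < C2" "\<And>n t x. m2 \<le> n \<Longrightarrow> t0 \<le> t \<Longrightarrow> \<bar>f False t x\<bar> \<le> C2 * t ^ n * exp (- a * t)"
    using assms[of False] by (metis bndE)
  have "\<bar>f s t x\<bar> \<le> D * (t ^ n * exp (- a * t))" if "max C1 C2 \<le> D" "max m1 m2 \<le> n" "t0 \<le> t" for D n s t x
  proof -
    have "\<bar>f s t x\<bar> \<le> (if s then C1 else C2) * (t ^ n * exp (- a * t))"
      using 1(2)[of n t x] 2(2)[of n t x] that by (simp add: mult.assoc)
    also have "\<dots> \<le> D * (t ^ n * exp (- a * t))"
      using that t_pos[OF that(3)] by (intro mult_right_mono) auto
    finally show ?thesis .
  qed
  then show ?thesis using that[of "max C1 C2" "max m1 m2"] 1(1) by auto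
qed

end

context gowdy_small begin

text \<open>The barriers for a and b are multiples of \<open>t ^ N\<close> and
  \<open>t ^ (N + m + 1) * exp (- \<alpha> * t)\<close>. In the a equation damping and coupling
  cancel, and the products of W with b are exponentially smaller than the barrier. In the b equation
  the product of a with W costs \<open>t ^ m\<close>, so the extra power \<open>m + 1\<close> gains
  a factor 1/t. All errors are of relative size 1/t, and a large \<open>N\<close> absorbs
  them.\<close>

lemma linearised_bnd:
  assumes lin: "linearised a b f g" and f: "\<And>s. bnd (2 * \<alpha>) (f s)" and g: "\<And>s. bnd \<alpha> (g s)"
  shows "bnd 0 (a s)" "bnd \<alpha> (b s)"
proof -
  have sm: "smooth_half t0 (a s)" "smooth_half t0 (b s)" for s
    using lin by (auto simp: linearised_def)
  obtain Cu where Cu: "0 < Cu" "\<And>s t x. t0 \<le> t \<Longrightarrow> \<bar>1 / 2 - u s t x\<bar> \<le> 1 / 2 - \<alpha> + Cu / t"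
    using u_bound by metis
  obtain C1 m1 where 1: "0 < C1" "\<And>D n s t x. C1 \<le> D \<Longrightarrow> m1 \<le> n \<Longrightarrow> t0 \<le> t \<Longrightarrow> \<bar>W s t x\<bar> \<le> D * (t ^ n * exp (- \<alpha> * t))"
    using bnd_family[of \<alpha> W] bnd_W by metis
  obtain C2 m2 where 2: "0 < C2" "\<And>D n s t x. C2 \<le> D \<Longrightarrow> m2 \<le> n \<Longrightarrow> t0 \<le> t \<Longrightarrow> \<bar>f s t x\<bar> \<le> D * (t ^ n * exp (- (2 * \<alpha>) * t))"
    using bnd_family[of "2 * \<alpha>" f] f by metis
  obtain C3 m3 where 3: "0 < C3" "\<And>D n s t x. C3 \<le> D \<Longrightarrow> m3 \<le> n \<Longrightarrow> t0 \<le> t \<Longrightarrow> \<bar>g s t x\<bar> \<le> D * (t ^ n * exp (- \<alpha> * t))"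
    using bnd_family[of \<alpha> g] g by metis
  define C where "C = C1 + C2 + C3"
  define m where "m = m1 + m2 + m3"
  have C: "0 < C" using 1(1) 2(1) 3(1) by (simp add: C_def)
  define w where "w t = C * (t ^ m * exp (- \<alpha> * t))" for t
  have le: "C1 \<le> C" "C2 \<le> C" "C3 \<le> C" "m1 \<le> m" "m2 \<le> m" "m3 \<le> m"
    using 1(1) 2(1) 3(1) by (simp_all add: C_def m_def)
  have w: "\<bar>W s t x\<bar> \<le> w t" "\<bar>g s t x\<bar> \<le> w t" "\<bar>f s t x\<bar> \<le> C * (t ^ m * exp (- (2 * \<alpha>) * t))" if "t0 \<le> t" for s t x
    unfolding w_def by (rule 1(2)[OF le(1,4) that] 3(2)[OF le(3,6) that] 2(2)[OF le(2,5) that])+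
  \<comment> \<open>Bounds \<open>t ^ (2 * m + 2) * exp (- (2 * \<alpha>) * t)\<close>: the power
    \<open>2 * m + 1\<close> arises from W times b, and one more gains the factor 1/t.\<close>
  define K where "K = (real (2 * m + 2) / (2 * \<alpha>)) ^ (2 * m + 2)"
  have K: "0 < K" "\<And>t. t0 \<le> t \<Longrightarrow> t ^ (2 * m + 2) * exp (- (2 * \<alpha>) * t) \<le> K"
  proof -
    show "0 < K" using alpha(1) by (simp add: K_def del: power_Suc)
    show "t ^ (2 * m + 2) * exp (- (2 * \<alpha>) * t) \<le> K" if "t0 \<le> t" for t
      unfolding K_def by (rule power_exp_bounded) (use alpha(1) t_pos[OF that] in auto)
  qed
  \<comment> \<open>The a equation has three terms of size \<open>C * K\<close>, the b equation an
    error \<open>Cu\<close> and two terms of size \<open>C\<close>; one \<open>N\<close> serves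
    both.\<close>
  obtain N where N: "3 * C * K + Cu + 2 * C < real N" using reals_Archimedean2 by blast
  obtain Ba where Ba: "0 < Ba" "\<And>s x. \<bar>a s t0 x\<bar> \<le> Ba" using family_bounded[of a] sm(1) by metis
  obtain Bb where Bb: "0 < Bb" "\<And>s x. \<bar>b s t0 x\<bar> \<le> Bb" using family_bounded[of b] sm(2) by metis
  \<comment> \<open>Dominates the initial values of both unknowns. The factor on \<open>Bb\<close>
    offsets the exponential in the barrier for b at \<open>t0\<close>.\<close>
  define M where "M = 1 + Ba + Bb * exp (\<alpha> * t0)"
  have M: "1 \<le> M" using Ba(1) Bb(1) by (simp add: M_def)
  \<comment> \<open>Both unknowns with both signs form one family of four functions;
    \<open>k\<close> selects a or b.\<close>
  define y where "y = (\<lambda>(k, s). if k then a s else b s)"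
  define h where "h = (\<lambda>(k, s :: bool) t. if k then M * t ^ N * exp (- 0 * t) else M * t ^ (N + m + 1) * exp (- \<alpha> * t))"
  define h' where "h' = (\<lambda>(k, s) t. if k then (real N / t - 0) * h (k, s) t else (real (N + m + 1) / t - \<alpha>) * h (k, s) t)"
  have main: "\<bar>y i t x\<bar> < h i t" if t: "t0 \<le> t" for i t x
  proof (rule comparison_principle_abs[of UNIV t0 y h h'])
    show "smooth_half t0 (y i)" for i using sm by (auto simp: y_def split: prod.splits)
    show "(h i has_real_derivative h' i r) (at r)" if "t0 \<le> r" for i r
      using poly_exp_DERIV[OF t_pos[OF that], of M N 0] poly_exp_DERIV[OF t_pos[OF that], of M "N + m + 1" \<alpha>]
      by (cases i) (auto simp: h_def h'_def)
    have pos: "1 \<le> t0 ^ n" for n using t0 by simp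
    show "\<bar>y i t0 x\<bar> < h i t0" for i x
    proof (cases i)
      case (Pair k s)
      have "\<bar>a s t0 x\<bar> < M * t0 ^ N"
      proof -
        have "0 < Bb * exp (\<alpha> * t0)" using Bb(1) by simp
        then have "\<bar>a s t0 x\<bar> < M" using Ba(2)[of s x] unfolding M_def by linarith
        also have "\<dots> \<le> M * t0 ^ N" using mult_left_mono[OF pos[of N], of M] M by simp
        finally show ?thesis .
      qed
      moreover have "\<bar>b s t0 x\<bar> < M * t0 ^ (N + m + 1) * exp (- \<alpha> * t0)"
      proof -
        have "Bb * exp (\<alpha> * t0) * exp (- \<alpha> * t0) = Bb" by (simp add: mult.assoc exp_add[symmetric])
        then have "\<bar>b s t0 x\<bar> \<le> Bb * exp (\<alpha> * t0) * exp (- \<alpha> * t0)" using Bb(2)[of s x] by (simp only:)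
        also have "\<dots> < M * exp (- \<alpha> * t0)" using Ba(1) by (intro mult_strict_right_mono) (auto simp: M_def)
        also have "\<dots> \<le> M * t0 ^ (N + m + 1) * exp (- \<alpha> * t0)"
          using mult_left_mono[OF pos[of "N + m + 1"], of M] M by (intro mult_right_mono) auto
        finally show ?thesis .
      qed
      ultimately show ?thesis using Pair by (simp add: y_def h_def)
    qed
    fix i r x and \<sigma> :: real
    assume r: "t0 < r" and \<sigma>: "\<bar>\<sigma>\<bar> = 1" and le: "\<And>j x. j \<in> UNIV \<Longrightarrow> \<bar>y j r x\<bar> \<le> h j r"
      and touch: "\<sigma> * y i r x = h i r" and zero: "dth (y i) r x = 0"
    have r': "t0 \<le> r" "0 < r" "1 \<le> r" using r t0 by auto
    define ha where "ha = M * r ^ N"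
    define hb where "hb = M * r ^ (N + m + 1) * exp (- \<alpha> * r)"
    have ha: "\<bar>a s r x\<bar> \<le> ha" for s x using le[of "(True, s)" x] by (simp add: y_def h_def ha_def)
    have hb: "\<bar>b s r x\<bar> \<le> hb" for s x using le[of "(False, s)" x] by (simp add: y_def h_def hb_def)
    have ha1: "1 \<le> ha" using mult_mono[OF M one_le_power[OF r'(3), of N]] M by (simp add: ha_def)
    have hb0: "0 < hb" using M r'(2) by (simp add: hb_def)
    have w0: "0 \<le> w r" using C r'(2) by (simp add: w_def)
    \<comment> \<open>This fixes the power \<open>m + 1\<close> in the b barrier: m for
      \<open>w\<close> and one for the gain 1/r.\<close>
    have wha: "w r * ha = C * (hb / r)"
      using r'(2) by (simp add: w_def ha_def hb_def power_add)
    have rm: "r ^ m * exp (- (2 * \<alpha>) * r) \<le> K / r"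
    proof -
      have "r ^ m * exp (- (2 * \<alpha>) * r) * r = r ^ (m + 1) * exp (- (2 * \<alpha>) * r)" by simp
      also have "\<dots> \<le> r ^ (2 * m + 2) * exp (- (2 * \<alpha>) * r)"
        using r'(3) by (intro mult_right_mono power_increasing) auto
      also have "\<dots> \<le> K" by (rule K(2)[OF r'(1)])
      finally show ?thesis using r'(2) by (simp add: pos_le_divide_eq)
    qed
    have whb: "w r * hb \<le> C * K * (ha / r)"
    proof -
      have e: "exp (- \<alpha> * r) * exp (- \<alpha> * r) = exp (- (2 * \<alpha>) * r)"
        by (simp add: exp_add[symmetric])
      have "w r * hb * r = C * ha * (r ^ (2 * m + 2) * (exp (- \<alpha> * r) * exp (- \<alpha> * r)))"
        by (simp add: w_def hb_def ha_def power_add mult_2 power2_eq_square)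
      also have "\<dots> \<le> C * ha * K"
        unfolding e using K(2)[OF r'(1)] C ha1 by (intro mult_left_mono) auto
      finally show ?thesis using r'(2) by (simp add: pos_le_divide_eq mult.commute mult.left_commute)
    qed
    have abs_le: "\<sigma> * z \<le> B" if "\<bar>z\<bar> \<le> B" for z B
      using that \<sigma> abs_ge_self[of "\<sigma> * z"] by (simp add: abs_mult)
    obtain k s where i: "i = (k, s)" by (cases i)
    show "\<sigma> * dtau t0 (y i) r x < h' i r"
    proof (cases k)
      case True
      have eq: "dtau t0 (a s) r x = b s r x * W (\<not> s) r x + W s r x * b (\<not> s) r x - (a s r x - a (\<not> s) r x) / 2 + f s r x"
        using linearised_eqs(1)[OF lin r'(1), of s x] zero i True by (simp add: y_def)
      have t: "\<sigma> * a s r x = ha" using touch i True by (simp add: y_def h_def ha_def)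
      have "\<sigma> * dtau t0 (a s) r x = \<sigma> * (b s r x * W (\<not> s) r x) + \<sigma> * (W s r x * b (\<not> s) r x)
          - ha / 2 + \<sigma> * a (\<not> s) r x / 2 + \<sigma> * f s r x"
        unfolding eq t[symmetric] by (simp add: algebra_simps add_divide_distrib diff_divide_distrib)
      also have "\<dots> \<le> w r * hb + w r * hb - ha / 2 + ha / 2 + C * (K / r)"
      proof -
        have "\<sigma> * (b s r x * W (\<not> s) r x) \<le> w r * hb"
          by (rule abs_le) (use w(1)[OF r'(1), of "\<not> s" x] hb[of s x] w0 in \<open>simp add: abs_mult mult.commute mult_mono\<close>)
        moreover have "\<sigma> * (W s r x * b (\<not> s) r x) \<le> w r * hb"
          by (rule abs_le) (use w(1)[OF r'(1), of s x] hb[of "\<not> s" x] w0 in \<open>simp add: abs_mult mult_mono\<close>)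
        moreover have "\<sigma> * a (\<not> s) r x \<le> ha" by (rule abs_le) (rule ha)
        moreover have "\<sigma> * f s r x \<le> C * (K / r)"
          using mult_left_mono[OF rm, of C] C by (intro abs_le order_trans[OF w(3)[OF r'(1)]]) auto
        ultimately show ?thesis by linarith
      qed
      also have "\<dots> \<le> 2 * (C * K * (ha / r)) + C * K * (ha / r)"
      proof -
        \<comment> \<open>The bound on the source carries no barrier factor;
          \<open>1 \<le> ha\<close> supplies it.\<close>
        have "C * (K / r) * 1 \<le> C * (K / r) * ha" using C K(1) r'(2) ha1 by (intro mult_left_mono) auto
        then have "C * (K / r) \<le> C * K * (ha / r)" by simp
        then show ?thesis using whb by linarith
      qed
      also have "\<dots> = (3 * C * K) * (ha / r)" by simp
      also have "\<dots> < real N * (ha / r)"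
        using N C Cu(1) ha1 r'(2) by (intro mult_strict_right_mono) auto
      finally show ?thesis using i True by (simp add: y_def h'_def h_def ha_def)
    next
      case False
      have eq: "dtau t0 (b s) r x = - (b s r x) / 2 + (1 / 2 - u s r x) * b (\<not> s) r x - a s r x * W (\<not> s) r x + g s r x"
        using linearised_eqs(2)[OF lin r'(1), of s x] zero i False by (simp add: y_def algebra_simps diff_divide_distrib)
      have t: "\<sigma> * b s r x = hb" using touch i False by (simp add: y_def h_def hb_def)
      have "\<sigma> * dtau t0 (b s) r x = - hb / 2 + \<sigma> * ((1 / 2 - u s r x) * b (\<not> s) r x)
          + \<sigma> * (- (a s r x * W (\<not> s) r x)) + \<sigma> * g s r x"
        unfolding eq t[symmetric] by (simp add: algebra_simps add_divide_distrib diff_divide_distrib)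
      also have "\<dots> \<le> - hb / 2 + (1 / 2 - \<alpha> + Cu / r) * hb + w r * ha + w r * ha"
      proof -
        have "\<bar>(1 / 2 - u s r x) * b (\<not> s) r x\<bar> \<le> (1 / 2 - \<alpha> + Cu / r) * hb"
          unfolding abs_mult using Cu(2)[OF r'(1), of s x] hb[of "\<not> s" x] by (intro mult_mono) auto
        from abs_le[OF this] have "\<sigma> * ((1 / 2 - u s r x) * b (\<not> s) r x) \<le> (1 / 2 - \<alpha> + Cu / r) * hb" .
        moreover have "\<sigma> * (- (a s r x * W (\<not> s) r x)) \<le> w r * ha"
          by (rule abs_le) (use w(1)[OF r'(1), of "\<not> s" x] ha[of s x] w0 in \<open>simp add: abs_mult mult.commute mult_mono\<close>)
        moreover have "\<sigma> * g s r x \<le> w r * ha"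
          using mult_left_mono[OF ha1 w0] by (intro abs_le order_trans[OF w(2)[OF r'(1)]]) auto
        ultimately show ?thesis by linarith
      qed
      also have "\<dots> = ((Cu + 2 * C) / r - \<alpha>) * hb"
        unfolding wha by (simp add: algebra_simps add_divide_distrib)
      also have "\<dots> < (real (N + m + 1) / r - \<alpha>) * hb"
      proof -
        have "0 < 3 * C * K" using C K(1) by simp
        then have "Cu + 2 * C < real (N + m + 1)" using N by simp
        then show ?thesis using hb0 r'(2) by (intro mult_strict_right_mono diff_strict_right_mono divide_strict_right_mono)
      qed
      finally show ?thesis using i False by (simp add: y_def h'_def h_def hb_def)
    qed
  qed (use t in auto)
  show "bnd 0 (a s)"
    using main[of _ "(True, s)"] by (intro bndI[of _ M N]) (auto simp: y_def h_def less_imp_le)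
  show "bnd \<alpha> (b s)"
    using main[of _ "(False, s)"] by (intro bndI[of _ M "N + m + 1"]) (auto simp: y_def h_def intro: less_imp_le simp del: power_Suc)
qed

text \<open>The induction hypothesis is used twice: for a and b at order k, then for their angular
  derivatives. The new sources are products: W with b has rate \<open>2 * \<alpha>\<close>, while u
  with b and a with W have rate \<alpha>, as the system requires.\<close>

lemma linearised_decay:
  assumes "linearised a b f g" "\<And>s. decay k (2 * \<alpha>) (f s)" "\<And>s. decay k \<alpha> (g s)"
    and "\<And>s. decay k 0 (u s)" "\<And>s. decay k \<alpha> (W s)"
  shows "decay k 0 (a s) \<and> decay k \<alpha> (b s)"
  using assms
proof (induction k arbitrary: a b f g s)
  case 0
  then show ?case using linearised_bnd[of a b f g s] by simp
next
  case (Suc k)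
  have sm: "smooth_half t0 (a s)" "smooth_half t0 (b s)" "smooth_half t0 (f s)" "smooth_half t0 (g s)" for s
    using Suc.prems(1) by (auto simp: linearised_def)
  note sms = sm smooth_u smooth_W smooth_intros
  have k: "decay k 0 (u s)" "decay k \<alpha> (W s)" "decay k 0 (dth (u s))" "decay k \<alpha> (dth (W s))"
    "decay k (2 * \<alpha>) (dth (f s))" "decay k \<alpha> (dth (g s))" for s
    using decay_Suc_le[OF Suc.prems(4)] decay_Suc_le[OF Suc.prems(5)] Suc.prems by auto
  have ab: "decay k 0 (a s)" "decay k \<alpha> (b s)" for s
    using Suc.IH[OF Suc.prems(1) decay_Suc_le[OF Suc.prems(2)] decay_Suc_le[OF Suc.prems(3)] k(1) k(2)] by auto
  have "decay k 0 (dth (a s)) \<and> decay k \<alpha> (dth (b s))" for s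
  proof (rule Suc.IH[OF linearised_dth[OF Suc.prems(1)] _ _ k(1) k(2)])
    fix s
    have "decay k (\<alpha> + \<alpha>) (\<lambda>t x. b s t x * dth (W (\<not> s)) t x)" "decay k (\<alpha> + \<alpha>) (\<lambda>t x. dth (W s) t x * b (\<not> s) t x)"
      by (intro decay_mult sms ab k)+
    then show "decay k (2 * \<alpha>) (\<lambda>t x. dth (f s) t x + b s t x * dth (W (\<not> s)) t x + dth (W s) t x * b (\<not> s) t x)"
      unfolding mult_2 by (intro decay_add sms k(5)[unfolded mult_2])
    have "decay k (0 + \<alpha>) (\<lambda>t x. dth (u s) t x * b (\<not> s) t x)" "decay k (0 + \<alpha>) (\<lambda>t x. a s t x * dth (W (\<not> s)) t x)"
      by (intro decay_mult sms ab k)+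
    then show "decay k \<alpha> (\<lambda>t x. dth (g s) t x - dth (u s) t x * b (\<not> s) t x - a s t x * dth (W (\<not> s)) t x)"
      unfolding add_0 by (intro decay_diff sms k)
  qed
  then show ?case using decay_bnd[OF ab(1)[of s]] decay_bnd[OF ab(2)[of s]] by simp
qed

text \<open>Order k for u and W controls the coefficients of the linearised system, which gives
  order k for their angular derivatives, that is, order \<open>Suc k\<close>.\<close>

lemma decay_u_W: "decay k 0 (u s) \<and> decay k \<alpha> (W s)"
proof (induction k arbitrary: s)
  case 0
  then show ?case using bnd_u bnd_W by simp
next
  case (Suc k)
  have "decay k 0 (dth (u s)) \<and> decay k \<alpha> (dth (W s))"
    by (rule linearised_decay[OF linearised_u_W]) (use Suc in \<open>auto intro: decay_time bnd_zero\<close>)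
  then show ?case using bnd_u bnd_W by simp
qed

end

section \<open>Asymptotics\<close>

text \<open>The factor y on the right makes \<open>exp y - 1\<close> inherit the decay of y once
  \<open>exp y\<close> is bounded.\<close>

lemma abs_exp_minus_one: "\<bar>exp y - 1\<bar> \<le> \<bar>y * (1 + exp (y :: real))\<bar>"
proof (cases "0 \<le> y")
  case True
  have "(1 - y) * exp y \<le> exp (- y) * exp y"
    using exp_ge_add_one_self[of "- y"] by (intro mult_right_mono) auto
  then have "exp y - 1 \<le> y * exp y" by (simp add: exp_minus algebra_simps)
  then show ?thesis using True by (simp add: abs_mult algebra_simps)
next
  case False
  have "1 - exp y \<le> - y" using exp_ge_add_one_self[of y] by linarith
  also have "\<dots> \<le> - y * (1 + exp y)" using False by (simp add: mult_le_0_iff algebra_simps)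
  finally have "1 - exp y \<le> - y * (1 + exp y)" .
  moreover have "y * (1 + exp y) \<le> 0" using False by (intro mult_nonpos_nonneg) auto
  moreover have "exp y \<le> 1" using False by simp
  ultimately show ?thesis by (simp add: algebra_simps)
qed

section \<open>Exponential weights, backward equations and norms\<close>

context half_line begin

lemma decay_congI: "(\<And>t x. t0 \<le> t \<Longrightarrow> f t x = g t x) \<Longrightarrow> decay k a g \<Longrightarrow> decay k a f"
  using decay_cong[of f g k a] by simp

lemma bnd_dominated:
  assumes "bnd a g" "\<And>t x. t0 \<le> t \<Longrightarrow> \<bar>f t x\<bar> \<le> \<bar>g t x\<bar>"
  shows "bnd a f"
proof -
  obtain C m where C: "0 < C" "\<And>k t x. m \<le> k \<Longrightarrow> t0 \<le> t \<Longrightarrow> \<bar>g t x\<bar> \<le> C * t ^ k * exp (- a * t)"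
    using assms(1) by (metis bndE)
  have "\<bar>f t x\<bar> \<le> C * t ^ m * exp (- a * t)" if "t0 \<le> t" for t x
    by (rule order_trans[OF assms(2)[OF that] C(2)[OF order_refl that]])
  then show ?thesis by (rule bndI)
qed

text \<open>Angular derivatives of the exponent are linear in t, hence of rate 0; the exponential
  supplies rate \<open>a\<close> through the lower bound on \<open>c * v x\<close>.\<close>

lemma decay_exp_static_time:
  assumes v: "smooth_S1 v" and pos: "\<And>x. a \<le> c * v x"
  shows "decay k a (\<lambda>t x. exp (- (c * v x * t)))"
proof (rule decay_exp)
  show "smooth_half t0 (\<lambda>t x. - (c * v x * t))"
    by (intro smooth_intros smooth_half_static v)
  have "decay k (0 + 0) (\<lambda>t x. (c * v x) * t)"
    by (intro decay_mult decay_scale decay_time bnd_time decay_static smooth_intros smooth_half_static v)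
  then have "decay k 0 (\<lambda>t x. (c * v x) * t)" by simp
  then show "decay k 0 (\<lambda>t x. - (c * v x * t))"
    by (intro decay_uminus smooth_intros smooth_half_static v)
  show "bnd a (\<lambda>t x. exp (- (c * v x * t)))"
    by (rule bndI[of _ 1 0]) (use pos t0 in \<open>auto intro!: mult_right_mono\<close>)
qed

text \<open>Decay bounds \<open>f\<close> from above, so its exponential is bounded. At order zero,
  subtracting 1 gains a factor \<open>f\<close>; at higher orders every term contains a derivative
  of \<open>f\<close>.\<close>

lemma decay_exp_minus_one:
  assumes sm: "smooth_half t0 f" and dec: "\<And>k. decay k a f" and a: "0 < a"
  shows "decay k 0 (\<lambda>t x. exp (f t x))" "decay k a (\<lambda>t x. exp (f t x) - 1)"
proof -
  obtain C m where C: "0 < C" "\<And>k t x. m \<le> k \<Longrightarrow> t0 \<le> t \<Longrightarrow> \<bar>f t x\<bar> \<le> C * t ^ k * exp (- a * t)"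
    using decay_bnd[OF dec[of 0]] by (metis bndE)
  define K where "K = C * (real m / a) ^ m"
  have f: "f t x \<le> K" if t: "t0 \<le> t" for t x
  proof -
    have "\<bar>f t x\<bar> \<le> C * (t ^ m * exp (- a * t))" using C(2)[OF order_refl t] by (simp add: mult.assoc)
    also have "\<dots> \<le> K" unfolding K_def
      using C(1) power_exp_bounded[OF a, of t m] t t0 by (intro mult_left_mono) auto
    finally show ?thesis by simp
  qed
  have b0: "bnd 0 (\<lambda>t x. exp (f t x))"
    by (rule bndI[of _ "exp K" 0]) (use f in auto)
  then show e: "decay k 0 (\<lambda>t x. exp (f t x))" for k
    using a by (intro decay_exp sm decay_mono[OF dec]) auto
  have "bnd (a + 0) (\<lambda>t x. f t x * (1 + exp (f t x)))"
    by (rule bnd_mult[OF decay_bnd[OF dec] bnd_add[OF bnd_const b0]])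
  then have "bnd a (\<lambda>t x. f t x * (1 + exp (f t x)))" by simp
  then have b: "bnd a (\<lambda>t x. exp (f t x) - 1)"
    by (rule bnd_dominated) (rule abs_exp_minus_one)
  show "decay k a (\<lambda>t x. exp (f t x) - 1)"
  proof (cases k)
    case 0
    then show ?thesis using b by simp
  next
    case (Suc n)
    have "decay n (a + 0) (\<lambda>t x. dth f t x * exp (f t x))"
      using dec[of "Suc n"] by (intro decay_mult smooth_intros sm e) auto
    moreover have "dth (\<lambda>t x. exp (f t x) - 1) t x = dth f t x * exp (f t x)" if "t0 \<le> t" for t x
      by (rule dth_eqI, rule DERIV_cong, (rule derivative_intros smooth_half_DERIV_th sm that)+) simp
    ultimately have "decay n a (dth (\<lambda>t x. exp (f t x) - 1))"
      using decay_cong[of "dth (\<lambda>t x. exp (f t x) - 1)" "\<lambda>t x. dth f t x * exp (f t x)"] by simp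
    with b Suc show ?thesis by simp
  qed
qed

text \<open>An unstable linear equation: the bound is propagated backwards from infinity, which requires
  the solution to grow more slowly than the homogeneous one.\<close>

lemma bnd_backward:
  assumes sm: "smooth_half t0 y" and a: "0 < a" and v: "\<And>x. 0 \<le> v x"
    and ode: "\<And>t x. t0 \<le> t \<Longrightarrow> dtau t0 y t x = 2 * v x * y t x + S t x"
    and S: "bnd a S" and slow: "bnd a (\<lambda>t x. exp (- (2 * v x * t)) * y t x)"
  shows "bnd a y"
proof -
  obtain C m where C: "0 < C" "\<And>k t x. m \<le> k \<Longrightarrow> t0 \<le> t \<Longrightarrow> \<bar>S t x\<bar> \<le> C * t ^ k * exp (- a * t)"
    using S by (metis bndE)
  obtain K where K: "0 \<le> K" "\<And>t. 1 \<le> t \<Longrightarrow> tail a m t \<le> K * t ^ m"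
    using tail_bound[OF a] by metis
  have "\<bar>y t x\<bar> \<le> (C * K) * t ^ m * exp (- a * t)" if t: "t0 \<le> t" for t x
  proof -
    define T where "T t = C * (tail a m t * exp (- a * t))" for t
    \<comment> \<open>The integrating factor: \<open>e * y\<close> has derivative
      \<open>e * S\<close>, and the decrease of \<open>e * T\<close> dominates it because both e and
      T are nonincreasing.\<close>
    define e where "e t = exp (- (2 * v x * t))" for t
    have T0: "0 \<le> T t" if "t0 \<le> t" for t
      using C(1) tail_nonneg[OF a, of t m] that t0 by (simp add: T_def)
    have e': "(e has_real_derivative - (2 * v x) * e t) (at t within {t0..})" for t
      unfolding e_def[abs_def] by (rule DERIV_cong, (rule derivative_intros)+) simp
    have T': "(T has_real_derivative C * - (t ^ m * exp (- a * t))) (at t within {t0..})" for t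
      unfolding T_def[abs_def] by (intro DERIV_cmult tail_exp_DERIV) (use a in auto)
    have "\<exists>l. \<forall>t\<ge>t0. \<bar>e t * y t x - l\<bar> \<le> e t * T t"
    proof (rule half_line_limit)
      show "((\<lambda>t. e t * y t x) has_real_derivative e t * S t x) (at t within {t0..})" if t: "t0 \<le> t" for t
        by (rule DERIV_cong, rule DERIV_mult[OF e' smooth_half_DERIV_tau[OF sm t]])
           (simp add: ode[OF t] algebra_simps)
      show "((\<lambda>t. e t * T t) has_real_derivative - (2 * v x) * e t * T t + C * - (t ^ m * exp (- a * t)) * e t)
          (at t within {t0..})" for t
        by (rule DERIV_mult[OF e' T'])
      show "\<bar>e t * S t x\<bar> \<le> - (- (2 * v x) * e t * T t + C * - (t ^ m * exp (- a * t)) * e t)" if t: "t0 \<le> t" for t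
      proof -
        have "\<bar>e t * S t x\<bar> \<le> C * t ^ m * exp (- a * t) * e t"
          using mult_right_mono[OF C(2)[OF order_refl t, of x], of "e t"] by (simp add: abs_mult e_def mult.commute)
        moreover have "0 \<le> 2 * v x * e t * T t" using T0[OF t] v[of x] by (simp add: e_def)
        moreover have "- (- (2 * v x) * e t * T t + C * - (t ^ m * exp (- a * t)) * e t)
            = 2 * v x * e t * T t + C * t ^ m * exp (- a * t) * e t"
          by (simp add: algebra_simps)
        ultimately show ?thesis by linarith
      qed
      show "0 \<le> e t * T t" if "t0 \<le> t" for t using T0[OF that] by (simp add: e_def)
    qed
    then obtain l where l: "\<And>t. t0 \<le> t \<Longrightarrow> \<bar>e t * y t x - l\<bar> \<le> e t * T t" by blast
    have e1: "e t \<le> 1" if "t0 \<le> t" for t using v[of x] that t0 by (simp add: e_def)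
    have Tb: "T t \<le> (C * K) * t ^ m * exp (- a * t)" if "t0 \<le> t" for t
      using C(1) K(2)[of t] that t0 by (simp add: T_def mult.assoc)
    have "bnd a (\<lambda>t _. e t * y t x - l)"
    proof (rule bndI)
      fix t assume t: "t0 \<le> t"
      have "e t * T t \<le> 1 * T t" using e1[OF t] T0[OF t] by (intro mult_right_mono)
      then show "\<bar>e t * y t x - l\<bar> \<le> (C * K) * t ^ m * exp (- a * t)" using l[OF t] Tb[OF t] by linarith
    qed
    from bnd_pointwise_limit[OF this a] have 1: "(\<lambda>n. e (t0 + real n) * y (t0 + real n) x) \<longlonglongrightarrow> l" .
    \<comment> \<open>Slow growth forces \<open>l = 0\<close>, which excludes a multiple of the
      homogeneous solution \<open>exp (2 * v x * t)\<close>; afterwards the factor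
      \<open>e t\<close> is divided out.\<close>
    have "(\<lambda>n. exp (- (2 * v x * (t0 + real n))) * y (t0 + real n) x) \<longlonglongrightarrow> 0"
      by (rule bnd_pointwise_limit[where a = a and f = "\<lambda>t x. exp (- (2 * v x * t)) * y t x"]) (use slow a in auto)
    with 1 have "l = 0" unfolding e_def by (rule LIMSEQ_unique)
    then have "e t * \<bar>y t x\<bar> \<le> e t * T t" using l[OF t] by (simp add: abs_mult e_def)
    then have "\<bar>y t x\<bar> \<le> T t" by (simp add: e_def)
    then show ?thesis using Tb[OF t] by simp
  qed
  then show ?thesis by (rule bndI)
qed

text \<open>The angular derivative of \<open>y\<close> solves the same equation with source
  \<open>2 * (deriv v x * y t x) + dth S t x\<close>, whose first part is controlled by the previous
  order.\<close>

lemma decay_backward: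
  assumes "smooth_half t0 y" "smooth_half t0 S" and v: "smooth_S1 v" "\<And>x. 0 \<le> v x" and a: "0 < a"
    and "\<And>t x. t0 \<le> t \<Longrightarrow> dtau t0 y t x = 2 * v x * y t x + S t x"
    and "decay k a S" and "decay k a (\<lambda>t x. exp (- (2 * v x * t)) * y t x)"
  shows "decay k a y"
  using assms(1,2,6,7,8)
proof (induction k arbitrary: y S)
  case 0
  then show ?case using bnd_backward[of y a v S] v a by simp
next
  case (Suc k)
  note sm = Suc.prems(1,2) smooth_half_static[OF v(1), of t0] smooth_half_static[OF smooth_S1_deriv[OF v(1)], of t0]
  note dec = Suc.prems(4,5)
  have y: "decay k a y"
    by (rule Suc.IH[OF sm(1,2) Suc.prems(3) decay_Suc_le[OF dec(1)] decay_Suc_le[OF dec(2)]])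
  have "decay k a (dth y)"
  proof (rule Suc.IH[of "dth y" "\<lambda>t x. 2 * (deriv v x * y t x) + dth S t x"])
    show "smooth_half t0 (dth y)" by (intro smooth_intros sm)
    show "smooth_half t0 (\<lambda>t x. 2 * (deriv v x * y t x) + dth S t x)" by (intro smooth_intros sm)
    have "decay k (0 + a) (\<lambda>t x. deriv v x * y t x)"
      by (intro decay_mult sm decay_static y)
    then have "decay k a (\<lambda>t x. 2 * (deriv v x * y t x))"
      by (intro decay_scale smooth_intros sm) simp
    then show "decay k a (\<lambda>t x. 2 * (deriv v x * y t x) + dth S t x)"
      using dec(1) by (intro decay_add smooth_intros sm) auto
    show "dtau t0 (dth y) t x = 2 * v x * dth y t x + (2 * (deriv v x * y t x) + dth S t x)" if t: "t0 \<le> t" for t x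
    proof -
      have "dtau t0 (dth y) t x = dth (\<lambda>t x. 2 * (v x * y t x) + S t x) t x"
        unfolding smooth_half_dth_dtau[OF sm(1) t]
        by (rule dth_cong) (simp add: Suc.prems(3)[OF t] mult.assoc)
      also have "\<dots> = 2 * v x * dth y t x + (2 * (deriv v x * y t x) + dth S t x)"
        by (rule dth_eqI, rule DERIV_cong, (rule derivative_intros smooth_half_DERIV_th smooth_S1_DERIV v sm t)+)
           (simp add: algebra_simps)
      finally show ?thesis .
    qed
    \<comment> \<open>The growth condition for \<open>dth y\<close> comes from differentiating the
      weighted \<open>y\<close>: the derivative of the weight brings a factor t, harmless for the
      rate.\<close>
    define e where "e = (\<lambda>t x. exp (- (2 * v x * t)) * y t x)"
    have sme: "smooth_half t0 e" unfolding e_def by (intro smooth_intros sm)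
    have "decay k (0 + (0 + a)) (\<lambda>t x. deriv v x * (t * e t x))"
      using decay_Suc_le[OF dec(2)]
      by (intro decay_mult decay_static decay_time bnd_time smooth_intros sm sme) (simp add: e_def)
    then have "decay k a (\<lambda>t x. 2 * (deriv v x * (t * e t x)))"
      by (intro decay_scale smooth_intros sm sme) simp
    moreover have "decay k a (dth e)" using dec(2) by (simp add: e_def)
    ultimately have "decay k a (\<lambda>t x. dth e t x + 2 * (deriv v x * (t * e t x)))"
      by (intro decay_add smooth_intros sm sme)
    moreover have "dth e t x + 2 * (deriv v x * (t * e t x)) = exp (- (2 * v x * t)) * dth y t x" if t: "t0 \<le> t" for t x
    proof -
      have "dth e t x = exp (- (2 * v x * t)) * dth y t x - 2 * (deriv v x * (t * e t x))"
        unfolding e_def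
        by (rule dth_eqI, rule DERIV_cong, (rule derivative_intros smooth_half_DERIV_th smooth_S1_DERIV v sm t)+)
           (simp add: algebra_simps)
      then show ?thesis by simp
    qed
    ultimately show "decay k a (\<lambda>t x. exp (- (2 * v x * t)) * dth y t x)"
      using decay_cong[of "\<lambda>t x. dth e t x + 2 * (deriv v x * (t * e t x))" "\<lambda>t x. exp (- (2 * v x * t)) * dth y t x"] by simp
  qed
  then show ?case using decay_bnd[OF y] by simp
qed

text \<open>One monomial for each order of differentiation; their sum is the polynomial.\<close>

lemma Ck_norm_decay:
  assumes "decay k a f"
  shows "\<exists>\<Xi> :: real poly. \<forall>t\<ge>t0. Ck_norm k (\<lambda>x. f t x) \<le> poly \<Xi> t * exp (- a * t)"
proof -
  have "\<exists>C m. \<forall>t\<ge>t0. \<forall>x. \<bar>(deriv ^^ j) (f t) x\<bar> \<le> C * t ^ m * exp (- a * t)" if "j \<le> k" for j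
    using assms that by (auto simp: decay_iff bnd_def dth_funpow_eq)
  then obtain C m where C: "\<And>j t x. j \<le> k \<Longrightarrow> t0 \<le> t \<Longrightarrow> \<bar>(deriv ^^ j) (f t) x\<bar> \<le> C j * t ^ m j * exp (- a * t)"
    by metis
  define \<Xi> where "\<Xi> = (\<Sum>j\<le>k. monom (C j) (m j))"
  have "Ck_norm k (\<lambda>x. f t x) \<le> poly \<Xi> t * exp (- a * t)" if t: "t0 \<le> t" for t
    unfolding Ck_norm_def \<Xi>_def poly_sum poly_monom sum_distrib_right
    by (intro sum_mono cSUP_least) (use C t in auto)
  then show ?thesis by blast
qed

end

section \<open>Construction of the limit functions\<close>

context gowdy_small begin

text \<open>The two bounds on the initial ratio force \<open>\<gamma> \<le> 1 / 2\<close>. This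
  places the rate 2 of the wave terms above \<open>2 * \<alpha>\<close>.\<close>

lemma alpha_half: "\<alpha> < 1 / 2"
  using bnd2[of 0] alpha by linarith

text \<open>\<open>dtau t0 P\<close> is the mean of the two u, and P is obtained by integration;
  rate 0 allows polynomial growth.\<close>

lemma decay_P: "decay k 0 (dtau t0 P)" "decay k 0 P"
proof -
  have "decay k 0 (\<lambda>t x. (1/2) * (u True t x + u False t x))"
    using decay_u_W by (intro decay_scale decay_add smooth_intros smooth_u) auto
  moreover have "(1/2) * (u True t x + u False t x) = dtau t0 P t x" for t x
    by (simp add: u_def sg_def)
  ultimately show "decay k 0 (dtau t0 P)" by simp
  then show "decay k 0 P" by (rule decay_integrate[OF smP])
qed

text \<open>In the equation for P the wave term has rate 2 and the nonlinearity, a product of the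
  two W, has twice the rate of W.\<close>

lemma decay_P_tau_tau: "decay k (2 * \<alpha>) (dtau t0 (dtau t0 P))"
proof -
  have "decay k (2 + 0) (\<lambda>t x. exp (- 2 * t) * dth (dth P) t x)"
    using decay_P(2)[of "Suc (Suc k)"]
    by (intro decay_mult decay_time bnd_exp_time smooth_intros smP) auto
  then have 1: "decay k (2 * \<alpha>) (\<lambda>t x. exp (- 2 * t) * dth (dth P) t x)"
    by (rule decay_mono) (use alpha_half in simp)
  have 2: "decay k (2 * \<alpha>) (\<lambda>t x. W True t x * W False t x)"
    unfolding mult_2 using decay_u_W by (intro decay_mult smooth_W) auto
  have eq: "dtau t0 (dtau t0 P) t x = exp (- 2 * t) * dth (dth P) t x + W True t x * W False t x" if "t0 \<le> t" for t x
    using eqP[OF that, of x] unfolding exp_square W_def sg_def by (simp add: power2_eq_square algebra_simps)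
  show ?thesis
    by (rule decay_congI, erule eq) (intro decay_add 1 2 smooth_intros smooth_W smP)
qed

text \<open>The functions v, \<phi>, r, q arise in this order as limits of \<open>dtau t0 P\<close>,
  \<open>P - v * t\<close>, \<open>exp (2 * P) * dtau t0 Q\<close> and Q, each with a time
  derivative of rate \<open>2 * \<alpha>\<close>. The last estimate goes through
  \<open>decay_backward\<close> instead.\<close>

lemma asymptotics:
  obtains v \<phi> q r where "smooth_S1 v" "smooth_S1 \<phi>" "smooth_S1 q" "smooth_S1 r" "\<And>x. \<alpha> \<le> v x \<and> v x \<le> 1 - \<alpha>"
    "\<And>k. decay k \<alpha> (\<lambda>t x. dtau t0 P t x - v x)"
    "\<And>k. decay k \<alpha> (\<lambda>t x. P t x - (v x * t + \<phi> x))"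
    "\<And>k. decay k \<alpha> (\<lambda>t x. exp (2 * (v x * t + \<phi> x)) * dtau t0 Q t x - r x)"
    "\<And>k. decay k \<alpha> (\<lambda>t x. exp (2 * (v x * t + \<phi> x)) * (Q t x - q x) + r x / (2 * v x))"
proof -
  have a2: "0 < 2 * \<alpha>" "\<alpha> \<le> 2 * \<alpha>" "0 \<le> 2 * \<alpha>" "0 \<le> \<alpha>" using alpha by auto
  obtain v where v: "smooth_S1 v" "\<And>k. decay k (2 * \<alpha>) (\<lambda>t x. dtau t0 P t x - v x)"
    by (rule decay_limit[OF smooth_half_dtau[OF smP] decay_P_tau_tau a2(1)]) (rule that)
  have v_lim: "(\<lambda>n. dtau t0 P (t0 + real n) x) \<longlonglongrightarrow> v x" for x
    by (rule bnd_pointwise_limit[OF decay_bnd[OF v(2)] a2(1)])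
  have v_range: "\<alpha> \<le> v x \<and> v x \<le> 1 - \<alpha>" for x
  proof
    have b: "\<alpha> \<le> dtau t0 P (t0 + real n) x \<and> dtau t0 P (t0 + real n) x \<le> 1 - \<alpha>" for n
      by (rule P_tau_bounds) simp
    show "\<alpha> \<le> v x" by (rule LIMSEQ_le_const[OF v_lim]) (use b in blast)
    show "v x \<le> 1 - \<alpha>" by (rule LIMSEQ_le_const2[OF v_lim]) (use b in blast)
  qed
  note smv = smooth_half_static[OF v(1), of t0]
  have smf: "smooth_half t0 (\<lambda>t x. P t x - v x * t)" by (intro smooth_intros smv smP)
  have f_tau: "dtau t0 (\<lambda>t x. P t x - v x * t) t x = dtau t0 P t x - v x" if t: "t0 \<le> t" for t x
    by (rule dtau_eqI[OF _ t], rule DERIV_cong, (rule derivative_intros smooth_half_DERIV_tau smP t)+) simp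
  have f': "decay k (2 * \<alpha>) (dtau t0 (\<lambda>t x. P t x - v x * t))" for k
    by (rule decay_congI, erule f_tau) (rule v(2))
  obtain \<phi> where \<phi>: "smooth_S1 \<phi>" "\<And>k. decay k (2 * \<alpha>) (\<lambda>t x. P t x - v x * t - \<phi> x)"
    by (rule decay_limit[OF smf f' a2(1)]) (rule that)
  note sm\<phi> = smooth_half_static[OF \<phi>(1), of t0]
  define p where "p = (\<lambda>t x. v x * t + \<phi> x)"
  have smp: "smooth_half t0 p" unfolding p_def by (intro smooth_intros smv sm\<phi>)
  have Pp: "decay k (2 * \<alpha>) (\<lambda>t x. P t x - p t x)" for k
    using \<phi>(2)[of k] by (simp add: p_def algebra_simps)

  \<comment> \<open>The equation for Q makes \<open>dtau t0 E\<close> equal to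
    \<open>exp (2 * P - 2 * t) * (dth (dth Q) + 2 * dth P * dth Q)\<close>. This is \<open>Z\<close>
    times an expression in \<open>G = exp (P - t) * dth Q\<close>, and each factor has rate
    \<alpha>: \<open>Z\<close> by \<open>P \<le> (1 - \<alpha>) * t\<close>, \<open>G\<close> as a
    half difference of the two W.\<close>
  define Z where "Z = (\<lambda>t x. exp (P t x - t))"
  define G where "G = (\<lambda>t x. (1/2) * (W True t x - W False t x))"
  define E where "E = (\<lambda>t x. exp (2 * P t x) * dtau t0 Q t x)"
  have smZ: "smooth_half t0 Z" unfolding Z_def by (intro smooth_intros smP)
  have smG: "smooth_half t0 G" unfolding G_def by (intro smooth_intros smooth_W)
  have smE: "smooth_half t0 E" unfolding E_def by (intro smooth_intros smP smQ)
  have Z: "decay k \<alpha> Z" for k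
    unfolding Z_def
  proof (rule decay_exp)
    show "bnd \<alpha> (\<lambda>t x. exp (P t x - t))"
      by (rule bndI[of _ 1 0]) (use P_linear(2) in \<open>auto simp: algebra_simps\<close>)
  qed (intro decay_diff decay_P decay_time bnd_time smooth_intros smP)+
  have G: "decay k \<alpha> G" for k
    unfolding G_def using decay_u_W by (intro decay_scale decay_diff smooth_intros smooth_W) auto
  have E_tau: "dtau t0 E t x = Z t x * (dth P t x * G t x + dth G t x)" if t: "t0 \<le> t" for t x
  proof -
    have G_eq: "G = (\<lambda>t x. exp (P t x) * exp (- t) * dth Q t x)"
      unfolding G_def W_def sg_def by (intro ext) (simp add: algebra_simps)
    have dG: "dth G t x = exp (P t x) * exp (- t) * (dth P t x * dth Q t x + dth (dth Q) t x)"
      unfolding G_eq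
      by (rule dth_eqI, rule DERIV_cong, (rule derivative_intros smooth_half_DERIV_th smooth_half_dth smP smQ t)+)
         (simp add: algebra_simps)
    have dE: "dtau t0 E t x = exp (2 * P t x) * (2 * dtau t0 P t x * dtau t0 Q t x + dtau t0 (dtau t0 Q) t x)"
      unfolding E_def
      by (rule dtau_eqI[OF _ t], rule DERIV_cong, (rule derivative_intros smooth_half_DERIV_tau smooth_half_dtau smP smQ t)+)
         (simp add: algebra_simps)
    have Q2: "2 * dtau t0 P t x * dtau t0 Q t x + dtau t0 (dtau t0 Q) t x
        = exp (- t) * exp (- t) * (dth (dth Q) t x + 2 * (dth P t x * dth Q t x))"
      using eqQ[OF t, of x] unfolding exp_square by (simp add: algebra_simps)
    have "Z t x = exp (P t x) * exp (- t)" by (simp add: Z_def exp_diff exp_minus divide_inverse)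
    then show ?thesis unfolding dE Q2 dG exp_square by (simp add: G_eq algebra_simps)
  qed
  have E': "decay k (2 * \<alpha>) (dtau t0 E)" for k
  proof (rule decay_congI, erule E_tau)
    have "decay k (0 + \<alpha>) (\<lambda>t x. dth P t x * G t x)"
      using decay_P(2)[of "Suc k"] by (intro decay_mult G smooth_intros smP smG) auto
    then have "decay k \<alpha> (\<lambda>t x. dth P t x * G t x + dth G t x)"
      using G[of "Suc k"] by (intro decay_add smooth_intros smP smG) auto
    then show "decay k (2 * \<alpha>) (\<lambda>t x. Z t x * (dth P t x * G t x + dth G t x))"
      unfolding mult_2 by (intro decay_mult Z smooth_intros smZ smP smG)
  qed
  obtain r where r: "smooth_S1 r" "\<And>k. decay k (2 * \<alpha>) (\<lambda>t x. E t x - r x)"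
    by (rule decay_limit[OF smE E' a2(1)]) (rule that)
  note smr = smooth_half_static[OF r(1), of t0]
  have E: "decay k 0 E" for k by (rule decay_integrate[OF smE decay_mono[OF E' a2(3)]])

  have Q_tau: "dtau t0 Q = (\<lambda>t x. exp (- 2 * P t x) * E t x)"
    by (intro ext) (simp add: E_def mult.assoc[symmetric] exp_add[symmetric])
  \<comment> \<open>Here the lower bound \<open>P \<ge> \<alpha> * t\<close> gives the rate.\<close>
  have "decay k (2 * \<alpha>) (\<lambda>t x. exp (- 2 * P t x))" for k
  proof (rule decay_exp)
    show "bnd (2 * \<alpha>) (\<lambda>t x. exp (- 2 * P t x))"
      by (rule bndI[of _ 1 0]) (use P_linear(1) in auto)
  qed (intro decay_scale decay_P smooth_intros smP)+
  then have EQ: "decay k (2 * \<alpha> + 0) (\<lambda>t x. exp (- 2 * P t x) * E t x)" for k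
    by (intro decay_mult E smooth_intros smP smE)
  have Q': "decay k (2 * \<alpha>) (dtau t0 Q)" for k using EQ[of k] unfolding Q_tau by simp
  obtain q where q: "smooth_S1 q" "\<And>k. decay k (2 * \<alpha>) (\<lambda>t x. Q t x - q x)"
    by (rule decay_limit[OF smQ Q' a2(1)]) (rule that)
  note smq = smooth_half_static[OF q(1), of t0]

  \<comment> \<open>Exchanges the weight \<open>exp (2 * P)\<close> for \<open>exp (2 * p)\<close>:
    the quotient is \<open>exp \<delta>\<close>, which tends to 1 at rate \<alpha>.\<close>
  define \<delta> where "\<delta> = (\<lambda>t x. - 2 * (P t x - p t x))"
  have sm\<delta>: "smooth_half t0 \<delta>" unfolding \<delta>_def by (intro smooth_intros smP smp)
  have \<delta>: "decay k \<alpha> \<delta>" for k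
    unfolding \<delta>_def by (intro decay_scale decay_mono[OF Pp a2(2)] smooth_intros smP smp)
  define S where "S = (\<lambda>t x. exp (2 * p t x) * dtau t0 Q t x - r x)"
  have smS: "smooth_half t0 S" unfolding S_def by (intro smooth_intros smp smQ smr)
  have S: "decay k \<alpha> S" for k
  proof -
    have "decay k (\<alpha> + 0) (\<lambda>t x. (exp (\<delta> t x) - 1) * E t x)"
      by (intro decay_mult decay_exp_minus_one(2)[OF sm\<delta> \<delta> alpha(1)] E smooth_intros sm\<delta> smE)
    then have "decay k \<alpha> (\<lambda>t x. (exp (\<delta> t x) - 1) * E t x + (E t x - r x))"
      by (intro decay_add decay_mono[OF r(2) a2(2)] smooth_intros sm\<delta> smE smr) simp
    moreover have "(exp (\<delta> t x) - 1) * E t x + (E t x - r x) = S t x" for t x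
    proof -
      have "exp (\<delta> t x) * exp (2 * P t x) = exp (2 * p t x)"
        by (simp add: \<delta>_def exp_add[symmetric])
      then have "exp (\<delta> t x) * E t x = exp (2 * p t x) * dtau t0 Q t x"
        by (simp add: E_def mult.assoc[symmetric])
      then show ?thesis by (simp add: S_def algebra_simps)
    qed
    ultimately show ?thesis by simp
  qed

  \<comment> \<open>As \<open>2 * v * \<rho> = r\<close>, adding \<rho> turns the source
    \<open>S + r\<close> of the equation into \<open>S\<close>.\<close>
  define \<rho> where "\<rho> = (\<lambda>(t :: real) x. r x * inverse (2 * v x))"
  have v0: "v x \<noteq> 0" "0 \<le> v x" for x using v_range[of x] alpha by auto
  have sm\<rho>: "smooth_half t0 \<rho>"
    unfolding \<rho>_def using v0 by (intro smooth_intros smooth_half_inverse smr smv) auto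
  define R where "R = (\<lambda>t x. exp (2 * p t x) * (Q t x - q x) + \<rho> t x)"
  have smR: "smooth_half t0 R" unfolding R_def by (intro smooth_intros smp smQ smq sm\<rho>)
  have R: "decay k \<alpha> R" for k
  proof (rule decay_backward[OF smR smS v(1) v0(2) alpha(1) _ S])
    show "dtau t0 R t x = 2 * v x * R t x + S t x" if t: "t0 \<le> t" for t x
    proof -
      have "dtau t0 R t x = 2 * v x * (exp (2 * p t x) * (Q t x - q x)) + exp (2 * p t x) * dtau t0 Q t x"
        unfolding R_def \<rho>_def p_def
        by (rule dtau_eqI[OF _ t], rule DERIV_cong, (rule derivative_intros smooth_half_DERIV_tau smQ t)+)
           (simp add: algebra_simps)
      then show ?thesis using v0[of x] by (simp add: R_def \<rho>_def S_def algebra_simps)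
    qed
    \<comment> \<open>The growth condition for the backward equation: under the weight, the first
      part of \<open>R\<close> becomes \<open>exp (2 * \<phi> x) * (Q t x - q x)\<close>, which
      decays because Q tends to q, and the second decays because
      \<open>2 * v x \<ge> \<alpha>\<close>.\<close>
    have 1: "decay k (0 + \<alpha>) (\<lambda>t x. exp (2 * \<phi> x) * (Q t x - q x))"
      by (intro decay_mult decay_static decay_mono[OF q(2) a2(2)] smooth_intros sm\<phi> smQ smq)
    have "\<alpha> \<le> 2 * v x" for x using v_range[of x] alpha by auto
    moreover have "decay k 0 \<rho>" using decay_static sm\<rho> unfolding \<rho>_def .
    ultimately have "decay k (\<alpha> + 0) (\<lambda>t x. exp (- (2 * v x * t)) * \<rho> t x)"
      by (intro decay_mult decay_exp_static_time v smooth_intros smv sm\<rho>)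
    with 1 have "decay k \<alpha> (\<lambda>t x. exp (2 * \<phi> x) * (Q t x - q x) + exp (- (2 * v x * t)) * \<rho> t x)"
      by (intro decay_add smooth_intros sm\<phi> smQ smq smv sm\<rho>) auto
    moreover have "exp (2 * \<phi> x) * (Q t x - q x) + exp (- (2 * v x * t)) * \<rho> t x
        = exp (- (2 * v x * t)) * R t x" for t x
    proof -
      have "exp (- (2 * v x * t)) * exp (2 * p t x) = exp (2 * \<phi> x)"
        by (simp add: p_def exp_add[symmetric] algebra_simps)
      then show ?thesis by (simp add: R_def distrib_left mult.assoc[symmetric])
    qed
    ultimately show "decay k \<alpha> (\<lambda>t x. exp (- (2 * v x * t)) * R t x)" by simp
  qed
  show ?thesis
  proof (rule that[OF v(1) \<phi>(1) q(1) r(1) v_range])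
    show "decay k \<alpha> (\<lambda>t x. dtau t0 P t x - v x)" for k by (rule decay_mono[OF v(2) a2(2)])
    show "decay k \<alpha> (\<lambda>t x. P t x - (v x * t + \<phi> x))" for k using decay_mono[OF Pp a2(2), of k] by (simp add: p_def)
    show "decay k \<alpha> (\<lambda>t x. exp (2 * (v x * t + \<phi> x)) * dtau t0 Q t x - r x)" for k using S[of k] by (simp add: S_def p_def)
    show "decay k \<alpha> (\<lambda>t x. exp (2 * (v x * t + \<phi> x)) * (Q t x - q x) + r x / (2 * v x))" for k
      using R[of k] unfolding R_def p_def \<rho>_def divide_inverse .
  qed
qed

end

theorem theorem1:
  fixes P Q :: "real \<Rightarrow> real \<Rightarrow> real" and t0 \<gamma> \<alpha> :: real
  assumes smP: "smooth_half t0 P" and smQ: "smooth_half t0 Q"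
    and eqP: "\<And>t x. t \<ge> t0 \<Longrightarrow>
       dtau t0 (dtau t0 P) t x - exp (-2*t) * dth (dth P) t x
       - exp (2 * P t x) * ((dtau t0 Q t x)\<^sup>2 - exp (-2*t) * (dth Q t x)\<^sup>2) = 0"
    and eqQ: "\<And>t x. t \<ge> t0 \<Longrightarrow>
       dtau t0 (dtau t0 Q) t x - exp (-2*t) * dth (dth Q) t x
       + 2 * (dtau t0 P t x * dtau t0 Q t x - exp (-2*t) * dth P t x * dth Q t x) = 0"
    and t0: "t0 \<ge> 2"
    and gpos: "\<gamma> > 0"
    and bnd1: "\<And>x. 1 \<le> P t0 x \<and> P t0 x \<le> t0 - 1"
    and bnd2: "\<And>x. \<gamma> \<le> P t0 x / t0 \<and> P t0 x / t0 \<le> 1 - \<gamma>"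
    and alpha: "0 < \<alpha>" "\<alpha> < \<gamma>"
    and Fbnd: "Fen t0 P Q t0 \<le> (\<gamma> - \<alpha>)\<^sup>2"
  shows "\<exists>v \<phi> q r. smooth_S1 v \<and> smooth_S1 \<phi> \<and> smooth_S1 q \<and> smooth_S1 r \<and>
     (\<forall>x. 0 < \<alpha> \<and> \<alpha> \<le> v x \<and> v x \<le> 1 - \<alpha> \<and> 1 - \<alpha> < 1) \<and>
     (\<forall>k::nat. \<exists>\<Xi>1 \<Xi>2 \<Xi>3 \<Xi>4 :: real poly. \<forall>t\<ge>t0.
        Ck_norm k (\<lambda>x. dtau t0 P t x - v x) \<le> poly \<Xi>1 t * exp (-\<alpha> * t) \<and>
        Ck_norm k (\<lambda>x. P t x - (v x * t + \<phi> x)) \<le> poly \<Xi>2 t * exp (-\<alpha> * t) \<and>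
        Ck_norm k (\<lambda>x. exp (2 * (v x * t + \<phi> x)) * dtau t0 Q t x - r x) \<le> poly \<Xi>3 t * exp (-\<alpha> * t) \<and>
        Ck_norm k (\<lambda>x. exp (2 * (v x * t + \<phi> x)) * (Q t x - q x) + r x / (2 * v x))
          \<le> poly \<Xi>4 t * exp (-\<alpha> * t))"
proof -
  have t0': "1 \<le> t0" using t0 by simp
  interpret gowdy_small t0 P Q \<gamma> \<alpha>
    by unfold_locales (fact t0' smP smQ eqP eqQ t0 bnd1 bnd2 alpha Fbnd)+
  obtain v \<phi> q r where sm: "smooth_S1 v" "smooth_S1 \<phi>" "smooth_S1 q" "smooth_S1 r"
    and v: "\<And>x. \<alpha> \<le> v x \<and> v x \<le> 1 - \<alpha>"
    and dec: "\<And>k. decay k \<alpha> (\<lambda>t x. dtau t0 P t x - v x)"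
    "\<And>k. decay k \<alpha> (\<lambda>t x. P t x - (v x * t + \<phi> x))"
    "\<And>k. decay k \<alpha> (\<lambda>t x. exp (2 * (v x * t + \<phi> x)) * dtau t0 Q t x - r x)"
    "\<And>k. decay k \<alpha> (\<lambda>t x. exp (2 * (v x * t + \<phi> x)) * (Q t x - q x) + r x / (2 * v x))"
    by (rule asymptotics) (rule that)
  have norm_bounds: "\<exists>\<Xi>1 \<Xi>2 \<Xi>3 \<Xi>4 :: real poly. \<forall>t\<ge>t0.
        Ck_norm k (\<lambda>x. dtau t0 P t x - v x) \<le> poly \<Xi>1 t * exp (-\<alpha> * t) \<and>
        Ck_norm k (\<lambda>x. P t x - (v x * t + \<phi> x)) \<le> poly \<Xi>2 t * exp (-\<alpha> * t) \<and>
        Ck_norm k (\<lambda>x. exp (2 * (v x * t + \<phi> x)) * dtau t0 Q t x - r x) \<le> poly \<Xi>3 t * exp (-\<alpha> * t) \<and>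
        Ck_norm k (\<lambda>x. exp (2 * (v x * t + \<phi> x)) * (Q t x - q x) + r x / (2 * v x))
          \<le> poly \<Xi>4 t * exp (-\<alpha> * t)" for k
  proof -
    note norms = dec[THEN Ck_norm_decay, of k]
    obtain \<Xi>1 :: "real poly" where 1: "\<forall>t\<ge>t0. Ck_norm k (\<lambda>x. dtau t0 P t x - v x) \<le> poly \<Xi>1 t * exp (-\<alpha> * t)"
      using norms(1) by (rule exE)
    obtain \<Xi>2 :: "real poly" where 2: "\<forall>t\<ge>t0. Ck_norm k (\<lambda>x. P t x - (v x * t + \<phi> x)) \<le> poly \<Xi>2 t * exp (-\<alpha> * t)"
      using norms(2) by (rule exE)
    obtain \<Xi>3 :: "real poly" where 3: "\<forall>t\<ge>t0. Ck_norm k (\<lambda>x. exp (2 * (v x * t + \<phi> x)) * dtau t0 Q t x - r x)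
        \<le> poly \<Xi>3 t * exp (-\<alpha> * t)"
      using norms(3) by (rule exE)
    obtain \<Xi>4 :: "real poly" where 4: "\<forall>t\<ge>t0. Ck_norm k (\<lambda>x. exp (2 * (v x * t + \<phi> x)) * (Q t x - q x) + r x / (2 * v x))
        \<le> poly \<Xi>4 t * exp (-\<alpha> * t)"
      using norms(4) by (rule exE)
    show ?thesis
      by (rule exI[of _ \<Xi>1], rule exI[of _ \<Xi>2], rule exI[of _ \<Xi>3], rule exI[of _ \<Xi>4])
         (use 1 2 3 4 in blast)
  qed
  show ?thesis
    by (rule exI[of _ v], rule exI[of _ \<phi>], rule exI[of _ q], rule exI[of _ r], intro conjI allI sm norm_bounds)
       (use v alpha in auto)
qed

end
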